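(* Let $V:f=0$ be a hypersurface of degree $d$ in $\mathbb{P}^n$ which is tame with respect to the subset $\hat\rho=(\rho_1,\ldots,\rho_{n-1})$ of a minimal set of homogeneous generators $\rho_1,\ldots,\rho_m$ of $D_0(f)$, with (unordered) exponents $(d_1,\ldots,d_m)$, $d_j=\deg\rho_j$, for some $m\ge n$. Then the following hold. \begin{enumerate} \item The Bourbaki ideal $B(f,\hat\rho)\subset S$ is saturated and $\dim S/B(f,\hat\rho)\le n-1$. Moreover, the minimal number of generators of $B(f,\hat\rho)$ is $m-n+1$. \item The hypersurface $V:f=0$ is free if and only if $B(f,\hat\rho)=S$. \item The hypersurface $V:f=0$ is an $(n+1)$-syzygy hypersurface (that is, $m=n+1$) if and only if the ideal $B(f,\hat\rho)$ is a codimension 2 complete intersection. \item For any $j\ge n$ one has $$d_1+\ldots+d_{n-1}+d_j\ge d-1,$$ and the equality holds for some $j\ge n$ if and only if the tame hypersurface $V$ is free. \end{enumerate}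
   Context: Let $n\ge 2$, $S=\mathbb{C}[x_0,\ldots,x_n]$ with the standard grading, and let $V:f=0$ be a reduced hypersurface of degree $d\ge 3$ in $\mathbb{P}^n$ ($f\in S$ homogeneous of degree $d$ and square-free), which is not a cone over a hypersurface in $\mathbb{P}^{n-1}$. Write $f_j=\partial f/\partial x_j$ and $$D_0(f)=\{\rho=(a_0,\ldots,a_n)\in S^{n+1}: \sum_{j=0}^n a_jf_j=0\},$$ a graded $S$-module of rank $n$, where a syzygy $\rho$ is homogeneous of degree $e$ if all its components are homogeneous of degree $e$. $V$ is an $m$-syzygy hypersurface if $D_0(f)$ is minimally generated by $m$ homogeneous syzygies $\rho_1,\ldots,\rho_m$; their degrees $d_j=\deg\rho_j$ are the exponents of $V$. One always has $m\ge n$, and $V$ is free if $m=n$ (equivalently, $D_0(f)$ is a free $S$-module). For $\hat\rho=(\rho_1,\ldots,\rho_{n-1})$ a subset of a minimal set of homogeneous generators of $D_0(f)$ (no ordering of the degrees assumed), consider the sequence $$0\to S(-d_1)\oplus\cdots\oplus S(-d_{n-1})\xrightarrow{u} D_0(f)\xrightarrow{v} B(f,\hat\rho)(d_1+\ldots+d_{n-1}-d+1)\to 0,\qquad( * )$$ where $u(a_1,\ldots,a_{n-1})=\sum_{j=1}^{n-1}a_j\rho_j$, and, for $\rho\in D_0(f)$, $v(\rho)=\det M(\hat\rho,\rho)/f$, where $M(\hat\rho,\rho)$ is the $(n+1)\times(n+1)$-matrix whose first row is $(x_0,\ldots,x_n)$, whose $j$-th row for $2\le j\le n$ consists of the components of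 $\rho_{j-1}$, and whose last row consists of the components of $\rho$ (this determinant is divisible by $f$). The Bourbaki ideal $B(f,\hat\rho)\subset S$ is the homogeneous ideal $\{v(\rho):\rho\in D_0(f)\}$ (the image of $v$, with degrees shifted so that it is a graded ideal of $S$). $V$ is tame with respect to $\hat\rho$ if the sequence $( * )$ is exact. A homogeneous ideal is saturated if it equals its saturation with respect to the irrelevant ideal $(x_0,\ldots,x_n)$; $\dim$ denotes Krull dimension (negative for the zero ring). *)

theory Defs
  imports
    "HOL-Analysis.Analysis"
    "HOL-Library.Poly_Mapping"
    "HOL-Library.Extended_Nat"
    "HOL-Library.Extended_Real"
    "HOL-Computational_Algebra.Squarefree"
    "HOL-Algebra.QuotRing"
    "HOL-Algebra.Ideal_Product"
begin

section \<open>The polynomial ring\<close>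

text \<open>
  \<open>S = \<complex>[x\<^sub>0, \<dots>, x\<^sub>n]\<close> is the type \<open>'v mpoly\<close>. The variables \<open>x\<^sub>0, \<dots>, x\<^sub>n\<close> are indexed by a finite linearly ordered type \<open>'v\<close> with
  \<open>n + 1\<close> elements, listed in increasing order. The order is only used to number the rows of the
  matrix \<open>M(\<rho>\<^sub>1, \<dots>, \<rho>\<^sub>n\<^sub>-\<^sub>1, \<rho>)\<close> below. Elements of \<open>S\<^sup>n\<^sup>+\<^sup>1\<close> are vectors of
  type \<open>'v mvec\<close>.
\<close>

type_synonym 'v mpoly = "('v \<Rightarrow>\<^sub>0 nat) \<Rightarrow>\<^sub>0 complex"

type_synonym 'v mvec = "('v mpoly, 'v) vec"

definition const :: "complex \<Rightarrow> 'v mpoly" where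
  "const c = Poly_Mapping.single 0 c"

definition var :: "'v \<Rightarrow> 'v mpoly" where
  "var j = Poly_Mapping.single (Poly_Mapping.single j 1) 1"

definition total_deg :: "('v::finite \<Rightarrow>\<^sub>0 nat) \<Rightarrow> nat" where
  "total_deg t = (\<Sum>j\<in>UNIV. Poly_Mapping.lookup t j)"

text \<open>The zero polynomial is homogeneous of every degree.\<close>

definition homogeneous :: "nat \<Rightarrow> ('v::finite) mpoly \<Rightarrow> bool" where
  "homogeneous e p \<longleftrightarrow> (\<forall>t\<in>Poly_Mapping.keys p. total_deg t = e)"

text \<open>In the summand below, \<open>t - single j 1\<close> is truncated if \<open>x\<^sub>j\<close> does not occur in the monomial
  \<open>t\<close>; the coefficient is then \<open>0\<close>.\<close>

definition partial :: "'v \<Rightarrow> 'v mpoly \<Rightarrow> 'v mpoly" where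
  "partial j p = (\<Sum>t\<in>Poly_Mapping.keys p.
     Poly_Mapping.single (t - Poly_Mapping.single j 1)
       (of_nat (Poly_Mapping.lookup t j) * Poly_Mapping.lookup p t))"

definition linear_subst :: "complex ^ 'v ^ 'v \<Rightarrow> ('v::finite) mpoly \<Rightarrow> 'v mpoly" where
  "linear_subst A p = (\<Sum>t\<in>Poly_Mapping.keys p. const (Poly_Mapping.lookup p t) *
     (\<Prod>i\<in>UNIV. (\<Sum>j\<in>UNIV. const (A $ i $ j) * var j) ^ Poly_Mapping.lookup t i))"

text \<open>\<open>f = 0\<close> is a cone over a hypersurface in \<open>\<P>\<^sup>n\<^sup>-\<^sup>1\<close> if, in suitable linear coordinates, its
  equation does not involve one of the variables.\<close>

definition is_cone :: "('v::finite) mpoly \<Rightarrow> bool" where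
  "is_cone f \<longleftrightarrow> (\<exists>A::complex ^ 'v ^ 'v. invertible A \<and>
     (\<exists>k. \<forall>t\<in>Poly_Mapping.keys (linear_subst A f). Poly_Mapping.lookup t k = 0))"


section \<open>Ideals\<close>

definition poly_ring :: "('v mpoly) ring" where
  "poly_ring = \<lparr>carrier = UNIV, mult = (*), one = 1, zero = 0, add = (+)\<rparr>"

text \<open>Chains of primes \<open>P\<^sub>0 \<subset> P\<^sub>1 \<subset> \<dots> \<subset> P\<^sub>k\<close>, of length \<open>k\<close>.\<close>

definition prime_chain :: "('a, 'b) ring_scheme \<Rightarrow> (nat \<Rightarrow> 'a set) \<Rightarrow> nat \<Rightarrow> bool" where
  "prime_chain R P k \<longleftrightarrow> (\<forall>i\<le>k. primeideal (P i) R) \<and> (\<forall>i<k. P i \<subset> P (Suc i))"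

text \<open>The dimension of the zero ring is \<open>- \<infinity>\<close>, the supremum of the empty set in \<open>ereal\<close>.\<close>

definition krull_dim :: "('a, 'b) ring_scheme \<Rightarrow> ereal" where
  "krull_dim R = (SUP k\<in>{k. \<exists>P. prime_chain R P k}. ereal (real k))"

definition height :: "('a, 'b) ring_scheme \<Rightarrow> 'a set \<Rightarrow> enat" where
  "height R Q = (SUP k\<in>{k. \<exists>P. prime_chain R P k \<and> P k = Q}. enat k)"

text \<open>The unit ideal has codimension \<open>\<infinity>\<close>.\<close>

definition codim :: "('a, 'b) ring_scheme \<Rightarrow> 'a set \<Rightarrow> enat" where
  "codim R I = (INF Q\<in>{Q. primeideal Q R \<and> I \<subseteq> Q}. height R Q)"

definition min_num_gens :: "('a, 'b) ring_scheme \<Rightarrow> 'a set \<Rightarrow> enat" where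
  "min_num_gens R I =
     (INF G\<in>{G. finite G \<and> G \<subseteq> carrier R \<and> genideal R G = I}. enat (card G))"

definition complete_intersection :: "nat \<Rightarrow> (('v::finite) mpoly) set \<Rightarrow> bool" where
  "complete_intersection c I \<longleftrightarrow> codim poly_ring I = enat c \<and>
     (\<exists>G. finite G \<and> card G = c \<and> (\<forall>g\<in>G. \<exists>e. homogeneous e g) \<and> genideal poly_ring G = I)"

definition irrelevant_ideal :: "('v mpoly) set" where
  "irrelevant_ideal = genideal poly_ring (range var)"

primrec irrelevant_power :: "nat \<Rightarrow> ('v mpoly) set" where
  "irrelevant_power 0 = carrier poly_ring"
| "irrelevant_power (Suc k) = ideal_prod poly_ring irrelevant_ideal (irrelevant_power k)"

definition saturation :: "('v mpoly) set \<Rightarrow> ('v mpoly) set" where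
  "saturation I = (\<Union>k. {g. \<forall>h\<in>irrelevant_power k. h * g \<in> I})"

definition saturated :: "('v mpoly) set \<Rightarrow> bool" where
  "saturated I \<longleftrightarrow> saturation I = I"


section \<open>Jacobian syzygies\<close>

definition D0 :: "('v::finite) mpoly \<Rightarrow> ('v mvec) set" where
  "D0 f = {a. (\<Sum>j\<in>UNIV. a $ j * partial j f) = 0}"

definition homogeneous_vec :: "nat \<Rightarrow> ('v::finite) mvec \<Rightarrow> bool" where
  "homogeneous_vec e a \<longleftrightarrow> (\<forall>j. homogeneous e (a $ j))"

definition minimal_generators ::
  "('v::finite) mpoly \<Rightarrow> nat \<Rightarrow> (nat \<Rightarrow> 'v mvec) \<Rightarrow> (nat \<Rightarrow> nat) \<Rightarrow> bool" where
  "minimal_generators f m \<rho> d \<longleftrightarrow>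
     (\<forall>j\<in>{1..m}. \<rho> j \<in> D0 f \<and> homogeneous_vec (d j) (\<rho> j)) \<and>
     module.span (*s) (\<rho> ` {1..m}) = D0 f \<and>
     (\<forall>j\<in>{1..m}. module.span (*s) (\<rho> ` ({1..m} - {j})) \<noteq> D0 f)"

definition syzygy_hypersurface :: "nat \<Rightarrow> ('v::finite) mpoly \<Rightarrow> bool" where
  "syzygy_hypersurface m f \<longleftrightarrow> (\<exists>\<rho> d. minimal_generators f m \<rho> d)"

text \<open>\<open>V : f = 0\<close> in \<open>\<P>\<^sup>n\<close> is free.\<close>

definition free_hypersurface :: "nat \<Rightarrow> ('v::finite) mpoly \<Rightarrow> bool" where
  "free_hypersurface n f \<longleftrightarrow> syzygy_hypersurface n f"


section \<open>The Bourbaki ideal and tameness\<close>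

text \<open>
  In the following, \<open>\<rho>\<close> is a sequence of syzygies of which only \<open>\<rho> 1, \<dots>, \<rho> (n - 1)\<close> are used.
  The rows of the matrix are indexed by \<open>'v\<close>; \<open>position i\<close> is the number, counted from \<open>0\<close>, of the
  row \<open>i\<close>.
\<close>

definition position :: "'v::{finite, linorder} \<Rightarrow> nat" where
  "position i = card {..<i}"

definition syzygy_matrix ::
  "nat \<Rightarrow> (nat \<Rightarrow> ('v::{finite, linorder}) mvec) \<Rightarrow> 'v mvec \<Rightarrow> ('v mvec, 'v) vec" where
  "syzygy_matrix n \<rho> \<sigma> =
     (\<chi> i. if position i = 0 then (\<chi> j. var j)
          else if position i < n then \<rho> (position i)
          else \<sigma>)"

text \<open>The quotient \<open>det M / f\<close>: \<open>S\<close> is a domain and, for \<open>\<rho> 1, \<dots>, \<rho> (n - 1), \<sigma> \<in> D0 f\<close> and square-free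
  homogeneous \<open>f\<close> of positive degree, it exists and is unique.\<close>

definition bourbaki_map ::
  "nat \<Rightarrow> ('v::{finite, linorder}) mpoly \<Rightarrow> (nat \<Rightarrow> 'v mvec) \<Rightarrow> 'v mvec \<Rightarrow> 'v mpoly" where
  "bourbaki_map n f \<rho> \<sigma> = (THE q. det (syzygy_matrix n \<rho> \<sigma>) = q * f)"

definition bourbaki_ideal ::
  "nat \<Rightarrow> ('v::{finite, linorder}) mpoly \<Rightarrow> (nat \<Rightarrow> 'v mvec) \<Rightarrow> ('v mpoly) set" where
  "bourbaki_ideal n f \<rho> = bourbaki_map n f \<rho> ` D0 f"

definition syzygy_combination ::
  "nat \<Rightarrow> (nat \<Rightarrow> ('v::finite) mvec) \<Rightarrow> (nat \<Rightarrow> 'v mpoly) \<Rightarrow> 'v mvec" where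
  "syzygy_combination n \<rho> a = (\<Sum>j\<in>{1..n - 1}. a j *s \<rho> j)"

text \<open>Exactness of \<open>0 \<rightarrow> A \<rightarrow> M \<rightarrow> B \<rightarrow> 0\<close> for additive maps \<open>u : A \<rightarrow> M\<close> and \<open>v : M \<rightarrow> B\<close>, given on
  carrier sets. Injectivity of \<open>u\<close> is exactness at \<open>A\<close>.\<close>

definition short_exact ::
  "'a set \<Rightarrow> ('a \<Rightarrow> 'b) \<Rightarrow> 'b set \<Rightarrow> ('b \<Rightarrow> 'c::zero) \<Rightarrow> 'c set \<Rightarrow> bool" where
  "short_exact A u M v B \<longleftrightarrow> inj_on u A \<and> u ` A = {x\<in>M. v x = 0} \<and> v ` M = B"

text \<open>The free module \<open>S(-d\<^sub>1) \<oplus> \<dots> \<oplus> S(-d\<^sub>n\<^sub>-\<^sub>1)\<close> is the set of families in \<open>S\<close> indexed by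
  \<open>{1..n - 1}\<close>; the degree shifts play no role for exactness.\<close>

definition tame ::
  "nat \<Rightarrow> ('v::{finite, linorder}) mpoly \<Rightarrow> (nat \<Rightarrow> 'v mvec) \<Rightarrow> bool" where
  "tame n f \<rho> \<longleftrightarrow>
     short_exact ({1..n - 1} \<rightarrow>\<^sub>E UNIV) (syzygy_combination n \<rho>) (D0 f)
       (bourbaki_map n f \<rho>) (bourbaki_ideal n f \<rho>)"

end

theory Submission
  imports Defs
begin

text \<open>
  Everything is read off the exact sequence \<open>0 \<rightarrow> S\<^sup>n\<^sup>-\<^sup>1 \<rightarrow> D\<^sub>0(f) \<rightarrow> B \<rightarrow> 0\<close>. The images of \<open>\<rho>\<^sub>n, \<dots>, \<rho>\<^sub>m\<close> generate \<open>B\<close>, and by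
  minimality of the \<open>\<rho>\<^sub>j\<close> every relation among them has coefficients in the maximal ideal, so by Nakayama
  \<open>B\<close> needs \<open>m - n + 1\<close> generators. Saturation holds because \<open>S\<^sup>n\<^sup>-\<^sup>1\<close> has depth at least \<open>3\<close> and \<open>D\<^sub>0(f)\<close>
  is a second syzygy module. No prime element \<open>p\<close> divides all of \<open>B\<close>, since \<open>D\<^sub>0(f)\<close> is free at \<open>p\<close> with
  determinant \<open>f\<close> up to a unit; hence \<open>B\<close> has codimension at least \<open>2\<close>, and is \<open>S\<close> if it is principal. The
  degree of \<open>v(\<rho>\<^sub>j)\<close> is \<open>d\<^sub>1 + \<dots> + d\<^sub>n\<^sub>-\<^sub>1 + d\<^sub>j - (d - 1)\<close>, which gives the last claim.

  Two facts of commutative algebra have elementary proofs here. A chain of primes of length \<open>k\<close> yields \<open>k\<close>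
  algebraically independent polynomials, which bounds \<open>k\<close> by counting monomials. For two forms \<open>b\<^sub>1, b\<^sub>2\<close> of
  positive degree, counting also shows that some \<open>CARD('v) - 2\<close> variables are algebraically independent modulo
  \<open>(b\<^sub>1, b\<^sub>2)\<close>; a prime over \<open>(b\<^sub>1, b\<^sub>2)\<close> in which they stay independent has height at most \<open>2\<close>.
\<close>


section \<open>Weighted degrees\<close>

text \<open>The equivalence with complete intersections needs codimension at most 2 for an ideal of
  two forms, a case of Krull's height theorem. Since the codimension is an infimum, one prime of
  height at most 2 is enough, and counting dimensions over \<complex> finds it. Other tools are made
  explicit in the same spirit. Localisation at \<open>p\<close> becomes multiplication by a factor
  prime to \<open>p\<close>, depth becomes the regularity of three distinct variables, which exist
  because \<open>n \<ge> 2\<close>, and the residue field is seen through constant terms. Common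
  divisors of \<open>B\<close> are tested on prime elements, so irreducible polynomials must be
  shown to be prime; this is done by adjoining one variable at a time. The order on
  \<open>'v\<close> also orders the monomials compatibly with addition. Hence there are no zero
  divisors, and every nonzero polynomial has a leading monomial.\<close>

definition wt :: "('v::finite \<Rightarrow> nat) \<Rightarrow> ('v \<Rightarrow>\<^sub>0 nat) \<Rightarrow> nat" where
  "wt w t = (\<Sum>j\<in>UNIV. w j * Poly_Mapping.lookup t j)"

definition whomog :: "('v::finite \<Rightarrow> nat) \<Rightarrow> nat \<Rightarrow> 'v mpoly \<Rightarrow> bool" where
  "whomog w k p \<longleftrightarrow> (\<forall>t\<in>Poly_Mapping.keys p. wt w t = k)"

definition wpart :: "('v::finite \<Rightarrow> nat) \<Rightarrow> nat \<Rightarrow> 'v mpoly \<Rightarrow> 'v mpoly" where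
  "wpart w k p = (\<Sum>t\<in>{t\<in>Poly_Mapping.keys p. wt w t = k}. Poly_Mapping.single t (Poly_Mapping.lookup p t))"

text \<open>The \<open>insert 0\<close> gives the zero polynomial degree 0 under every weight, so
  tests for units must exclude \<open>p = 0\<close> separately.\<close>

definition wdeg :: "('v::finite \<Rightarrow> nat) \<Rightarrow> 'v mpoly \<Rightarrow> nat" where
  "wdeg w p = Max (insert 0 (wt w ` Poly_Mapping.keys p))"

lemma wt_zero [simp]: "wt w 0 = 0"
  by (simp add: wt_def)

lemma wt_add: "wt w (s + t) = wt w s + wt w t"
  by (simp add: wt_def lookup_add sum.distrib distrib_left)

lemma wt_single [simp]: "wt w (Poly_Mapping.single j k) = w j * k"
proof -
  have "wt w (Poly_Mapping.single j k) = (\<Sum>i\<in>UNIV. if i = j then w j * k else 0)"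
    unfolding wt_def by (intro sum.cong) (auto simp: lookup_single when_def)
  then show ?thesis by simp
qed

definition unit_wt :: "'v \<Rightarrow> nat" where
  "unit_wt j = 1"

text \<open>Under this weight the degree is the degree in \<open>x_j\<close>, so the lemmas on
  gradings also decide which variables occur and which powers of a variable divide.\<close>

definition var_wt :: "'v \<Rightarrow> 'v \<Rightarrow> nat" where
  "var_wt j i = (if i = j then 1 else 0)"

lemma wt_unit: "wt unit_wt = total_deg"
  by (rule ext) (simp add: wt_def total_deg_def unit_wt_def)

lemma wt_var: "wt (var_wt j) t = Poly_Mapping.lookup t j"
proof -
  have "wt (var_wt j) t = (\<Sum>i\<in>UNIV. if i = j then Poly_Mapping.lookup t i else 0)"
    unfolding wt_def var_wt_def by (intro sum.cong) auto
  then show ?thesis by simp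
qed

lemma homogeneous_iff_whomog: "homogeneous e p \<longleftrightarrow> whomog unit_wt e p"
  by (simp only: homogeneous_def whomog_def wt_unit)

lemma poly_mapping_sum_keys: "p = (\<Sum>t\<in>Poly_Mapping.keys p. Poly_Mapping.single t (Poly_Mapping.lookup p t))"
  by (rule poly_mapping_eqI)
    (auto simp: lookup_sum lookup_single when_def sum.If_cases in_keys_iff)

lemma lookup_wpart: "Poly_Mapping.lookup (wpart w k p) t = (if wt w t = k then Poly_Mapping.lookup p t else 0)"
proof -
  have "Poly_Mapping.lookup (wpart w k p) t
    = (\<Sum>s\<in>{s \<in> Poly_Mapping.keys p. wt w s = k}. if s = t then Poly_Mapping.lookup p s else 0)"
    unfolding wpart_def lookup_sum by (intro sum.cong) (auto simp: lookup_single when_def)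
  then show ?thesis by (auto simp: in_keys_iff)
qed

lemma keys_wpart: "Poly_Mapping.keys (wpart w k p) = {t\<in>Poly_Mapping.keys p. wt w t = k}"
  by (auto simp: in_keys_iff lookup_wpart split: if_splits)

lemma whomog_wpart: "whomog w k (wpart w k p)"
  by (simp add: whomog_def keys_wpart)

lemma wpart_add: "wpart w k (p + q) = wpart w k p + wpart w k q"
  by (rule poly_mapping_eqI) (simp add: lookup_wpart lookup_add)

lemma wpart_zero [simp]: "wpart w k 0 = 0"
  by (rule poly_mapping_eqI) (simp add: lookup_wpart)

lemma wpart_sum: "wpart w k (sum g I) = (\<Sum>i\<in>I. wpart w k (g i))"
  by (induction I rule: infinite_finite_induct) (auto simp: wpart_add)

lemma wpart_whomog: "whomog w k p \<Longrightarrow> wpart w l p = (if l = k then p else 0)"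
  by (rule poly_mapping_eqI) (auto simp: lookup_wpart whomog_def in_keys_iff)

lemma whomog_zero [simp]: "whomog w k 0"
  by (simp add: whomog_def)

lemma whomog_add: "whomog w k p \<Longrightarrow> whomog w k q \<Longrightarrow> whomog w k (p + q)"
  using keys_add[of p q] by (auto simp: whomog_def)

lemma whomog_diff: "whomog w k p \<Longrightarrow> whomog w k q \<Longrightarrow> whomog w k (p - q)"
  using keys_diff[of p q] by (auto simp: whomog_def)

lemma whomog_sum: "(\<And>i. i \<in> I \<Longrightarrow> whomog w k (g i)) \<Longrightarrow> whomog w k (sum g I)"
  by (induction I rule: infinite_finite_induct) (auto intro: whomog_add)

lemma whomog_mult: "whomog w k p \<Longrightarrow> whomog w l q \<Longrightarrow> whomog w (k + l) (p * q)"
  using keys_mult[of p q] by (fastforce simp: whomog_def wt_add)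

lemma whomog_one: "whomog w 0 1"
  by (simp add: whomog_def)

lemma whomog_const: "whomog w 0 (const c)"
  by (simp add: whomog_def const_def)

lemma whomog_var: "whomog w (w j) (var j)"
  by (simp add: whomog_def var_def)

lemma whomog_prod:
  "finite I \<Longrightarrow> (\<And>i. i \<in> I \<Longrightarrow> whomog w (k i) (g i)) \<Longrightarrow> whomog w (sum k I) (prod g I)"
  by (induction I rule: finite_induct) (auto intro: whomog_mult whomog_one)

lemma whomog_power: "whomog w k p \<Longrightarrow> whomog w (n * k) (p ^ n)"
  by (induction n) (auto intro: whomog_mult whomog_one)

lemma sum_wpart: "(\<Sum>k\<in>wt w ` Poly_Mapping.keys p. wpart w k p) = p"
proof (rule poly_mapping_eqI)
  fix t
  show "Poly_Mapping.lookup (\<Sum>k\<in>wt w ` Poly_Mapping.keys p. wpart w k p) t = Poly_Mapping.lookup p t"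
    by (cases "t \<in> Poly_Mapping.keys p") (auto simp: lookup_sum lookup_wpart in_keys_iff)
qed

text \<open>Multiplication by a form shifts components, which turns an arbitrary equation into
  homogeneous ones. The case split keeps the truncated \<open>m - k\<close> from selecting the
  component of weight 0.\<close>

lemma wpart_whomog_mult:
  assumes "whomog w k p"
  shows "wpart w m (p * q) = (if k \<le> m then p * wpart w (m - k) q else 0)"
proof -
  have "p * q = p * (\<Sum>l\<in>wt w ` Poly_Mapping.keys q. wpart w l q)"
    by (simp only: sum_wpart)
  also have "\<dots> = (\<Sum>l\<in>wt w ` Poly_Mapping.keys q. p * wpart w l q)"
    by (simp add: sum_distrib_left)
  finally have "wpart w m (p * q) = (\<Sum>l\<in>wt w ` Poly_Mapping.keys q. wpart w m (p * wpart w l q))"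
    by (simp add: wpart_sum)
  also have "\<dots> = (\<Sum>l\<in>wt w ` Poly_Mapping.keys q. if m = k + l then p * wpart w l q else 0)"
    by (intro sum.cong refl wpart_whomog whomog_mult assms whomog_wpart)
  also have "\<dots> = (if k \<le> m then p * wpart w (m - k) q else 0)"
  proof (cases "k \<le> m \<and> m - k \<in> wt w ` Poly_Mapping.keys q")
    case True
    have "(\<Sum>l\<in>wt w ` Poly_Mapping.keys q. if m = k + l then p * wpart w l q else 0)
      = (\<Sum>l\<in>wt w ` Poly_Mapping.keys q. if l = m - k then p * wpart w l q else 0)"
      using True by (intro sum.cong) auto
    then show ?thesis using True by simp
  next
    case False
    have 1: "(\<Sum>l\<in>wt w ` Poly_Mapping.keys q. if m = k + l then p * wpart w l q else 0) = 0"
      using False by (intro sum.neutral) auto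
    have "k \<le> m \<Longrightarrow> wpart w (m - k) q = 0"
      using False unfolding keys_eq_empty[symmetric] keys_wpart by force
    with 1 show ?thesis by simp
  qed
  finally show ?thesis .
qed

lemma wt_le_wdeg: "t \<in> Poly_Mapping.keys p \<Longrightarrow> wt w t \<le> wdeg w p"
  by (simp add: wdeg_def)

lemma wdeg_le: "(\<And>t. t \<in> Poly_Mapping.keys p \<Longrightarrow> wt w t \<le> k) \<Longrightarrow> wdeg w p \<le> k"
  by (auto simp: wdeg_def)

lemma wdeg_attained:
  assumes "p \<noteq> 0" obtains t where "t \<in> Poly_Mapping.keys p" "wt w t = wdeg w p"
proof -
  have "wdeg w p \<in> insert 0 (wt w ` Poly_Mapping.keys p)"
    unfolding wdeg_def by (intro Max_in) auto
  then show ?thesis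
  proof
    assume "wdeg w p = 0"
    moreover obtain t where "t \<in> Poly_Mapping.keys p" using assms by fastforce
    ultimately show ?thesis using that wt_le_wdeg[of t p w] by auto
  qed (use that in auto)
qed

lemma wpart_wdeg_nonzero: "p \<noteq> 0 \<Longrightarrow> wpart w (wdeg w p) p \<noteq> 0"
  by (metis (mono_tags, lifting) wdeg_attained keys_wpart keys_zero empty_iff mem_Collect_eq)

lemma wpart_gt_wdeg: "wdeg w p < k \<Longrightarrow> wpart w k p = 0"
  by (rule poly_mapping_eqI) (use wt_le_wdeg[of _ p w] in \<open>force simp: lookup_wpart in_keys_iff\<close>)

lemma wpart_mult_wdeg:
  "wpart w (wdeg w p + wdeg w q) (p * q) = wpart w (wdeg w p) p * wpart w (wdeg w q) q"
proof -
  let ?k = "wdeg w p" and ?l = "wdeg w q"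
  let ?K = "wt w ` Poly_Mapping.keys p"
  have "p * q = (\<Sum>k\<in>?K. wpart w k p) * q"
    by (simp only: sum_wpart)
  then have "wpart w (?k + ?l) (p * q) = (\<Sum>k\<in>?K. wpart w (?k + ?l) (wpart w k p * q))"
    by (simp add: sum_distrib_right wpart_sum)
  also have "\<dots> = (\<Sum>k\<in>?K. if k = ?k then wpart w k p * wpart w ?l q else 0)"
  proof (rule sum.cong)
    fix k assume "k \<in> ?K"
    then have "k \<le> ?k" by (auto intro: wt_le_wdeg)
    \<comment> \<open>For \<open>k < ?k\<close> the complementary component of \<open>q\<close>
      would have weight above \<open>wdeg w q\<close>.\<close>
    then show "wpart w (?k + ?l) (wpart w k p * q) = (if k = ?k then wpart w k p * wpart w ?l q else 0)"
      by (auto simp: wpart_whomog_mult[OF whomog_wpart] wpart_gt_wdeg)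
  qed simp
  also have "\<dots> = wpart w ?k p * wpart w ?l q"
  proof (cases "p = 0")
    case False
    then have "?k \<in> ?K" by (metis wdeg_attained imageI)
    then show ?thesis by simp
  qed simp
  finally show ?thesis .
qed

text \<open>The lower bound holds because the product of the two top components is nonzero in a
  domain.\<close>

lemma wdeg_mult:
  fixes p q :: "('v::{finite,linorder}) mpoly"
  assumes "p \<noteq> 0" "q \<noteq> 0"
  shows "wdeg w (p * q) = wdeg w p + wdeg w q"
proof (rule antisym)
  show "wdeg w (p * q) \<le> wdeg w p + wdeg w q"
  proof (rule wdeg_le)
    fix t assume "t \<in> Poly_Mapping.keys (p * q)"
    then obtain a b where "t = a + b" "a \<in> Poly_Mapping.keys p" "b \<in> Poly_Mapping.keys q"
      using keys_mult[of p q] by blast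
    then show "wt w t \<le> wdeg w p + wdeg w q"
      by (simp add: wt_add add_mono wt_le_wdeg)
  qed
  have "wpart w (wdeg w p + wdeg w q) (p * q) \<noteq> 0"
    using assms by (simp add: wpart_mult_wdeg wpart_wdeg_nonzero)
  then show "wdeg w p + wdeg w q \<le> wdeg w (p * q)"
    using wpart_gt_wdeg[of w "p * q" "wdeg w p + wdeg w q"] by linarith
qed

lemma wdeg_whomog: "whomog w k p \<Longrightarrow> p \<noteq> 0 \<Longrightarrow> wdeg w p = k"
  by (metis wdeg_attained whomog_def)

section \<open>Total degree, constants and units\<close>

abbreviation tdeg :: "('v::finite) mpoly \<Rightarrow> nat" where
  "tdeg \<equiv> wdeg unit_wt"

lemma lookup_pm_zero_iff: "(\<forall>j. Poly_Mapping.lookup t j = 0) \<longleftrightarrow> t = 0"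
  by (auto intro: poly_mapping_eqI)

lemma wt_unit_zero_iff: "wt unit_wt t = 0 \<longleftrightarrow> t = 0"
  by (simp add: wt_def unit_wt_def lookup_pm_zero_iff)

lemma tdeg_zero_iff: "tdeg p = 0 \<longleftrightarrow> (\<exists>c. p = const c)"
proof
  assume *: "tdeg p = 0"
  have "p = const (Poly_Mapping.lookup p 0)"
  proof (rule poly_mapping_eqI)
    fix t
    show "Poly_Mapping.lookup p t = Poly_Mapping.lookup (const (Poly_Mapping.lookup p 0)) t"
      using * wt_le_wdeg[of t p unit_wt]
      by (cases "t = 0") (auto simp: const_def lookup_single when_def wt_unit_zero_iff in_keys_iff)
  qed
  then show "\<exists>c. p = const c" ..
next
  assume "\<exists>c. p = const c"
  then show "tdeg p = 0" by (auto simp: const_def wdeg_def)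
qed

lemma const_mult: "const (a * b) = const a * const b"
  by (simp add: const_def mult_single)

lemma const_one [simp]: "const 1 = 1"
  by (simp add: const_def)

lemma const_zero [simp]: "const 0 = 0"
  by (simp add: const_def)

lemma const_add: "const (a + b) = const a + const b"
  by (simp add: const_def single_add)

lemma const_eq_0_iff [simp]: "const a = 0 \<longleftrightarrow> a = 0"
  by (metis const_def const_zero lookup_single_eq)

lemma const_sum: "const (sum g I) = (\<Sum>i\<in>I. const (g i))"
  by (induction I rule: infinite_finite_induct) (auto simp: const_add)

lemma lookup_const_mult: "Poly_Mapping.lookup (const c * p) t = c * Poly_Mapping.lookup p t"
  unfolding const_def
  by (transfer, simp add: prod_fun_def when_mult)

lemma const_dvd_one: "c \<noteq> 0 \<Longrightarrow> const c dvd 1"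
  by (rule dvdI[of _ _ "const (1 / c)"]) (simp flip: const_mult)

lemma unit_iff:
  fixes p :: "('v::{finite,linorder}) mpoly"
  shows "p dvd 1 \<longleftrightarrow> p \<noteq> 0 \<and> tdeg p = 0"
proof
  assume "p dvd 1"
  then obtain q where q: "1 = p * q" by (auto elim: dvdE)
  then have "p \<noteq> 0" "q \<noteq> 0" by auto
  then have "tdeg p + tdeg q = tdeg (1 :: 'v mpoly)" using wdeg_mult[of p q unit_wt] q by simp
  moreover have "tdeg (1 :: 'v mpoly) = 0" by (simp add: wdeg_def)
  ultimately show "p \<noteq> 0 \<and> tdeg p = 0" using \<open>p \<noteq> 0\<close> by simp
next
  assume "p \<noteq> 0 \<and> tdeg p = 0"
  then show "p dvd 1" using tdeg_zero_iff const_dvd_one by (metis const_zero)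
qed

lemma dvd_imp_wdeg_le:
  fixes p :: "('v::{finite,linorder}) mpoly"
  shows "p dvd q \<Longrightarrow> q \<noteq> 0 \<Longrightarrow> wdeg w p \<le> wdeg w q"
  by (metis dvd_def le_add1 mult_eq_0_iff wdeg_mult)

lemma lookup_monom_mult:
  "Poly_Mapping.lookup (Poly_Mapping.single s c * p) (s + t) = c * Poly_Mapping.lookup p t"
  for s :: "'v \<Rightarrow>\<^sub>0 nat" and p :: "'v mpoly"
  by transfer (simp add: prod_fun_def when_mult)

lemma keys_monom_mult: "c \<noteq> 0 \<Longrightarrow>
  Poly_Mapping.keys (Poly_Mapping.single s c * p) = (+) s ` Poly_Mapping.keys p"
  for s :: "'v \<Rightarrow>\<^sub>0 nat" and p :: "'v mpoly"
proof -
  assume c: "c \<noteq> 0"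
  have "Poly_Mapping.keys (Poly_Mapping.single s c * p) \<subseteq> (+) s ` Poly_Mapping.keys p"
    using keys_mult[of "Poly_Mapping.single s c" p] c by auto
  moreover have "(+) s ` Poly_Mapping.keys p \<subseteq> Poly_Mapping.keys (Poly_Mapping.single s c * p)"
    using c by (auto simp: in_keys_iff lookup_monom_mult)
  ultimately show ?thesis by blast
qed

text \<open>Descent on the total degree: a nonzero nonunit has positive degree, so splitting one off
  lowers the degree.\<close>

lemma irreducible_dvd_exists:
  fixes p :: "('v::{finite,linorder}) mpoly"
  assumes "p \<noteq> 0" "\<not> p dvd 1"
  shows "\<exists>q. irreducible q \<and> q dvd p"
  using assms
proof (induction "tdeg p" arbitrary: p rule: less_induct)
  case less
  show ?case
  proof (cases "irreducible p")
    case False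
    with less.prems obtain a b where ab: "p = a * b" "\<not> a dvd 1" "\<not> b dvd 1"
      unfolding irreducible_def by blast
    then have "a \<noteq> 0" "b \<noteq> 0" using less.prems by auto
    then have "tdeg a < tdeg p" using ab unit_iff[of b] by (simp add: wdeg_mult)
    then obtain q where "irreducible q" "q dvd a" using less.hyps \<open>a \<noteq> 0\<close> ab by blast
    then show ?thesis using ab by (metis dvd_mult2)
  qed auto
qed

section \<open>Irreducible polynomials are prime\<close>

text \<open>The polynomial subring on the variables in \<open>A\<close>, kept inside the one ambient
  ring so that an induction over \<open>A\<close> never changes the type.\<close>

definition polys :: "'v set \<Rightarrow> ('v mpoly) set" where
  "polys A = {p. \<forall>t\<in>Poly_Mapping.keys p. Poly_Mapping.keys t \<subseteq> A}"

lemma polys_iff: "p \<in> polys A \<longleftrightarrow> (\<forall>t\<in>Poly_Mapping.keys p. \<forall>i. i \<notin> A \<longrightarrow> Poly_Mapping.lookup t i = 0)"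
  unfolding polys_def mem_Collect_eq by (metis in_keys_iff subset_iff)

lemma polys_UNIV [simp]: "polys UNIV = UNIV"
  by (simp add: polys_def)

lemma polys_zero [simp]: "0 \<in> polys A"
  by (simp add: polys_def)

lemma polys_one [simp]: "1 \<in> polys A"
  by (simp add: polys_def)

lemma polys_const [simp]: "const c \<in> polys A"
  by (simp add: polys_def const_def)

lemma polys_var: "j \<in> A \<Longrightarrow> var j \<in> polys A"
  by (simp add: polys_def var_def)

lemma polys_add: "p \<in> polys A \<Longrightarrow> q \<in> polys A \<Longrightarrow> p + q \<in> polys A"
  using keys_add[of p q] by (auto simp: polys_def)

lemma polys_diff: "p \<in> polys A \<Longrightarrow> q \<in> polys A \<Longrightarrow> p - q \<in> polys A"
  using keys_diff[of p q] by (auto simp: polys_def)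

lemma polys_mult: "p \<in> polys A \<Longrightarrow> q \<in> polys A \<Longrightarrow> p * q \<in> polys A"
  unfolding polys_def
proof (intro CollectI ballI)
  fix t assume *: "p \<in> {p. \<forall>t\<in>Poly_Mapping.keys p. Poly_Mapping.keys t \<subseteq> A}"
    "q \<in> {p. \<forall>t\<in>Poly_Mapping.keys p. Poly_Mapping.keys t \<subseteq> A}"
  assume "t \<in> Poly_Mapping.keys (p * q)"
  then obtain a b where "t = a + b" "a \<in> Poly_Mapping.keys p" "b \<in> Poly_Mapping.keys q"
    using keys_mult[of p q] by blast
  then show "Poly_Mapping.keys t \<subseteq> A"
    using * keys_add[of a b] by blast
qed

lemma polys_power: "p \<in> polys A \<Longrightarrow> p ^ n \<in> polys A"
  by (induction n) (auto intro: polys_mult)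

lemma polys_sum: "(\<And>i. i \<in> I \<Longrightarrow> g i \<in> polys A) \<Longrightarrow> sum g I \<in> polys A"
  by (induction I rule: infinite_finite_induct) (auto intro: polys_add)

lemma polys_mono: "A \<subseteq> B \<Longrightarrow> polys A \<subseteq> polys B"
  by (auto simp: polys_def)

lemma polys_iff_wdeg:
  fixes p :: "('v::finite) mpoly"
  shows "p \<in> polys A \<longleftrightarrow> (\<forall>i. i \<notin> A \<longrightarrow> wdeg (var_wt i) p = 0)"
proof
  assume *: "p \<in> polys A"
  show "\<forall>i. i \<notin> A \<longrightarrow> wdeg (var_wt i) p = 0"
  proof (intro allI impI)
    fix i assume "i \<notin> A"
    then have "wdeg (var_wt i) p \<le> 0"
      using * by (intro wdeg_le) (auto simp: wt_var polys_iff)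
    then show "wdeg (var_wt i) p = 0" by simp
  qed
next
  assume *: "\<forall>i. i \<notin> A \<longrightarrow> wdeg (var_wt i) p = 0"
  show "p \<in> polys A"
    unfolding polys_iff
  proof (intro ballI allI impI)
    fix t i assume "t \<in> Poly_Mapping.keys p" "i \<notin> A"
    then show "Poly_Mapping.lookup t i = 0"
      using * wt_le_wdeg[of t p "var_wt i"] by (auto simp: wt_var)
  qed
qed

text \<open>The degrees of the two factors in a variable outside \<open>A\<close> add up to 0, so
  both are 0. Quotients of elements of the subring thus stay in it.\<close>

lemma polys_factor:
  fixes p q :: "('v::{finite,linorder}) mpoly"
  assumes "p * q \<in> polys A" "p \<noteq> 0"
  shows "q \<in> polys A"
proof (cases "q = 0")
  case False
  then show ?thesis using assms by (simp add: polys_iff_wdeg wdeg_mult)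
qed simp

lemma var_power: "var j ^ k = Poly_Mapping.single (Poly_Mapping.single j k) 1"
  by (induction k) (auto simp: var_def mult_single simp flip: single_add)

lemma var_neq_0 [simp]: "var j \<noteq> 0"
  unfolding var_def by (metis lookup_single_eq lookup_zero zero_neq_one)

lemma var_power_dvd:
  fixes p :: "('v::finite) mpoly"
  assumes "\<And>t. t \<in> Poly_Mapping.keys p \<Longrightarrow> k \<le> Poly_Mapping.lookup t j"
  shows "var j ^ k dvd p"
proof -
  let ?s = "Poly_Mapping.single j k"
  have "p = (\<Sum>t\<in>Poly_Mapping.keys p. Poly_Mapping.single t (Poly_Mapping.lookup p t))"
    by (rule poly_mapping_sum_keys)
  also have "\<dots> = (\<Sum>t\<in>Poly_Mapping.keys p. var j ^ k * Poly_Mapping.single (t - ?s) (Poly_Mapping.lookup p t))"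
  proof (rule sum.cong)
    fix t assume "t \<in> Poly_Mapping.keys p"
    then have "?s + (t - ?s) = t"
      using assms[of t] by (intro poly_mapping_eqI) (auto simp: lookup_add lookup_minus lookup_single when_def)
    then show "Poly_Mapping.single t (Poly_Mapping.lookup p t) =
        var j ^ k * Poly_Mapping.single (t - ?s) (Poly_Mapping.lookup p t)"
      by (simp add: var_power mult_single)
  qed simp
  also have "\<dots> = var j ^ k * (\<Sum>t\<in>Poly_Mapping.keys p. Poly_Mapping.single (t - ?s) (Poly_Mapping.lookup p t))"
    by (simp only: sum_distrib_left)
  finally show ?thesis by (rule dvdI)
qed

lemma var_dvd_keys: "var j dvd p \<Longrightarrow> t \<in> Poly_Mapping.keys p \<Longrightarrow> Poly_Mapping.lookup t j \<noteq> 0"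
  for p :: "('v::finite) mpoly"
  by (auto simp: var_def dvd_def keys_monom_mult lookup_add)

text \<open>The bound is strict, so that \<open>k = 0\<close> singles out the zero polynomial and
  inductions on \<open>k\<close> can start there.\<close>

definition degb :: "'v \<Rightarrow> nat \<Rightarrow> 'v mpoly \<Rightarrow> bool" where
  "degb j k p \<longleftrightarrow> (\<forall>t\<in>Poly_Mapping.keys p. Poly_Mapping.lookup t j < k)"

lemma degb_zero_iff: "degb j 0 p \<longleftrightarrow> p = 0"
  by (auto simp: degb_def)

lemma degb_zero [simp]: "degb j k 0"
  by (auto simp: degb_def)

lemma degb_exists:
  fixes p :: "('v::finite) mpoly"
  shows "\<exists>k. degb j k p"
  using wt_le_wdeg[of _ p "var_wt j"] by (intro exI[of _ "Suc (wdeg (var_wt j) p)"]) (auto simp: degb_def wt_var less_Suc_eq_le)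

lemma degb_mono: "degb j k p \<Longrightarrow> k \<le> l \<Longrightarrow> degb j l p"
  by (fastforce simp: degb_def)

lemma degb_diff: "degb j k p \<Longrightarrow> degb j k q \<Longrightarrow> degb j k (p - q)"
  using keys_diff[of p q] by (auto simp: degb_def)

lemma degb_mult_polys:
  assumes "c \<in> polys A" "j \<notin> A" "degb j k p"
  shows "degb j k (c * p)"
  unfolding degb_def
proof
  fix t assume "t \<in> Poly_Mapping.keys (c * p)"
  then obtain a b where "t = a + b" "a \<in> Poly_Mapping.keys c" "b \<in> Poly_Mapping.keys p"
    using keys_mult[of c p] by blast
  then show "Poly_Mapping.lookup t j < k"
    using assms by (auto simp: degb_def lookup_add polys_iff)
qed

lemma degb_mult_var_power:
  fixes p :: "('v::finite) mpoly"
  shows "degb j k p \<Longrightarrow> degb j (k + l) (p * var j ^ l)"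
  by (auto simp: degb_def var_power mult.commute[of p] keys_monom_mult lookup_add)

lemma polys_whomog: "c \<in> polys A \<Longrightarrow> j \<notin> A \<Longrightarrow> whomog (var_wt j) 0 c" for c :: "('v::finite) mpoly"
  by (auto simp: polys_iff whomog_def wt_var)

lemma whomog_polys: "c \<in> polys (insert j A) \<Longrightarrow> whomog (var_wt j) 0 c \<Longrightarrow> c \<in> polys A" for c :: "('v::finite) mpoly"
  unfolding polys_iff whomog_def wt_var by (metis insert_iff)

lemma wpart_polys: "p \<in> polys A \<Longrightarrow> wpart w k p \<in> polys A"
  by (auto simp: polys_def keys_wpart)

lemma wpart_var_dvd: "var j ^ k dvd wpart (var_wt j) k p"
  by (intro var_power_dvd) (simp add: keys_wpart wt_var)

text \<open>Here \<open>p\<close> is seen as a polynomial in \<open>x_j\<close> over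
  \<open>polys A\<close>, and \<open>c\<close>, possibly 0, is its coefficient of
  \<open>x_j^k\<close>. The cofactor of \<open>x_j^k\<close> in the component of degree
  \<open>k\<close> has degree 0 in \<open>x_j\<close> and so lies in \<open>polys A\<close>.\<close>

lemma top_decomp:
  fixes p :: "('v::{finite,linorder}) mpoly"
  assumes "p \<in> polys (insert j A)" "degb j (Suc k) p"
  obtains c p' where "c \<in> polys A" "p' \<in> polys (insert j A)" "degb j k p'" "p = c * var j ^ k + p'"
proof -
  let ?h = "wpart (var_wt j) k p"
  obtain c where c: "?h = var j ^ k * c"
    using wpart_var_dvd[of j k p] by (elim dvdE)
  have "var j ^ k * c \<in> polys (insert j A)"
    using assms wpart_polys[of p "insert j A" "var_wt j" k] c by simp
  then have 1: "c \<in> polys (insert j A)"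
    by (rule polys_factor) simp
  have "whomog (var_wt j) 0 c"
  proof -
    have "Poly_Mapping.lookup t j = 0" if "t \<in> Poly_Mapping.keys c" for t
    proof -
      have "Poly_Mapping.single j k + t \<in> Poly_Mapping.keys ?h"
        unfolding c var_power by (simp add: keys_monom_mult that)
      then show ?thesis by (simp add: keys_wpart wt_add wt_var lookup_add)
    qed
    then show ?thesis by (auto simp: whomog_def wt_var)
  qed
  with 1 have 2: "c \<in> polys A" by (rule whomog_polys)
  have "degb j k (p - ?h)"
    unfolding degb_def
  proof
    fix t assume "t \<in> Poly_Mapping.keys (p - ?h)"
    then have "t \<in> Poly_Mapping.keys p" "Poly_Mapping.lookup t j \<noteq> k"
      by (auto simp: in_keys_iff lookup_minus lookup_wpart wt_var split: if_splits)
    then show "Poly_Mapping.lookup t j < k"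
      using assms by (auto simp: degb_def less_Suc_eq)
  qed
  with 2 show ?thesis
    using that[of c "p - ?h"] assms wpart_polys[of p "insert j A" "var_wt j" k] c
    by (simp add: polys_diff mult.commute)
qed

text \<open>A divisor free of \<open>x_j\<close> acts on each coefficient separately: compare the
  components of degree \<open>k\<close> in \<open>x_j\<close> and cancel
  \<open>x_j^k\<close>.\<close>

lemma top_dvd:
  fixes c :: "('v::{finite,linorder}) mpoly"
  assumes "\<pi> \<in> polys A" "j \<notin> A" "c \<in> polys A" "degb j k p'" "\<pi> dvd c * var j ^ k + p'"
  shows "\<pi> dvd c"
proof -
  from assms(5) obtain s where s: "c * var j ^ k + p' = \<pi> * s" by (elim dvdE)
  have "wpart (var_wt j) k (c * var j ^ k + p') = c * var j ^ k"
  proof -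
    have "whomog (var_wt j) (0 + k * var_wt j j) (c * var j ^ k)"
      by (intro whomog_mult polys_whomog[OF assms(3,2)] whomog_power whomog_var)
    then have "whomog (var_wt j) k (c * var j ^ k)" by (simp add: var_wt_def)
    moreover have "wpart (var_wt j) k p' = 0"
      using assms(4) unfolding keys_eq_empty[symmetric] keys_wpart by (auto simp: degb_def wt_var)
    ultimately show ?thesis by (simp add: wpart_add wpart_whomog)
  qed
  then have "c * var j ^ k = \<pi> * wpart (var_wt j) k s"
    unfolding s by (simp add: wpart_whomog_mult[OF polys_whomog[OF assms(1,2)]])
  moreover obtain r where "wpart (var_wt j) k s = var j ^ k * r"
    using wpart_var_dvd[of j k s] by (elim dvdE)
  ultimately have "c * var j ^ k = (\<pi> * r) * var j ^ k" by (simp add: ac_simps)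
  then have "c = \<pi> * r" by simp
  then show ?thesis by simp
qed

text \<open>Here \<open>dvd\<close> refers to the full ring; for \<open>p \<noteq> 0\<close> it
  agrees on \<open>polys A\<close> with having a cofactor in \<open>polys A\<close>, by
  \<open>polys_factor\<close>.\<close>

definition prime_on :: "'v set \<Rightarrow> 'v mpoly \<Rightarrow> bool" where
  "prime_on A p \<longleftrightarrow> (\<forall>a\<in>polys A. \<forall>b\<in>polys A. p dvd a * b \<longrightarrow> p dvd a \<or> p dvd b)"

text \<open>Gauss's lemma: \<open>p\<close> divides the product of the two leading coefficients in
  \<open>x_j\<close>, hence one of them. Dropping that leading term lowers the sum of the degree
  bounds.\<close>

lemma prime_on_insert:
  fixes p :: "('v::{finite,linorder}) mpoly"
  assumes j: "j \<notin> A" and p: "p \<in> polys A" "prime_on A p"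
  shows "prime_on (insert j A) p"
proof -
  have "p dvd a \<or> p dvd b"
    if "a \<in> polys (insert j A)" "b \<in> polys (insert j A)" "degb j k a" "degb j l b" "p dvd a * b" for a b k l
    using that
  proof (induction "k + l" arbitrary: a b k l rule: less_induct)
    case less
    show ?case
    proof (cases "k = 0 \<or> l = 0")
      case True
      with less.prems show ?thesis by (auto simp: degb_zero_iff)
    next
      case False
      then obtain k' l' where kl: "k = Suc k'" "l = Suc l'" by (metis not0_implies_Suc)
      obtain a1 a' where a: "a1 \<in> polys A" "a' \<in> polys (insert j A)" "degb j k' a'" "a = a1 * var j ^ k' + a'"
        using less.prems kl by (metis top_decomp)
      obtain b1 b' where b: "b1 \<in> polys A" "b' \<in> polys (insert j A)" "degb j l' b'" "b = b1 * var j ^ l' + b'"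
        using less.prems kl by (metis top_decomp)
      have "degb j (k' + l') (a * b - a1 * b1 * var j ^ (k' + l'))"
        unfolding degb_def
      proof
        fix t assume t: "t \<in> Poly_Mapping.keys (a * b - a1 * b1 * var j ^ (k' + l'))"
        have 1: "a * b - a1 * b1 * var j ^ (k' + l') = (a1 * var j ^ k') * b' + a' * b"
          unfolding a(4) b(4) by (simp add: algebra_simps power_add)
        have 2: "degb j (k' + l') (a1 * (b' * var j ^ k'))"
          using degb_mult_var_power[OF b(3), of k'] a(1) j by (auto intro: degb_mult_polys simp: add.commute)
        have 3: "degb j (k' + l') (a' * b)"
          unfolding degb_def
        proof
          fix t assume "t \<in> Poly_Mapping.keys (a' * b)"
          then obtain u v where "t = u + v" "u \<in> Poly_Mapping.keys a'" "v \<in> Poly_Mapping.keys b"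
            using keys_mult[of a' b] by blast
          then show "Poly_Mapping.lookup t j < k' + l'"
            using a(3) less.prems(4) unfolding kl degb_def by (force simp: lookup_add)
        qed
        show "Poly_Mapping.lookup t j < k' + l'"
          using t 2 3 keys_add[of "(a1 * var j ^ k') * b'" "a' * b"] unfolding 1
          by (auto simp: degb_def ac_simps)
      qed
      then have "p dvd a1 * b1"
        using top_dvd[OF p(1) j polys_mult[OF a(1) b(1)], of "k' + l'" "a * b - a1 * b1 * var j ^ (k' + l')"]
          less.prems(5) by simp
      then consider "p dvd a1" | "p dvd b1" using p(2) a(1) b(1) by (auto simp: prime_on_def)
      then show ?thesis
      proof cases
        case 1
        have "p dvd (a - a1 * var j ^ k') * b"
          using 1 less.prems(5) by (simp add: left_diff_distrib)
        then have "p dvd a' * b" using a by simp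
        then have "p dvd a' \<or> p dvd b"
          using less.hyps[of k' l a' b] kl a less.prems by simp
        then show ?thesis using 1 a(4) by auto
      next
        case 2
        have "p dvd a * (b - b1 * var j ^ l')"
          using 2 less.prems(5) by (simp add: right_diff_distrib)
        then have "p dvd a * b'" using b by simp
        then have "p dvd a \<or> p dvd b'"
          using less.hyps[of k l' a b'] kl b less.prems by simp
        then show ?thesis using 2 b(4) by auto
      qed
    qed
  qed
  then show ?thesis unfolding prime_on_def by (meson degb_exists)
qed

text \<open>Clearing of denominators, with \<open>c\<close> as a denominator free of
  \<open>x_j\<close>. Each irreducible factor of \<open>c\<close> stays prime after
  \<open>x_j\<close> is adjoined, so it divides \<open>q\<close> or \<open>g\<close> and can be
  cancelled there.\<close>

lemma gauss_split:
  fixes c :: "('v::{finite,linorder}) mpoly"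
  assumes IH: "\<And>p. irreducible p \<Longrightarrow> p \<in> polys A \<Longrightarrow> prime_on A p" and j: "j \<notin> A"
    and "c \<in> polys A" "c \<noteq> 0" "q \<in> polys (insert j A)" "g \<in> polys (insert j A)" "c * p = q * g"
  shows "\<exists>c1 c2 q' g'. c = c1 * c2 \<and> q = c1 * q' \<and> g = c2 * g' \<and> p = q' * g'"
  using assms(3-)
proof (induction "tdeg c" arbitrary: c q g rule: less_induct)
  case less
  show ?case
  proof (cases "c dvd 1")
    case True
    then obtain u where u: "1 = c * u" by (elim dvdE)
    have "q = c * (u * q)" "p = (u * q) * g"
      using u less.prems(5) by (metis mult.assoc mult_1 mult.commute)+
    then show ?thesis by (metis mult_1 mult.right_neutral)
  next
    case False
    then obtain \<pi> where \<pi>: "irreducible \<pi>" "\<pi> dvd c" using irreducible_dvd_exists less.prems by blast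
    then obtain c0 where c0: "c = \<pi> * c0" by (elim dvdE)
    have nz: "\<pi> \<noteq> 0" "c0 \<noteq> 0" using less.prems(2) c0 by auto
    have \<pi>A: "\<pi> \<in> polys A" and c0A: "c0 \<in> polys A"
      using less.prems(1) nz polys_factor[of \<pi> c0 A] polys_factor[of c0 \<pi> A] c0 by (auto simp: mult.commute)
    have deg: "tdeg c0 < tdeg c"
      using nz c0 \<pi>(1) unit_iff[of \<pi>] by (auto simp: wdeg_mult irreducible_def)
    have "prime_on (insert j A) \<pi>" using prime_on_insert[OF j \<pi>A] IH \<pi>(1) \<pi>A by blast
    moreover have "\<pi> dvd q * g" using less.prems(5) c0 by (metis dvd_triv_left mult.assoc)
    ultimately consider "\<pi> dvd q" | "\<pi> dvd g" using less.prems(3,4) by (auto simp: prime_on_def)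
    then show ?thesis
    proof cases
      case 1
      then obtain q0 where q0: "q = \<pi> * q0" by (elim dvdE)
      then have "q0 \<in> polys (insert j A)" using less.prems(3) nz polys_factor by metis
      moreover have "c0 * p = q0 * g" using less.prems(5) nz(1) unfolding c0 q0 by (simp add: mult.assoc)
      ultimately obtain c1 c2 q' g' where "c0 = c1 * c2 \<and> q0 = c1 * q' \<and> g = c2 * g' \<and> p = q' * g'"
        using less.hyps[OF deg c0A nz(2) _ less.prems(4)] by blast
      then have "c = (\<pi> * c1) * c2 \<and> q = (\<pi> * c1) * q' \<and> g = c2 * g' \<and> p = q' * g'"
        using c0 q0 by (simp add: mult.assoc)
      then show ?thesis by blast
    next
      case 2
      then obtain g0 where g0: "g = \<pi> * g0" by (elim dvdE)
      then have "g0 \<in> polys (insert j A)" using less.prems(4) nz polys_factor by metis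
      moreover have "c0 * p = q * g0" using less.prems(5) nz(1) unfolding c0 g0
        by (metis mult.assoc mult.left_commute mult_left_cancel)
      ultimately obtain c1 c2 q' g' where "c0 = c1 * c2 \<and> q = c1 * q' \<and> g0 = c2 * g' \<and> p = q' * g'"
        using less.hyps[OF deg c0A nz(2) less.prems(3)] by blast
      then have "c = c1 * (\<pi> * c2) \<and> q = c1 * q' \<and> g = (\<pi> * c2) * g' \<and> p = q' * g'"
        using c0 g0 by (simp add: ac_simps)
      then show ?thesis by blast
    qed
  qed
qed

text \<open>Division by \<open>g\<close> as polynomials in \<open>x_j\<close> without fractions:
  each cancellation of a leading term costs a factor \<open>c\<close>, and \<open>e\<close> collects
  these factors.\<close>

lemma pseudo_division:
  fixes g :: "('v::{finite,linorder}) mpoly"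
  assumes j: "j \<notin> A" and c: "c \<in> polys A" "c \<noteq> 0" and g': "g' \<in> polys (insert j A)" "degb j k g'"
    and g: "g = c * var j ^ k + g'" and h: "h \<in> polys (insert j A)" "degb j l h"
  shows "\<exists>e q r. e \<in> polys A \<and> e \<noteq> 0 \<and> q \<in> polys (insert j A) \<and> e * h = q * g + r \<and> degb j k r"
  using h
proof (induction l arbitrary: h)
  case 0
  then have "h = 0" by (simp add: degb_zero_iff)
  then show ?case by (intro exI[of _ 1] exI[of _ 0]) simp
next
  case (Suc l)
  have cA: "c \<in> polys (insert j A)" using c polys_mono[of A "insert j A"] by auto
  show ?case
  proof (cases "l < k")
    case True
    then have "degb j k h" using Suc.prems degb_mono by (metis Suc_leI)
    then show ?thesis by (intro exI[of _ 1] exI[of _ 0] exI[of _ h]) simp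
  next
    case False
    obtain h1 h' where h1: "h1 \<in> polys A" "h' \<in> polys (insert j A)" "degb j l h'" "h = h1 * var j ^ l + h'"
      using Suc.prems by (metis top_decomp)
    have h1A: "h1 \<in> polys (insert j A)" using h1 polys_mono[of A "insert j A"] by auto
    let ?s = "h1 * var j ^ (l - k)"
    let ?h = "c * h' - ?s * g'"
    have sA: "?s \<in> polys (insert j A)" by (intro polys_mult polys_power h1A polys_var) simp
    have "degb j (k + (l - k)) (g' * var j ^ (l - k))" by (rule degb_mult_var_power[OF g'(2)])
    then have "degb j l (h1 * (g' * var j ^ (l - k)))"
      using False by (intro degb_mult_polys[OF h1(1) j]) simp
    then have "degb j l ?h"
      using degb_diff[OF degb_mult_polys[OF c(1) j h1(3)]] by (simp add: ac_simps)
    moreover have "?h \<in> polys (insert j A)"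
      by (intro polys_diff polys_mult[OF cA h1(2)] polys_mult[OF sA g'(1)])
    ultimately obtain e q r where e: "e \<in> polys A" "e \<noteq> 0" "q \<in> polys (insert j A)" "e * ?h = q * g + r" "degb j k r"
      using Suc.IH by blast
    have "var j ^ l = var j ^ (l - k) * var j ^ k"
      using False by (simp flip: power_add)
    then have "c * h = ?s * g + ?h"
      unfolding h1(4) g by (simp add: algebra_simps)
    then have "(e * c) * h = (e * ?s + q) * g + r"
      using e(4) by (metis (no_types, opaque_lifting) add.assoc distrib_left distrib_right mult.assoc)
    moreover have "e * ?s + q \<in> polys (insert j A)"
      using e polys_mono[of A "insert j A"] sA by (auto intro!: polys_add polys_mult)
    ultimately show ?thesis using e c
      by (intro exI[of _ "e * c"] exI[of _ "e * ?s + q"] exI[of _ r]) (auto intro: polys_mult)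
  qed
qed

lemma unit_mult_dvd: "u dvd 1 \<Longrightarrow> u * x dvd x" for u x :: "'a::comm_semiring_1"
  using mult_dvd_mono[of u 1 x x] by simp

text \<open>Induction on the variables. If \<open>p\<close> involves \<open>x_j\<close>, a nonzero
  element \<open>g\<close> of least degree in \<open>x_j\<close> in the ideal of \<open>p\<close>
  and \<open>a\<close> acts as their greatest common divisor over the fraction field of
  \<open>polys A\<close>: by pseudo-division it divides both up to factors free of
  \<open>x_j\<close>. Irreducibility then leaves two cases: \<open>p\<close> divides
  \<open>g\<close>, and so \<open>a\<close>; or \<open>g\<close> is free of \<open>x_j\<close> up to
  a unit, and a Bezout identity gives that \<open>p\<close> divides \<open>b\<close>.\<close>

lemma irreducible_prime_on:
  fixes p :: "('v::{finite,linorder}) mpoly"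
  assumes "finite A" "irreducible p" "p \<in> polys A"
  shows "prime_on A p"
  using assms
proof (induction A arbitrary: p rule: finite_induct)
  case empty
  then have "p = const (Poly_Mapping.lookup p 0)"
    by (intro poly_mapping_eqI) (auto simp: polys_iff const_def lookup_single when_def lookup_pm_zero_iff in_keys_iff)
  then have "tdeg p = 0" using tdeg_zero_iff by blast
  then show ?case using empty by (auto simp: unit_iff irreducible_def)
next
  case (insert j A)
  note IH = insert.IH and j = insert.hyps(2) and irr = insert.prems(1) and pB = insert.prems(2)
  let ?B = "insert j A"
  have AB: "polys A \<subseteq> polys ?B" by (rule polys_mono) auto
  have p0: "p \<noteq> 0" using irr by (auto simp: irreducible_def)
  show ?case
  proof (cases "p \<in> polys A")
    case True
    then show ?thesis using prime_on_insert[OF j] IH irr by blast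
  next
    case pA: False
    \<comment> \<open>Factors free of \<open>x_j\<close> can be cancelled. The share
      \<open>c1\<close> of \<open>c\<close> in \<open>p\<close> must be a unit, because a unit
      cofactor \<open>q'\<close> would put \<open>p\<close> into \<open>polys A\<close>.\<close>
    have cancel: "p dvd b" if that: "c \<in> polys A" "c \<noteq> 0" "b \<in> polys ?B" "p dvd c * b" for b c
    proof -
      note c = that
      from c(4) obtain s where s: "c * b = p * s" by (elim dvdE)
      have "c * b \<in> polys ?B" using c AB by (auto intro: polys_mult)
      then have "s \<in> polys ?B" using s p0 polys_factor by metis
      then obtain c1 c2 q' g' where *: "c = c1 * c2" "p = c1 * q'" "s = c2 * g'" "b = q' * g'"
        using gauss_split[OF IH j c(1,2) pB _ s] by blast
      have "c1 \<in> polys A" "c1 \<noteq> 0"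
        using c * polys_factor[of c2 c1 A] by (auto simp: mult.commute)
      then have "\<not> q' dvd 1"
      proof -
        assume "c1 \<in> polys A" "c1 \<noteq> 0"
        show "\<not> q' dvd 1"
        proof
          assume "q' dvd 1"
          then obtain k where "q' = const k" using unit_iff tdeg_zero_iff by metis
          then have "p \<in> polys A" using * \<open>c1 \<in> polys A\<close> by (auto intro: polys_mult)
          with pA show False ..
        qed
      qed
      with irr * have "c1 dvd 1" by (auto simp: irreducible_def)
      then have "p dvd q'" unfolding *(2) by (rule unit_mult_dvd)
      then show ?thesis using * by (metis dvd_mult2)
    qed
    show ?thesis
      unfolding prime_on_def
    proof (intro ballI impI)
      fix a b assume a: "a \<in> polys ?B" and b: "b \<in> polys ?B" and ab: "p dvd a * b"
      define J where "J = {g. \<exists>u\<in>polys ?B. \<exists>w\<in>polys ?B. g = u * p + w * a}"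
      have JB: "J \<subseteq> polys ?B" unfolding J_def using pB a by (auto intro!: polys_add polys_mult)
      have pJ: "p \<in> J" unfolding J_def by (intro CollectI bexI[of _ 1] bexI[of _ 0]) auto
      have aJ: "a \<in> J" unfolding J_def by (intro CollectI bexI[of _ 0] bexI[of _ 1]) auto
      have Jlin: "e * h - q * g \<in> J" if "e \<in> polys ?B" "q \<in> polys ?B" "h \<in> J" "g \<in> J" for e q h g
      proof -
        obtain u w where 1: "u \<in> polys ?B" "w \<in> polys ?B" "h = u * p + w * a" using \<open>h \<in> J\<close> unfolding J_def by blast
        obtain u' w' where 2: "u' \<in> polys ?B" "w' \<in> polys ?B" "g = u' * p + w' * a" using \<open>g \<in> J\<close> unfolding J_def by blast
        have "e * h - q * g = (e * u - q * u') * p + (e * w - q * w') * a"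
          unfolding 1(3) 2(3) by (simp add: algebra_simps)
        moreover have "e * u - q * u' \<in> polys ?B" "e * w - q * w' \<in> polys ?B"
          using 1 2 that by (auto intro!: polys_diff polys_mult)
        ultimately show ?thesis unfolding J_def by blast
      qed
      \<comment> \<open>The least degree in \<open>x_j\<close> of a nonzero element of
        \<open>J\<close>, with \<open>Suc\<close> because \<open>degb\<close> is strict. Remainders
        of smaller degree in \<open>J\<close> therefore vanish.\<close>
      define k where "k = (LEAST k. \<exists>g\<in>J. g \<noteq> 0 \<and> degb j (Suc k) g)"
      obtain k0 where "degb j k0 p" using degb_exists by blast
      then have "\<exists>g\<in>J. g \<noteq> 0 \<and> degb j (Suc k0) g" using pJ p0 degb_mono[of j k0 p "Suc k0"] by auto
      then have ex: "\<exists>g\<in>J. g \<noteq> 0 \<and> degb j (Suc k) g"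
        unfolding k_def by (rule LeastI)
      have least: "g = 0" if "g \<in> J" "degb j k g" for g
      proof (cases k)
        case 0 then show ?thesis using that by (simp add: degb_zero_iff)
      next
        case (Suc k')
        then show ?thesis using that not_less_Least[of k' "\<lambda>k. \<exists>g\<in>J. g \<noteq> 0 \<and> degb j (Suc k) g"]
          unfolding k_def[symmetric] by auto
      qed
      obtain g where g: "g \<in> J" "g \<noteq> 0" "degb j (Suc k) g" using ex by blast
      then obtain c g' where c: "c \<in> polys A" "g' \<in> polys ?B" "degb j k g'" "g = c * var j ^ k + g'"
        using top_decomp JB by (metis subsetD)
      have "c \<noteq> 0" using least[of g] g c by auto
      have div: "\<exists>e q. e \<in> polys A \<and> e \<noteq> 0 \<and> q \<in> polys ?B \<and> e * h = q * g" if "h \<in> J" for h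
      proof -
        obtain l where "degb j l h" using degb_exists by blast
        moreover have "h \<in> polys ?B" using \<open>h \<in> J\<close> JB by blast
        ultimately obtain e q r where *: "e \<in> polys A" "e \<noteq> 0" "q \<in> polys ?B" "e * h = q * g + r" "degb j k r"
          using pseudo_division[OF j c(1) \<open>c \<noteq> 0\<close> c(2-4), where h = h and l = l] by blast
        have "r = e * h - q * g" using *(4) by simp
        also have "\<dots> \<in> J" using * that g AB by (intro Jlin) auto
        finally have "r = 0" using least * by blast
        then show ?thesis using * by auto
      qed
      have gB: "g \<in> polys ?B" using g JB by auto
      obtain e q where e: "e \<in> polys A" "e \<noteq> 0" "q \<in> polys ?B" "e * p = q * g" using div[OF pJ] by blast
      then obtain c1 c2 q' g' where s: "e = c1 * c2" "q = c1 * q'" "g = c2 * g'" "p = q' * g'"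
        using gauss_split[OF IH j e(1-3) gB e(4)] by blast
      from irr s consider "q' dvd 1" | "g' dvd 1" unfolding irreducible_def by blast
      then show "p dvd a \<or> p dvd b"
      proof cases
        case 1
        then have "p dvd g'" unfolding s(4) by (rule unit_mult_dvd)
        then have "p dvd g" using s(3) by simp
        moreover obtain e' q'' where e': "e' \<in> polys A" "e' \<noteq> 0" "e' * a = q'' * g" using div[OF aJ] by blast
        ultimately have "p dvd e' * a" by simp
        then show ?thesis using cancel[OF e'(1,2) a] by simp
      next
        case 2
        obtain u w where uw: "g = u * p + w * a" using g(1) unfolding J_def by blast
        \<comment> \<open>Bezout: after multiplication by \<open>b\<close> both terms are divisible
          by \<open>p\<close>.\<close>
        have "g * b = u * p * b + w * (a * b)" unfolding uw by (simp add: algebra_simps)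
        then have "p dvd g * b" using ab by simp
        moreover have "g * b = g' * (c2 * b)" unfolding s(3) by (simp only: mult.assoc mult.left_commute)
        ultimately have "p dvd g' * (c2 * b)" by simp
        then have "p dvd c2 * b" using unit_mult_dvd[OF 2, of "c2 * b"] by (rule dvd_trans)
        moreover have "c2 \<in> polys A" "c2 \<noteq> 0" using s e polys_factor[of c1 c2 A] by auto
        ultimately show ?thesis using cancel b by blast
      qed
    qed
  qed
qed

lemma irreducible_imp_prime_elem:
  fixes p :: "('v::{finite,linorder}) mpoly"
  assumes "irreducible p"
  shows "prime_elem p"
  using irreducible_prime_on[of UNIV p] assms by (auto simp: prime_elem_def irreducible_def prime_on_def)

lemma prime_dvd_exists:
  fixes p :: "('v::{finite,linorder}) mpoly"
  assumes "p \<noteq> 0" "\<not> p dvd 1"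
  shows "\<exists>q. prime_elem q \<and> q dvd p"
  using irreducible_dvd_exists[OF assms] irreducible_imp_prime_elem by blast

section \<open>Ideals and primes of the polynomial ring\<close>

text \<open>Ideals and primes over the type class operations, so that arithmetic needs no carrier
  sets; \<open>ideal_poly_ring\<close> and \<open>primeideal_poly_ring\<close> translate
  back.\<close>

definition is_ideal :: "('v mpoly) set \<Rightarrow> bool" where
  "is_ideal I \<longleftrightarrow> 0 \<in> I \<and> (\<forall>a\<in>I. \<forall>b\<in>I. a + b \<in> I) \<and> (\<forall>a\<in>I. \<forall>r. r * a \<in> I)"

definition is_prime :: "('v mpoly) set \<Rightarrow> bool" where
  "is_prime P \<longleftrightarrow> is_ideal P \<and> 1 \<notin> P \<and> (\<forall>a b. a * b \<in> P \<longrightarrow> a \<in> P \<or> b \<in> P)"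

lemma is_ideal_zero: "is_ideal I \<Longrightarrow> 0 \<in> I"
  and is_ideal_add: "is_ideal I \<Longrightarrow> a \<in> I \<Longrightarrow> b \<in> I \<Longrightarrow> a + b \<in> I"
  and is_ideal_mult: "is_ideal I \<Longrightarrow> a \<in> I \<Longrightarrow> r * a \<in> I"
  and is_ideal_mult_right: "is_ideal I \<Longrightarrow> a \<in> I \<Longrightarrow> a * r \<in> I"
  by (auto simp: is_ideal_def mult.commute[of a r])

lemma is_ideal_diff: "is_ideal I \<Longrightarrow> a \<in> I \<Longrightarrow> b \<in> I \<Longrightarrow> a - b \<in> I"
  using is_ideal_add[of I a "-1 * b"] is_ideal_mult[of I b "-1"] by simp

lemma is_ideal_sum: "is_ideal I \<Longrightarrow> (\<And>i. i \<in> J \<Longrightarrow> g i \<in> I) \<Longrightarrow> sum g J \<in> I"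
  by (induction J rule: infinite_finite_induct) (auto intro: is_ideal_add is_ideal_zero)

lemma is_ideal_eq_UNIV: "is_ideal I \<Longrightarrow> I = UNIV \<longleftrightarrow> 1 \<in> I"
  using is_ideal_mult_right[of I 1] by auto

lemma is_primeD: "is_prime P \<Longrightarrow> is_ideal P" "is_prime P \<Longrightarrow> 1 \<notin> P"
  "is_prime P \<Longrightarrow> a * b \<in> P \<Longrightarrow> a \<in> P \<or> b \<in> P"
  by (auto simp: is_prime_def)

lemma is_prime_power: "is_prime P \<Longrightarrow> y ^ k \<in> P \<Longrightarrow> y \<in> P"
  by (induction k) (auto simp: is_prime_def)

lemma is_ideal_two_generators: "is_ideal {a * b1 + c * b2 | a c. True}" (is "is_ideal ?B")
  unfolding is_ideal_def
proof (intro conjI ballI allI)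
  show "0 \<in> ?B" by (intro CollectI exI[of _ 0]) simp
next
  fix x y assume "x \<in> ?B" "y \<in> ?B"
  then obtain a c a' c' where "x = a * b1 + c * b2" "y = a' * b1 + c' * b2" by blast
  then show "x + y \<in> ?B" by (intro CollectI exI[of _ "a + a'"] exI[of _ "c + c'"]) (simp add: algebra_simps)
next
  fix x r assume "x \<in> ?B"
  then obtain a c where "x = a * b1 + c * b2" by blast
  then show "r * x \<in> ?B" by (intro CollectI exI[of _ "r * a"] exI[of _ "r * c"]) (simp add: algebra_simps)
qed

lemma poly_ring_simps [simp]:
  "carrier poly_ring = UNIV" "mult poly_ring = (*)" "one poly_ring = 1" "zero poly_ring = 0" "add poly_ring = (+)"
  by (simp_all add: poly_ring_def)

lemma cring_poly_ring: "cring (poly_ring :: ('v mpoly) ring)"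
proof (rule cringI)
  show "abelian_group (poly_ring :: ('v mpoly) ring)"
  proof (rule abelian_groupI)
    fix x :: "'v mpoly"
    show "\<exists>y\<in>carrier poly_ring. y \<oplus>\<^bsub>poly_ring\<^esub> x = \<zero>\<^bsub>poly_ring\<^esub>"
      by (intro bexI[of _ "- x"]) auto
  qed (auto simp: ac_simps)
  show "comm_monoid (poly_ring :: ('v mpoly) ring)"
    by (rule comm_monoidI) (auto simp: ac_simps)
qed (auto simp: algebra_simps)

lemma ring_poly_ring: "ring (poly_ring :: ('v mpoly) ring)"
  by (rule cring.axioms(1)[OF cring_poly_ring])

lemma ideal_poly_ring: "ideal I (poly_ring :: ('v mpoly) ring) \<longleftrightarrow> is_ideal I"
proof
  assume I: "ideal I (poly_ring :: ('v mpoly) ring)"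
  interpret ideal I "poly_ring :: ('v mpoly) ring" by (rule I)
  show "is_ideal I"
    using additive_subgroup.zero_closed[OF is_additive_subgroup] additive_subgroup.a_closed[OF is_additive_subgroup]
      I_l_closed by (auto simp: is_ideal_def)
next
  assume I: "is_ideal I"
  interpret R: ring "poly_ring :: ('v mpoly) ring" by (rule ring_poly_ring)
  show "ideal I (poly_ring :: ('v mpoly) ring)"
  proof (rule idealI[OF ring_poly_ring])
    show "subgroup I (add_monoid (poly_ring :: ('v mpoly) ring))"
    proof (rule group.subgroupI[OF R.a_group])
      fix a assume a: "a \<in> I"
      have "inv\<^bsub>add_monoid (poly_ring :: ('v mpoly) ring)\<^esub> a = - a"
        by (rule group.inv_equality[OF R.a_group]) auto
      then show "inv\<^bsub>add_monoid (poly_ring :: ('v mpoly) ring)\<^esub> a \<in> I"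
        using is_ideal_mult[OF I a, of "-1"] by simp
    qed (use I in \<open>auto simp: is_ideal_def\<close>)
  qed (use I in \<open>auto simp: is_ideal_mult is_ideal_mult_right\<close>)
qed

lemma primeideal_poly_ring: "primeideal P (poly_ring :: ('v mpoly) ring) \<longleftrightarrow> is_prime P"
proof
  assume P: "primeideal P (poly_ring :: ('v mpoly) ring)"
  interpret primeideal P "poly_ring :: ('v mpoly) ring" by (rule P)
  have "is_ideal P" using is_ideal ideal_poly_ring by blast
  then show "is_prime P"
    using I_prime I_notcarr is_ideal_eq_UNIV[of P] by (auto simp: is_prime_def)
next
  assume "is_prime P"
  then show "primeideal P (poly_ring :: ('v mpoly) ring)"
    using is_ideal_eq_UNIV[of P]
    by (intro primeidealI cring_poly_ring) (auto simp: ideal_poly_ring is_prime_def)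
qed

lemma genideal_finite:
  fixes G :: "('v mpoly) set"
  assumes "finite G"
  shows "genideal poly_ring G = {\<Sum>g\<in>G. c g * g | c. True}" (is "_ = ?J")
proof
  have "is_ideal ?J"
    unfolding is_ideal_def
  proof (intro conjI ballI allI)
    show "0 \<in> ?J" by (intro CollectI exI[of _ "\<lambda>_. 0"]) simp
  next
    fix a b assume "a \<in> ?J" "b \<in> ?J"
    then obtain c c' where "a = (\<Sum>g\<in>G. c g * g)" "b = (\<Sum>g\<in>G. c' g * g)" by blast
    then have "a + b = (\<Sum>g\<in>G. (c g + c' g) * g)" by (simp add: sum.distrib distrib_right)
    then show "a + b \<in> ?J" by (intro CollectI exI[of _ "\<lambda>g. c g + c' g"]) simp
  next
    fix a r assume "a \<in> ?J"
    then obtain c where "a = (\<Sum>g\<in>G. c g * g)" by blast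
    then have "r * a = (\<Sum>g\<in>G. (r * c g) * g)" by (simp add: sum_distrib_left mult.assoc)
    then show "r * a \<in> ?J" by (intro CollectI exI[of _ "\<lambda>g. r * c g"]) simp
  qed
  moreover have "G \<subseteq> ?J"
  proof
    fix g assume "g \<in> G"
    then have "(\<Sum>h\<in>G. (if h = g then 1 else 0) * h) = g"
      using assms by (simp add: if_distrib[of "\<lambda>x. x * _"] cong: if_cong)
    then show "g \<in> ?J"
      by (intro CollectI exI[of _ "\<lambda>h. if h = g then 1 else 0"]) simp
  qed
  ultimately show "genideal poly_ring G \<subseteq> ?J"
    unfolding genideal_def by (auto simp: ideal_poly_ring)
  show "?J \<subseteq> genideal poly_ring G"
    unfolding genideal_def
  proof (intro subsetI InterI)
    fix x I assume "x \<in> ?J" "I \<in> {I. ideal I poly_ring \<and> G \<subseteq> I}"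
    then show "x \<in> I"
      by (auto simp: ideal_poly_ring intro!: is_ideal_sum is_ideal_mult)
  qed
qed

lemma is_prime_principal: "prime_elem p \<Longrightarrow> is_prime {q. p dvd q}" for p :: "'v mpoly"
  by (auto simp: is_prime_def is_ideal_def prime_elem_def)

lemma is_prime_zero: "is_prime {0 :: ('v::{finite,linorder}) mpoly}"
  by (auto simp: is_prime_def is_ideal_def)

section \<open>Algebraic independence and chains of primes\<close>

text \<open>A monomial in the entries of a list. Lists allow a new element to be put in front, which
  is how independent families grow along a chain of primes.\<close>

fun lmon :: "'a::comm_monoid_mult list \<Rightarrow> nat list \<Rightarrow> 'a" where
  "lmon (y # ys) (k # ks) = y ^ k * lmon ys ks"
| "lmon _ _ = 1"

text \<open>Algebraic independence over \<complex> of the residues of \<open>ys\<close> modulo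
  \<open>P\<close>, without forming the quotient: \<open>F\<close> and \<open>c\<close> encode a
  polynomial in \<open>length ys\<close> unknowns.\<close>

definition alg_indep_mod :: "('v mpoly) set \<Rightarrow> 'v mpoly list \<Rightarrow> bool" where
  "alg_indep_mod P ys \<longleftrightarrow> (\<forall>F c. finite F \<longrightarrow> F \<subseteq> {\<alpha>. length \<alpha> = length ys} \<longrightarrow>
     (\<Sum>\<alpha>\<in>F. const (c \<alpha>) * lmon ys \<alpha>) \<in> P \<longrightarrow> (\<forall>\<alpha>\<in>F. c \<alpha> = 0))"

lemma alg_indep_modD:
  "alg_indep_mod P ys \<Longrightarrow> finite F \<Longrightarrow> F \<subseteq> {\<alpha>. length \<alpha> = length ys} \<Longrightarrow>
    (\<Sum>\<alpha>\<in>F. const (c \<alpha>) * lmon ys \<alpha>) \<in> P \<Longrightarrow> \<alpha> \<in> F \<Longrightarrow> c \<alpha> = 0"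
  unfolding alg_indep_mod_def by blast

lemma const_in_ideal: "is_ideal I \<Longrightarrow> const c \<in> I \<Longrightarrow> c \<noteq> 0 \<Longrightarrow> 1 \<in> I"
  using is_ideal_mult[of I "const c" "const (1 / c)"] by (simp flip: const_mult)

lemma alg_indep_mod_Nil:
  assumes "is_ideal P" "1 \<notin> P"
  shows "alg_indep_mod P []"
  unfolding alg_indep_mod_def
proof (intro allI impI ballI)
  fix F and c :: "nat list \<Rightarrow> complex" and \<alpha>
  assume F: "finite F" "F \<subseteq> {\<alpha>. length \<alpha> = length []}" "(\<Sum>\<alpha>\<in>F. const (c \<alpha>) * lmon [] \<alpha>) \<in> P" "\<alpha> \<in> F"
  then have "F = {[]}" by auto
  then show "c \<alpha> = 0" using F const_in_ideal[OF assms(1), of "c []"] assms(2) by auto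
qed

text \<open>Divide a relation with value in \<open>P\<close> by the lowest power of \<open>y\<close>: since \<open>y \<notin> P\<close>, the quotient is still in \<open>P\<close>,
  and its part free of \<open>y\<close> is in \<open>P'\<close>.\<close>

lemma alg_indep_mod_Cons:
  assumes P: "is_prime P" and P': "is_ideal P'" and sub: "P \<subseteq> P'" and y: "y \<in> P'" "y \<notin> P"
    and zs: "alg_indep_mod P' zs"
  shows "alg_indep_mod P (y # zs)"
proof (rule ccontr)
  assume "\<not> alg_indep_mod P (y # zs)"
  then obtain F c \<alpha>0 where F: "finite F" "F \<subseteq> {\<alpha>. length \<alpha> = length (y # zs)}"
    "(\<Sum>\<alpha>\<in>F. const (c \<alpha>) * lmon (y # zs) \<alpha>) \<in> P" "\<alpha>0 \<in> F" "c \<alpha>0 \<noteq> 0"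
    unfolding alg_indep_mod_def by blast
  define G where "G = {\<alpha>\<in>F. c \<alpha> \<noteq> 0}"
  have G: "finite G" "G \<noteq> {}" "G \<subseteq> {\<alpha>. length \<alpha> = length (y # zs)}" using F by (auto simp: G_def)
  have Gsum: "(\<Sum>\<alpha>\<in>G. const (c \<alpha>) * lmon (y # zs) \<alpha>) \<in> P"
  proof -
    have "(\<Sum>\<alpha>\<in>G. const (c \<alpha>) * lmon (y # zs) \<alpha>) = (\<Sum>\<alpha>\<in>F. const (c \<alpha>) * lmon (y # zs) \<alpha>)"
      unfolding G_def using F(1) by (intro sum.mono_neutral_left) auto
    then show ?thesis using F(3) by simp
  qed
  define m where "m = Min (hd ` G)"
  have "m \<in> hd ` G" unfolding m_def using G by (intro Min_in) auto
  then obtain \<alpha>1 where \<alpha>1: "\<alpha>1 \<in> G" "hd \<alpha>1 = m" by blast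
  have m_le: "m \<le> hd \<alpha>" if "\<alpha> \<in> G" for \<alpha> unfolding m_def using G that by (intro Min_le) auto
  have ne: "\<alpha> \<noteq> []" if "\<alpha> \<in> G" for \<alpha> using G that by auto
  define G0 where "G0 = {\<alpha>\<in>G. hd \<alpha> = m}"
  define r where "r = (\<Sum>\<alpha>\<in>G0. const (c \<alpha>) * lmon zs (tl \<alpha>))"
  define s where "s = (\<Sum>\<alpha>\<in>G - G0. const (c \<alpha>) * (y ^ (hd \<alpha> - Suc m) * lmon zs (tl \<alpha>)))"
  have mon_eq: "lmon (y # zs) \<alpha> = y ^ hd \<alpha> * lmon zs (tl \<alpha>)" if "\<alpha> \<in> G" for \<alpha>
    using ne[OF that] by (cases \<alpha>) auto
  have "(\<Sum>\<alpha>\<in>G. const (c \<alpha>) * lmon (y # zs) \<alpha>)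
    = (\<Sum>\<alpha>\<in>G0. const (c \<alpha>) * lmon (y # zs) \<alpha>) + (\<Sum>\<alpha>\<in>G - G0. const (c \<alpha>) * lmon (y # zs) \<alpha>)"
    using G(1) by (subst sum.subset_diff[of G0 G]) (auto simp: G0_def)
  also have "(\<Sum>\<alpha>\<in>G0. const (c \<alpha>) * lmon (y # zs) \<alpha>) = y ^ m * r"
    unfolding r_def sum_distrib_left by (intro sum.cong) (auto simp: mon_eq G0_def ac_simps)
  also have "(\<Sum>\<alpha>\<in>G - G0. const (c \<alpha>) * lmon (y # zs) \<alpha>) = y ^ m * (y * s)"
    unfolding s_def sum_distrib_left
  proof (intro sum.cong)
    fix \<alpha> assume \<alpha>: "\<alpha> \<in> G - G0"
    then have "m < hd \<alpha>" using m_le[of \<alpha>] by (auto simp: G0_def)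
    then have "y ^ hd \<alpha> = y ^ m * y * y ^ (hd \<alpha> - Suc m)"
      by (metis Suc_leI le_add_diff_inverse power_Suc2 power_add)
    then show "const (c \<alpha>) * lmon (y # zs) \<alpha> = y ^ m * (y * (const (c \<alpha>) * (y ^ (hd \<alpha> - Suc m) * lmon zs (tl \<alpha>))))"
      using \<alpha> by (simp add: mon_eq ac_simps)
  qed simp
  finally have "(\<Sum>\<alpha>\<in>G. const (c \<alpha>) * lmon (y # zs) \<alpha>) = y ^ m * (r + y * s)"
    by (simp add: distrib_left)
  then have "y ^ m * (r + y * s) \<in> P" using Gsum by simp
  then have "r + y * s \<in> P" using is_primeD(3)[OF P] is_prime_power[OF P] y(2) by blast
  then have "(r + y * s) - y * s \<in> P'"
    using sub y(1) by (intro is_ideal_diff[OF P'] is_ideal_mult_right[OF P']) auto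
  then have "r \<in> P'" by simp
  moreover have "r = (\<Sum>\<beta>\<in>tl ` G0. const (c (m # \<beta>)) * lmon zs \<beta>)"
  proof -
    have inj: "inj_on tl G0"
    proof (rule inj_onI)
      fix \<alpha> \<beta> assume "\<alpha> \<in> G0" "\<beta> \<in> G0" "tl \<alpha> = tl \<beta>"
      then show "\<alpha> = \<beta>" using ne[of \<alpha>] ne[of \<beta>] unfolding G0_def by (metis (mono_tags, lifting) list.expand mem_Collect_eq)
    qed
    have "m # tl \<alpha> = \<alpha>" if "\<alpha> \<in> G0" for \<alpha>
      using that ne[of \<alpha>] unfolding G0_def by (cases \<alpha>) auto
    then show ?thesis unfolding r_def sum.reindex[OF inj] by simp
  qed
  moreover have "tl ` G0 \<subseteq> {\<alpha>. length \<alpha> = length zs}" using G unfolding G0_def by auto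
  moreover have "finite (tl ` G0)" using G unfolding G0_def by auto
  ultimately have "c (m # tl \<alpha>1) = 0"
    using alg_indep_modD[OF zs, of "tl ` G0" "\<lambda>\<beta>. c (m # \<beta>)" "tl \<alpha>1"] \<alpha>1 by (auto simp: G0_def)
  moreover have "m # tl \<alpha>1 = \<alpha>1" using \<alpha>1 ne[of \<alpha>1] by (cases \<alpha>1) auto
  ultimately show False using \<alpha>1 by (auto simp: G_def)
qed

section \<open>Dimension counts over the constants\<close>

interpretation cpoly: vector_space "\<lambda>c (p :: 'v mpoly). const c * p"
  by unfold_locales (auto simp: const_add const_mult algebra_simps)

lemma is_ideal_subspace: "is_ideal I \<Longrightarrow> cpoly.subspace I"
  by (auto simp: is_ideal_def cpoly.subspace_def)

lemma card_bounded_monomials: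
  fixes h :: "'v::finite \<Rightarrow> nat"
  shows "finite {t. \<forall>j. Poly_Mapping.lookup t j < h j}" "card {t. \<forall>j. Poly_Mapping.lookup t j < h j} = (\<Prod>j\<in>UNIV. h j)"
proof -
  have "bij_betw Poly_Mapping.lookup {t. \<forall>j. Poly_Mapping.lookup t j < h j} (PiE UNIV (\<lambda>j. {..<h j}))"
  proof (rule bij_betwI[where g = Abs_poly_mapping])
    show "Abs_poly_mapping \<in> PiE UNIV (\<lambda>j. {..<h j}) \<rightarrow> {t. \<forall>j. Poly_Mapping.lookup t j < h j}"
      by (auto simp: PiE_def Pi_def)
  qed auto
  then show "finite {t. \<forall>j. Poly_Mapping.lookup t j < h j}" "card {t. \<forall>j. Poly_Mapping.lookup t j < h j} = (\<Prod>j\<in>UNIV. h j)"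
    using bij_betw_finite bij_betw_same_card by (fastforce simp: card_PiE finite_PiE)+
qed

text \<open>Bounding each exponent separately, rather than the total degree, makes the number of
  monomials an exact power.\<close>

definition box :: "nat \<Rightarrow> ('v::finite \<Rightarrow>\<^sub>0 nat) set" where
  "box M = {t. \<forall>j. Poly_Mapping.lookup t j < M}"

lemma card_box: "finite (box M :: ('v::finite \<Rightarrow>\<^sub>0 nat) set)" "card (box M :: ('v \<Rightarrow>\<^sub>0 nat) set) = M ^ CARD('v)"
  using card_bounded_monomials[of "\<lambda>_ :: 'v. M"] by (simp_all add: box_def)

lemma in_span_monomials:
  assumes "Poly_Mapping.keys p \<subseteq> T"
  shows "p \<in> cpoly.span ((\<lambda>t. Poly_Mapping.single t 1) ` T)"
proof -
  have "(\<Sum>t\<in>Poly_Mapping.keys p. const (Poly_Mapping.lookup p t) * Poly_Mapping.single t 1) \<in> cpoly.span ((\<lambda>t. Poly_Mapping.single t 1) ` T)"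
    using assms by (intro cpoly.span_sum cpoly.span_scale cpoly.span_base) auto
  also have "(\<Sum>t\<in>Poly_Mapping.keys p. const (Poly_Mapping.lookup p t) * Poly_Mapping.single t 1) = p"
    by (subst (3) poly_mapping_sum_keys) (simp add: const_def mult_single)
  finally show ?thesis .
qed

lemma in_box_mult:
  assumes "Poly_Mapping.keys p \<subseteq> box (Suc k)" "Poly_Mapping.keys q \<subseteq> box (Suc l)"
  shows "Poly_Mapping.keys (p * q) \<subseteq> box (Suc (k + l))"
proof
  fix t assume "t \<in> Poly_Mapping.keys (p * q)"
  then obtain a b where "t = a + b" "a \<in> Poly_Mapping.keys p" "b \<in> Poly_Mapping.keys q"
    using keys_mult[of p q] by blast
  moreover from this assms have "a \<in> box (Suc k)" "b \<in> box (Suc l)" by auto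
  ultimately show "t \<in> box (Suc (k + l))"
    by (auto simp: box_def lookup_add less_Suc_eq_le intro: add_mono)
qed

lemma box_mono: "M \<le> N \<Longrightarrow> box M \<subseteq> box N"
  by (auto simp: box_def intro: less_le_trans)

lemma in_box_power:
  assumes "Poly_Mapping.keys p \<subseteq> box (Suc k)"
  shows "Poly_Mapping.keys (p ^ n) \<subseteq> box (Suc (n * k))"
proof (induction n)
  case 0
  then show ?case by (auto simp: box_def)
next
  case (Suc n)
  then show ?case using in_box_mult[OF assms Suc] by (simp add: add.commute)
qed

lemma in_box_mon:
  assumes "\<forall>y\<in>set ys. Poly_Mapping.keys y \<subseteq> box (Suc k)" "set \<alpha> \<subseteq> {..N}"
  shows "Poly_Mapping.keys (lmon ys \<alpha>) \<subseteq> box (Suc (length ys * (N * k)))"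
  using assms
proof (induction ys \<alpha> rule: lmon.induct)
  case (1 y ys a as)
  have "Poly_Mapping.keys (y ^ a) \<subseteq> box (Suc (N * k))"
    using in_box_power[of y k a] 1(2,3) box_mono[of "Suc (a * k)" "Suc (N * k)"] by auto
  moreover have "Poly_Mapping.keys (lmon ys as) \<subseteq> box (Suc (length ys * (N * k)))" using 1 by auto
  ultimately show ?case using in_box_mult[of "y ^ a" "N * k" "lmon ys as" "length ys * (N * k)"] by simp
qed (auto simp: box_def)

lemma alg_indep_mod_inj:
  assumes "alg_indep_mod P ys" "is_ideal P"
  shows "inj_on (lmon ys) {\<alpha>. length \<alpha> = length ys}"
proof (rule inj_onI, rule ccontr)
  fix \<alpha> \<beta> assume *: "\<alpha> \<in> {\<alpha>. length \<alpha> = length ys}" "\<beta> \<in> {\<alpha>. length \<alpha> = length ys}" "lmon ys \<alpha> = lmon ys \<beta>" "\<alpha> \<noteq> \<beta>"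
  let ?c = "\<lambda>\<gamma>. if \<gamma> = \<alpha> then 1 else (-1 :: complex)"
  have "const (-1) = (-1 :: 'a mpoly)" using const_add[of "-1" 1] by (simp add: eq_neg_iff_add_eq_0)
  then have "(\<Sum>\<gamma>\<in>{\<alpha>, \<beta>}. const (?c \<gamma>) * lmon ys \<gamma>) = 0" using * by auto
  then have "?c \<alpha> = 0"
    using * is_ideal_zero[OF assms(2)] alg_indep_modD[OF assms(1), of "{\<alpha>, \<beta>}" ?c \<alpha>] by simp
  then show False by simp
qed

lemma alg_indep_mod_independent:
  assumes "alg_indep_mod P ys" "is_ideal P" "finite F" "F \<subseteq> {\<alpha>. length \<alpha> = length ys}"
  shows "cpoly.independent (lmon ys ` F)" "card (lmon ys ` F) = card F"
proof -
  have inj: "inj_on (lmon ys) F" using alg_indep_mod_inj[OF assms(1,2)] assms(4) inj_on_subset by blast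
  then show "card (lmon ys ` F) = card F" by (rule card_image)
  show "cpoly.independent (lmon ys ` F)"
  proof (rule cpoly.independent_if_scalars_zero)
    fix h x assume *: "(\<Sum>x\<in>lmon ys ` F. const (h x) * x) = 0" "x \<in> lmon ys ` F"
    then have "(\<Sum>\<alpha>\<in>F. const (h (lmon ys \<alpha>)) * lmon ys \<alpha>) \<in> P"
      using is_ideal_zero[OF assms(2)] by (simp add: sum.reindex[OF inj])
    then show "h x = 0" using alg_indep_modD[OF assms(1,3,4), of "\<lambda>\<alpha>. h (lmon ys \<alpha>)"] *(2) by auto
  qed (use assms in auto)
qed

lemma keys_in_box_exists: "\<exists>k. \<forall>y\<in>set ys. Poly_Mapping.keys y \<subseteq> box (Suc k)"
  for ys :: "('v::finite) mpoly list"
proof (induction ys)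
  case (Cons y ys)
  then obtain k where k: "\<forall>y\<in>set ys. Poly_Mapping.keys y \<subseteq> box (Suc k)" by blast
  have "finite ((\<lambda>(t, j). Poly_Mapping.lookup t j) ` (Poly_Mapping.keys y \<times> UNIV))" by simp
  then obtain l where "\<forall>x\<in>(\<lambda>(t, j). Poly_Mapping.lookup t j) ` (Poly_Mapping.keys y \<times> UNIV). x \<le> l"
    using finite_nat_set_iff_bounded_le by blast
  then have "Poly_Mapping.keys y \<subseteq> box (Suc l)" by (auto simp: box_def less_Suc_eq_le)
  then show ?case
    using k box_mono[of "Suc k" "Suc (max k l)"] box_mono[of "Suc l" "Suc (max k l)"]
    by (intro exI[of _ "max k l"]) fastforce
qed simp

text \<open>With \<open>K\<close> independent elements, the monomials with exponents at most
  \<open>N\<close> are \<open>(N + 1)^K\<close> independent polynomials. They lie in a box of side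
  linear in \<open>N\<close>, whose dimension grows only like \<open>N^CARD('v)\<close>.\<close>

lemma alg_indep_mod_length_le:
  fixes ys :: "('v::finite) mpoly list"
  assumes "alg_indep_mod P ys" "is_ideal P"
  shows "length ys \<le> CARD('v)"
proof (rule ccontr)
  assume "\<not> length ys \<le> CARD('v)"
  then have len: "Suc CARD('v) \<le> length ys" by simp
  obtain k where k: "\<forall>y\<in>set ys. Poly_Mapping.keys y \<subseteq> box (Suc k)" using keys_in_box_exists by blast
  define K where "K = length ys"
  \<comment> \<open>The side of the box below is at most \<open>Suc N * Suc (K * k)\<close>. With
    this \<open>N\<close> the constant factor of the count is \<open>N\<close> itself, which is less
    than \<open>Suc N\<close>.\<close>
  define N where "N = (Suc (K * k)) ^ CARD('v)"
  define F where "F = {\<alpha>. set \<alpha> \<subseteq> {..N} \<and> length \<alpha> = length ys}"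
  have finF: "finite F" unfolding F_def by (intro finite_lists_length_eq) auto
  have cardF: "card F = Suc N ^ K" unfolding F_def K_def by (simp add: card_lists_length_eq)
  let ?T = "box (Suc (K * (N * k))) :: ('v \<Rightarrow>\<^sub>0 nat) set"
  have "lmon ys ` F \<subseteq> cpoly.span ((\<lambda>t. Poly_Mapping.single t 1) ` ?T)"
    using in_box_mon[OF k, of _ N] unfolding F_def K_def by (auto intro!: in_span_monomials)
  then have "card (lmon ys ` F) \<le> card ((\<lambda>t. Poly_Mapping.single t (1::complex)) ` ?T)"
    using alg_indep_mod_independent(1)[OF assms finF] cpoly.independent_span_bound[of "(\<lambda>t. Poly_Mapping.single t 1) ` ?T"]
      card_box(1) unfolding F_def by blast
  also have "\<dots> \<le> card ?T" by (rule card_image_le[OF card_box(1)])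
  also have "\<dots> = (Suc (K * (N * k))) ^ CARD('v)" by (rule card_box)
  also have "\<dots> \<le> (Suc N * Suc (K * k)) ^ CARD('v)" by (intro power_mono) (auto simp: algebra_simps)
  also have "\<dots> = Suc N ^ CARD('v) * N" by (simp only: power_mult_distrib N_def)
  also have "\<dots> < Suc N ^ CARD('v) * Suc N" by simp
  also have "\<dots> = Suc N ^ Suc CARD('v)" by simp
  also have "\<dots> \<le> Suc N ^ K" using len unfolding K_def by (intro power_increasing) auto
  finally show False
    using alg_indep_mod_independent(2)[OF assms finF] cardF by (auto simp: F_def)
qed

section \<open>Chains of primes and independent elements\<close>

definition chain :: "(nat \<Rightarrow> ('v mpoly) set) \<Rightarrow> nat \<Rightarrow> bool" where
  "chain P k \<longleftrightarrow> (\<forall>i\<le>k. is_prime (P i)) \<and> (\<forall>i<k. P i \<subset> P (Suc i))"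

lemma prime_chain_poly_ring: "prime_chain poly_ring P k \<longleftrightarrow> chain P k"
  by (simp add: prime_chain_def chain_def primeideal_poly_ring)

text \<open>From the top down, each strict inclusion contributes one element of the larger prime
  outside the smaller one.\<close>

lemma chain_alg_indep:
  "chain P k \<Longrightarrow> alg_indep_mod (P k) zs \<Longrightarrow> \<exists>ys. length ys = k \<and> alg_indep_mod (P 0) (ys @ zs)"
proof (induction k arbitrary: P)
  case 0
  then show ?case by auto
next
  case (Suc k)
  have "chain (\<lambda>i. P (Suc i)) k" using Suc.prems by (auto simp: chain_def)
  then obtain ys where ys: "length ys = k" "alg_indep_mod (P (Suc 0)) (ys @ zs)"
    using Suc.IH[of "\<lambda>i. P (Suc i)"] Suc.prems by auto
  have P: "is_prime (P 0)" "is_prime (P (Suc 0))" "P 0 \<subset> P (Suc 0)" using Suc.prems by (auto simp: chain_def)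
  then obtain y where "y \<in> P (Suc 0)" "y \<notin> P 0" by blast
  then have "alg_indep_mod (P 0) (y # ys @ zs)"
    using P ys by (intro alg_indep_mod_Cons[of "P 0" "P (Suc 0)"]) (auto dest: is_primeD)
  then show ?case using ys by (intro exI[of _ "y # ys"]) simp
qed

text \<open>With \<open>zs\<close> empty this bounds the dimension of the ring. With
  \<open>zs\<close> independent modulo a prime \<open>Q\<close> it bounds the height of
  \<open>Q\<close> by the number of the remaining variables.\<close>

lemma chain_length_le:
  fixes P :: "nat \<Rightarrow> (('v::finite) mpoly) set"
  assumes "chain P k" "alg_indep_mod (P k) zs"
  shows "k + length zs \<le> CARD('v)"
proof -
  obtain ys where "length ys = k" "alg_indep_mod (P 0) (ys @ zs)" using chain_alg_indep[OF assms] by blast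
  moreover have "is_ideal (P 0)" using assms by (auto simp: chain_def dest: is_primeD)
  ultimately show ?thesis using alg_indep_mod_length_le[of "P 0" "ys @ zs"] by simp
qed

section \<open>Primes of small height over two forms\<close>

text \<open>The nonzero elements of \<open>polys I\<close> are closed under multiplication, and an
  ideal maximal among those disjoint from such a set is prime.\<close>

lemma exists_prime_avoiding:
  fixes B :: "(('v::{finite,linorder}) mpoly) set"
  assumes B: "is_ideal B" "polys I \<inter> B \<subseteq> {0}"
  shows "\<exists>Q. is_prime Q \<and> B \<subseteq> Q \<and> polys I \<inter> Q \<subseteq> {0}"
proof -
  let ?A = "{J. is_ideal J \<and> B \<subseteq> J \<and> polys I \<inter> J \<subseteq> {0}}"
  have "\<exists>M\<in>?A. \<forall>X\<in>?A. M \<subseteq> X \<longrightarrow> X = M"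
  proof (rule subset_Zorn_nonempty)
    show "?A \<noteq> {}" using B by auto
  next
    fix C assume C: "C \<noteq> {}" "subset.chain ?A C"
    have CA: "is_ideal J" "B \<subseteq> J" "polys I \<inter> J \<subseteq> {0}" if "J \<in> C" for J
      using C(2) that by (auto simp: subset_chain_def)
    have tot: "J \<subseteq> K \<or> K \<subseteq> J" if "J \<in> C" "K \<in> C" for J K
      using C(2) that by (auto simp: subset_chain_def)
    have "is_ideal (\<Union>C)"
      unfolding is_ideal_def
    proof (intro conjI ballI allI)
      show "0 \<in> \<Union>C" using C(1) CA(1) is_ideal_zero by fastforce
    next
      fix a b assume "a \<in> \<Union>C" "b \<in> \<Union>C"
      then obtain J K where JK: "J \<in> C" "a \<in> J" "K \<in> C" "b \<in> K" by blast
      with tot[of J K] obtain L where "L \<in> C" "a \<in> L" "b \<in> L" by blast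
      then show "a + b \<in> \<Union>C" using is_ideal_add[OF CA(1)] by blast
    next
      fix a r assume "a \<in> \<Union>C"
      then show "r * a \<in> \<Union>C" using is_ideal_mult[OF CA(1)] by blast
    qed
    moreover have "B \<subseteq> \<Union>C" using C(1) CA(2) by blast
    moreover have "polys I \<inter> \<Union>C \<subseteq> {0}" using CA(3) by blast
    ultimately show "\<Union>C \<in> ?A" by simp
  qed
  then obtain Q where QA: "Q \<in> ?A" and max0: "\<forall>X\<in>?A. Q \<subseteq> X \<longrightarrow> X = Q" by (rule bexE)
  from QA have Q: "is_ideal Q" "B \<subseteq> Q" "polys I \<inter> Q \<subseteq> {0}" by simp_all
  have max: "X = Q" if "is_ideal X" "polys I \<inter> X \<subseteq> {0}" "Q \<subseteq> X" for X
    using max0 that Q(2) by (metis (mono_tags, lifting) mem_Collect_eq order_trans)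
  \<comment> \<open>Maximality of \<open>Q\<close>, applied to the ideal generated by
    \<open>Q\<close> and \<open>a\<close>.\<close>
  have meets: "\<exists>q r. q \<in> Q \<and> q + r * a \<in> polys I \<and> q + r * a \<noteq> 0" if a: "a \<notin> Q" for a
  proof -
    let ?X = "{q + r * a | q r. q \<in> Q}"
    have "is_ideal ?X"
      unfolding is_ideal_def
    proof (intro conjI ballI allI)
      show "0 \<in> ?X" using is_ideal_zero[OF Q(1)] by (intro CollectI exI[of _ 0]) simp
    next
      fix x y assume "x \<in> ?X" "y \<in> ?X"
      then obtain q r q' r' where "x = q + r * a" "q \<in> Q" "y = q' + r' * a" "q' \<in> Q" by blast
      then show "x + y \<in> ?X" using is_ideal_add[OF Q(1)]
        by (intro CollectI exI[of _ "q + q'"] exI[of _ "r + r'"]) (simp add: algebra_simps)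
    next
      fix x s assume "x \<in> ?X"
      then obtain q r where "x = q + r * a" "q \<in> Q" by blast
      then show "s * x \<in> ?X" using is_ideal_mult[OF Q(1)]
        by (intro CollectI exI[of _ "s * q"] exI[of _ "s * r"]) (simp add: algebra_simps)
    qed
    moreover have "Q \<subseteq> ?X"
    proof
      fix q assume "q \<in> Q" then show "q \<in> ?X" by (intro CollectI exI[of _ q] exI[of _ 0]) simp
    qed
    moreover have "a \<in> ?X" using is_ideal_zero[OF Q(1)] by (intro CollectI exI[of _ 0] exI[of _ 1]) simp
    ultimately have "\<not> polys I \<inter> ?X \<subseteq> {0}" using max[of ?X] a by blast
    then show ?thesis by blast
  qed
  have "is_prime Q"
    unfolding is_prime_def
  proof (intro conjI allI impI)
    show "1 \<notin> Q" using Q(3) polys_one[of I] by (metis IntI singletonD subsetD zero_neq_one)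
  next
    fix a b assume ab: "a * b \<in> Q"
    show "a \<in> Q \<or> b \<in> Q"
    proof (rule ccontr)
      assume "\<not> (a \<in> Q \<or> b \<in> Q)"
      then obtain q r q' r' where
        *: "q \<in> Q" "q + r * a \<in> polys I" "q + r * a \<noteq> 0" "q' \<in> Q" "q' + r' * b \<in> polys I" "q' + r' * b \<noteq> 0"
        using meets by metis
      have "(q + r * a) * (q' + r' * b) = (q' + r' * b) * q + (r * a) * q' + r * r' * (a * b)"
        by (simp add: algebra_simps)
      also have "\<dots> \<in> Q" by (intro is_ideal_add[OF Q(1)] is_ideal_mult[OF Q(1) *(1)]
          is_ideal_mult[OF Q(1) *(4)] is_ideal_mult[OF Q(1) ab])
      finally have "(q + r * a) * (q' + r' * b) \<in> Q" .
      moreover have "(q + r * a) * (q' + r' * b) \<in> polys I" by (rule polys_mult[OF *(2,5)])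
      ultimately have "(q + r * a) * (q' + r' * b) \<in> polys I \<inter> Q" by blast
      then have "(q + r * a) * (q' + r' * b) = 0" using Q(3) by blast
      then show False using * by simp
    qed
  qed (rule Q(1))
  then show ?thesis using Q by blast
qed

fun expo :: "'v list \<Rightarrow> nat list \<Rightarrow> ('v \<Rightarrow>\<^sub>0 nat)" where
  "expo (z # zs) (k # ks) = Poly_Mapping.single z k + expo zs ks"
| "expo _ _ = 0"

lemma lmon_var: "lmon (map var zs) ks = Poly_Mapping.single (expo zs ks) 1"
  by (induction zs ks rule: expo.induct) (auto simp: var_power mult_single)

lemma lookup_expo_notin: "z \<notin> set zs \<Longrightarrow> Poly_Mapping.lookup (expo zs ks) z = 0"
  by (induction zs ks rule: expo.induct) (auto simp: lookup_add lookup_single when_def)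

lemma expo_inj:
  "distinct zs \<Longrightarrow> length ks = length zs \<Longrightarrow> length ls = length zs \<Longrightarrow> expo zs ks = expo zs ls \<Longrightarrow> ks = ls"
proof (induction zs arbitrary: ks ls)
  case (Cons z zs)
  then obtain k ks' l ls' where *: "ks = k # ks'" "ls = l # ls'" by (metis length_Suc_conv list.size(4) add_Suc_right)
  have "Poly_Mapping.lookup (expo (z # zs) ks) z = Poly_Mapping.lookup (expo (z # zs) ls) z" using Cons by simp
  then have "k = l" using Cons.prems(1) * by (simp add: lookup_add lookup_expo_notin)
  moreover have "ks' = ls'" using Cons * \<open>k = l\<close> by auto
  ultimately show ?case using * by simp
qed auto

text \<open>A relation with value in \<open>Q\<close> also lies in \<open>polys I\<close>, so it is
  0, and distinct exponent lists give distinct monomials.\<close>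

lemma alg_indep_mod_vars:
  fixes Q :: "(('v::finite) mpoly) set"
  assumes "polys I \<inter> Q \<subseteq> {0}" "distinct zs" "set zs \<subseteq> I"
  shows "alg_indep_mod Q (map var zs)"
  unfolding alg_indep_mod_def
proof (intro allI impI ballI)
  fix F c \<alpha>
  assume F: "finite F" "F \<subseteq> {\<alpha>. length \<alpha> = length (map (var :: 'v \<Rightarrow> 'v mpoly) zs)}"
    "(\<Sum>\<alpha>\<in>F. const (c \<alpha>) * lmon (map var zs) \<alpha>) \<in> Q" "\<alpha> \<in> F"
  have "lmon (map var ys) \<beta> \<in> polys I" if "set ys \<subseteq> I" for ys \<beta>
    using that by (induction ys \<beta> rule: expo.induct) (auto intro: polys_mult polys_power polys_var)
  then have "(\<Sum>\<alpha>\<in>F. const (c \<alpha>) * lmon (map var zs) \<alpha>) \<in> polys I"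
    using assms(3) by (intro polys_sum polys_mult) auto
  then have 0: "(\<Sum>\<alpha>\<in>F. const (c \<alpha>) * lmon (map var zs) \<alpha>) = 0" using assms(1) F(3) by blast
  have "Poly_Mapping.lookup (\<Sum>\<beta>\<in>F. const (c \<beta>) * lmon (map var zs) \<beta>) (expo zs \<alpha>) = (\<Sum>\<beta>\<in>F. if \<beta> = \<alpha> then c \<beta> else 0)"
    unfolding lookup_sum
  proof (rule sum.cong)
    fix \<beta> assume \<beta>: "\<beta> \<in> F"
    have "expo zs \<beta> = expo zs \<alpha> \<longleftrightarrow> \<beta> = \<alpha>"
      using expo_inj[OF assms(2), of \<beta> \<alpha>] \<beta> F(2,4) by auto
    then show "Poly_Mapping.lookup (const (c \<beta>) * lmon (map var zs) \<beta>) (expo zs \<alpha>) = (if \<beta> = \<alpha> then c \<beta> else 0)"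
      by (simp add: lookup_const_mult lmon_var lookup_single when_def)
  qed simp
  then show "c \<alpha> = 0" using 0 F(1,4) by simp
qed

lemma cpoly_span_mult:
  fixes q :: "'v mpoly"
  assumes "p \<in> cpoly.span S" "\<And>s. s \<in> S \<Longrightarrow> q * s \<in> cpoly.span S'"
  shows "q * p \<in> cpoly.span S'"
  using assms(1)
proof (induction rule: cpoly.span_induct_alt)
  case base
  then show ?case by (simp add: cpoly.span_zero)
next
  case (step c x y)
  have "q * (const c * x + y) = const c * (q * x) + q * y" by (simp add: algebra_simps)
  then show ?case using step assms(2) by (simp add: cpoly.span_add cpoly.span_scale)
qed

lemma whomog_span:
  assumes "p \<in> cpoly.span S" "\<And>s. s \<in> S \<Longrightarrow> whomog w k s"
  shows "whomog w k p"
  using assms(1)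
proof (induction rule: cpoly.span_induct_alt)
  case (step c x y)
  have "whomog w (0 + k) (const c * x)" using step assms(2) by (intro whomog_mult whomog_const)
  then show ?case using step by (intro whomog_add) auto
qed simp

section \<open>Standard monomials and their number\<close>

lemma lookup_le_wt: "Poly_Mapping.lookup t j \<le> wt unit_wt t" for t :: "'v::finite \<Rightarrow>\<^sub>0 nat"
  unfolding wt_def unit_wt_def by (simp add: member_le_sum)

lemma finite_degree: "finite {t :: 'v::finite \<Rightarrow>\<^sub>0 nat. wt unit_wt t \<le> N}"
proof -
  have "{t :: 'v \<Rightarrow>\<^sub>0 nat. wt unit_wt t \<le> N} \<subseteq> box (Suc N)"
    by (auto simp: box_def less_Suc_eq_le intro: le_trans[OF lookup_le_wt])
  then show ?thesis using card_box(1) finite_subset by blast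
qed

lemma independent_monomials:
  "cpoly.independent ((\<lambda>t. Poly_Mapping.single t 1 :: 'v mpoly) ` T)"
  "card ((\<lambda>t. Poly_Mapping.single t 1 :: 'v mpoly) ` T) = card T"
  if "finite T"
proof -
  have inj: "inj_on (\<lambda>t. Poly_Mapping.single t 1 :: 'v mpoly) T"
    by (rule inj_onI) (metis lookup_single_eq lookup_single_not_eq zero_neq_one)
  then show "card ((\<lambda>t. Poly_Mapping.single t 1 :: 'v mpoly) ` T) = card T" by (rule card_image)
  show "cpoly.independent ((\<lambda>t. Poly_Mapping.single t 1 :: 'v mpoly) ` T)"
  proof (rule cpoly.independent_if_scalars_zero)
    fix h x assume *: "(\<Sum>x\<in>(\<lambda>t. Poly_Mapping.single t 1 :: 'v mpoly) ` T. const (h x) * x) = 0" "x \<in> (\<lambda>t. Poly_Mapping.single t 1 :: 'v mpoly) ` T"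
    then obtain t where t: "t \<in> T" "x = Poly_Mapping.single t 1" by blast
    have "Poly_Mapping.lookup (\<Sum>s\<in>T. const (h (Poly_Mapping.single s 1)) * Poly_Mapping.single s 1) t
        = (\<Sum>s\<in>T. if s = t then h x else 0)"
      unfolding lookup_sum by (intro sum.cong) (auto simp: lookup_const_mult lookup_single when_def t)
    then show "h x = 0" using *(1) t that by (simp add: sum.reindex[OF inj])
  qed (use that in auto)
qed

text \<open>Modulo an ideal containing a form \<open>g\<close>, a multiple of the leading monomial of \<open>g\<close> is a combination of smaller
  monomials of the same degree.\<close>

lemma reduce_to_standard:
  fixes B :: "(('v::{finite,linorder}) mpoly) set"
  assumes B: "is_ideal B"
    and g: "\<And>i. i \<in> J \<Longrightarrow> g i \<in> B \<and> g i \<noteq> 0 \<and> whomog unit_wt (e i) (g i)"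
    and U: "\<And>t. t \<notin> U \<Longrightarrow> \<exists>i\<in>J. \<exists>s. t = Max (Poly_Mapping.keys (g i)) + s"
    and "wt unit_wt t = N"
  shows "Poly_Mapping.single t 1 \<in> cpoly.span ((\<lambda>u. Poly_Mapping.single u 1) ` {u\<in>U. wt unit_wt u = N} \<union> B)"
  using assms(4)
\<comment> \<open>Only finitely many monomials have degree \<open>N\<close>, so the number of
  smaller ones is a valid measure. \<open>U\<close> contains the standard monomials, those that are
  no multiple of a leading monomial.\<close>
proof (induction "card {s. wt unit_wt s = N \<and> s < t}" arbitrary: t rule: less_induct)
  case less
  let ?V = "cpoly.span ((\<lambda>u. Poly_Mapping.single u 1) ` {u\<in>U. wt unit_wt u = N} \<union> B)"
  show ?case
  proof (cases "t \<in> U")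
    case True
    then show ?thesis using less.prems by (intro cpoly.span_base) auto
  next
    case False
    then obtain i s where i: "i \<in> J" "t = Max (Poly_Mapping.keys (g i)) + s" using U by blast
    let ?K = "Poly_Mapping.keys (g i)" and ?L = "Max (Poly_Mapping.keys (g i))"
    have L: "?L \<in> ?K" using g[OF i(1)] by (intro Max_in) auto
    define l where "l = Poly_Mapping.lookup (g i) ?L"
    have l: "l \<noteq> 0" using L by (simp add: l_def in_keys_iff)
    have "const (1 / l) * Poly_Mapping.single s 1 * g i \<in> B" using g[OF i(1)] by (intro is_ideal_mult[OF B]) auto
    then have 1: "const (1 / l) * Poly_Mapping.single s 1 * g i \<in> ?V" by (intro cpoly.span_base) auto
    have 2: "Poly_Mapping.single (t' + s) 1 \<in> ?V" if t': "t' \<in> ?K - {?L}" for t'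
    proof -
      have deg: "wt unit_wt (t' + s) = N"
        using g[OF i(1)] L t' less.prems i(2) by (auto simp: whomog_def wt_add)
      have "t' < ?L" using t' by (auto simp: le_neq_trans)
      then have lt: "t' + s < t" unfolding i(2) by (rule add_strict_right_mono)
      have "{u. wt unit_wt u = N \<and> u < t' + s} \<subset> {u. wt unit_wt u = N \<and> u < t}"
        using lt deg by auto
      moreover have "finite {u. wt unit_wt u = N \<and> u < t}"
        by (rule finite_subset[OF _ finite_degree[of N]]) auto
      ultimately show ?thesis using less.hyps[OF _ deg] psubset_card_mono by blast
    qed
    have "g i = const l * Poly_Mapping.single ?L 1 + (\<Sum>t'\<in>?K - {?L}. const (Poly_Mapping.lookup (g i) t') * Poly_Mapping.single t' 1)"
    proof -
      have "g i = (\<Sum>t'\<in>?K. Poly_Mapping.single t' (Poly_Mapping.lookup (g i) t'))" by (rule poly_mapping_sum_keys)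
      also have "\<dots> = (\<Sum>t'\<in>?K. const (Poly_Mapping.lookup (g i) t') * Poly_Mapping.single t' 1)"
        by (simp add: const_def mult_single)
      also have "\<dots> = const l * Poly_Mapping.single ?L 1 + (\<Sum>t'\<in>?K - {?L}. const (Poly_Mapping.lookup (g i) t') * Poly_Mapping.single t' 1)"
        unfolding l_def using L by (subst sum.remove[of ?K ?L]) auto
      finally show ?thesis .
    qed
    then have "const (1 / l) * Poly_Mapping.single s 1 * g i = const (1 / l) * Poly_Mapping.single s 1 *
        (const l * Poly_Mapping.single ?L 1 + (\<Sum>t'\<in>?K - {?L}. const (Poly_Mapping.lookup (g i) t') * Poly_Mapping.single t' 1))"
      by (rule arg_cong)
    also have "\<dots> = (const (1 / l) * const l) * (Poly_Mapping.single s 1 * Poly_Mapping.single ?L 1) +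
        (\<Sum>t'\<in>?K - {?L}. const (Poly_Mapping.lookup (g i) t' * (1 / l)) * (Poly_Mapping.single t' 1 * Poly_Mapping.single s 1))"
      unfolding distrib_left sum_distrib_left const_mult
      by (intro arg_cong2[where f = "(+)"] sum.cong) (simp_all only: ac_simps)
    also have "const (1 / l) * const l = 1" using l by (simp flip: const_mult)
    also have "Poly_Mapping.single s 1 * Poly_Mapping.single ?L 1 = Poly_Mapping.single t (1 :: complex)"
      by (simp add: mult_single i(2) add.commute)
    finally have "Poly_Mapping.single t 1 = const (1 / l) * Poly_Mapping.single s 1 * g i -
        (\<Sum>t'\<in>?K - {?L}. const (Poly_Mapping.lookup (g i) t' * (1 / l)) * Poly_Mapping.single (t' + s) 1)"
      by (simp add: mult_single)
    also have "\<dots> \<in> ?V"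
      by (intro cpoly.span_diff cpoly.span_sum cpoly.span_scale 1 2)
    finally show ?thesis .
  qed
qed

text \<open>A graded Nakayama argument: standard monomials span modulo \<open>(b1, b2)\<close>,
  hence generate \<open>S\<close> as a module over \<complex>\<open>[b1, b2]\<close>. Since the
  forms have positive degree, their coefficients have smaller degree, and the induction on
  \<open>N\<close> applies to them.\<close>

lemma span_standard_times_forms:
  fixes b1 b2 :: "('v::{finite,linorder}) mpoly"
  assumes b: "whomog unit_wt e1 b1" "whomog unit_wt e2 b2" "0 < e1" "0 < e2"
    and std: "\<And>t N. wt unit_wt t = N \<Longrightarrow>
      Poly_Mapping.single t 1 \<in> cpoly.span ((\<lambda>u. Poly_Mapping.single u 1) ` {u\<in>U. wt unit_wt u = N} \<union> {a * b1 + c * b2 | a c. True})"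
    and "wt unit_wt t \<le> N"
  shows "Poly_Mapping.single t 1 \<in> cpoly.span
    ((\<lambda>(u, i, j). Poly_Mapping.single u 1 * b1 ^ i * b2 ^ j) ` ({u\<in>U. wt unit_wt u \<le> N} \<times> {..N} \<times> {..N}))"
  using assms(6)
proof (induction N arbitrary: t rule: less_induct)
  case (less N)
  let ?S = "\<lambda>N. (\<lambda>(u, i, j). Poly_Mapping.single u 1 * b1 ^ i * b2 ^ j) ` ({u\<in>U. wt unit_wt u \<le> N} \<times> {..N} \<times> {..N})"
  let ?B = "{a * b1 + c * b2 | a c. True}"
  have homog: "p \<in> cpoly.span (?S M)" if "M < N" "whomog unit_wt M p" for p M
  proof -
    have "p = (\<Sum>t\<in>Poly_Mapping.keys p. const (Poly_Mapping.lookup p t) * Poly_Mapping.single t 1)"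
      by (subst poly_mapping_sum_keys) (simp add: const_def mult_single)
    also have "\<dots> \<in> cpoly.span (?S M)"
      using that by (intro cpoly.span_sum cpoly.span_scale less.IH) (auto simp: whomog_def)
    finally show ?thesis .
  qed
  define k where "k = wt unit_wt t"
  have kN: "k \<le> N" using less.prems by (simp add: k_def)
  have mono: "?S k \<subseteq> ?S N" using kN by (intro image_mono) auto
  have sub: "cpoly.subspace ?B" by (rule is_ideal_subspace[OF is_ideal_two_generators])
  have "Poly_Mapping.single t 1 \<in> cpoly.span ((\<lambda>u. Poly_Mapping.single u 1) ` {u\<in>U. wt unit_wt u = k} \<union> ?B)"
    by (rule std) (simp add: k_def)
  then obtain p \<beta> where p: "p \<in> cpoly.span ((\<lambda>u. Poly_Mapping.single u 1) ` {u\<in>U. wt unit_wt u = k})"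
    and \<beta>: "\<beta> \<in> ?B" "Poly_Mapping.single t 1 = p + \<beta>"
    unfolding cpoly.span_Un cpoly.span_eq_iff[THEN iffD2, OF sub] by blast
  \<comment> \<open>The monomial and \<open>p\<close> both have degree \<open>k\<close>, hence so
    does \<open>\<beta>\<close>. Its coefficients \<open>a\<close> and \<open>c\<close> may then be
    replaced by their components of degree \<open>k - e1\<close> and \<open>k - e2\<close>.\<close>
  have "whomog unit_wt k p" by (rule whomog_span[OF p]) (auto simp: whomog_def)
  moreover have "whomog unit_wt k (Poly_Mapping.single t (1::complex))" by (simp add: whomog_def k_def)
  ultimately have "whomog unit_wt k \<beta>"
    using whomog_diff[of unit_wt k "Poly_Mapping.single t 1" p] \<beta>(2) by simp
  then have \<beta>k: "wpart unit_wt k \<beta> = \<beta>" by (simp add: wpart_whomog)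
  obtain a c where ac: "\<beta> = b1 * a + b2 * c" using \<beta>(1) by (auto simp: mult.commute)
  have step: "r * q \<in> cpoly.span (?S N)"
    if r: "r = b1 \<and> e = e1 \<or> r = b2 \<and> e = e2" and q: "q = (if e \<le> k then wpart unit_wt (k - e) q' else 0)" for r q e q'
  proof (cases "e \<le> k")
    case True
    have e: "0 < e" using b r by auto
    then have lt: "k - e < N" using True kN by simp
    have "q \<in> cpoly.span (?S (k - e))" using homog[OF lt] q True by (simp add: whomog_wpart)
    then show ?thesis
    proof (rule cpoly_span_mult)
      fix s assume "s \<in> ?S (k - e)"
      then obtain u i j where s: "s = Poly_Mapping.single u 1 * b1 ^ i * b2 ^ j" "u \<in> U" "wt unit_wt u \<le> k - e" "i \<le> k - e" "j \<le> k - e"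
        by auto
      have "r * s \<in> ?S N"
        using r
      proof
        assume "r = b1 \<and> e = e1"
        then have "r * s = (\<lambda>(u, i, j). Poly_Mapping.single u 1 * b1 ^ i * b2 ^ j) (u, Suc i, j)"
          by (simp add: s ac_simps)
        \<comment> \<open>The exponent may grow by one because
          \<open>i \<le> k - e < N\<close>.\<close>
        then show ?thesis using s kN lt e True by (intro image_eqI[where x = "(u, Suc i, j)"]) auto
      next
        assume "r = b2 \<and> e = e2"
        then have "r * s = (\<lambda>(u, i, j). Poly_Mapping.single u 1 * b1 ^ i * b2 ^ j) (u, i, Suc j)"
          by (simp add: s ac_simps)
        then show ?thesis using s kN lt e True by (intro image_eqI[where x = "(u, i, Suc j)"]) auto
      qed
      then show "r * s \<in> cpoly.span (?S N)" by (rule cpoly.span_base)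
    qed
  next
    case False
    then show ?thesis using q by (simp add: cpoly.span_zero)
  qed
  have "\<beta> = b1 * (if e1 \<le> k then wpart unit_wt (k - e1) a else 0) + b2 * (if e2 \<le> k then wpart unit_wt (k - e2) c else 0)"
    using \<beta>k unfolding ac wpart_add wpart_whomog_mult[OF b(1)] wpart_whomog_mult[OF b(2)] by auto
  also have "\<dots> \<in> cpoly.span (?S N)"
    using step[of b1 e1 _ a] step[of b2 e2 _ c] by (intro cpoly.span_add) auto
  finally have "\<beta> \<in> cpoly.span (?S N)" .
  moreover have "p \<in> cpoly.span (?S N)"
  proof -
    have "(\<lambda>u. Poly_Mapping.single u 1) ` {u\<in>U. wt unit_wt u = k} \<subseteq> ?S N"
    proof (rule image_subsetI)
      fix u assume "u \<in> {u\<in>U. wt unit_wt u = k}"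
      then show "Poly_Mapping.single u 1 \<in> ?S N"
        using kN by (intro image_eqI[where x = "(u, 0, 0)"]) auto
    qed
    then show ?thesis using p cpoly.span_mono by blast
  qed
  ultimately show ?case unfolding \<beta>(2) by (intro cpoly.span_add)
qed

text \<open>A monomial with exponents at least \<open>D\<close> at all places of some
  \<open>I\<close> is a multiple of \<open>L I\<close>. So a standard monomial has at most
  \<open>CARD('v) - 3\<close> large exponents. For each of the at most \<open>2^CARD('v)\<close>
  possible sets of large places, the small exponents have \<open>D\<close> choices and the large
  ones \<open>M\<close>.\<close>

lemma card_standard_le:
  fixes L :: "'v::finite set \<Rightarrow> ('v \<Rightarrow>\<^sub>0 nat)"
  assumes v: "3 \<le> CARD('v)" and D: "0 < D" "D \<le> M"
    and L: "\<And>I. card I = CARD('v) - 2 \<Longrightarrow> L I \<in> box D \<and> Poly_Mapping.keys (L I) \<subseteq> I"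
    and U: "\<And>t. t \<in> U \<Longrightarrow> \<not> (\<exists>I s. card I = CARD('v) - 2 \<and> t = L I + s)"
  shows "card (U \<inter> box M) \<le> 2 ^ CARD('v) * (D ^ CARD('v) * M ^ (CARD('v) - 3))"
proof -
  let ?v = "CARD('v)"
  let ?h = "\<lambda>J (j::'v). if j \<in> J then M else D"
  let ?X = "\<lambda>J. {t. \<forall>j. Poly_Mapping.lookup t j < ?h J j}"
  let ?JJ = "{J :: 'v set. card J \<le> ?v - 3}"
  have "U \<inter> box M \<subseteq> (\<Union>J\<in>?JJ. ?X J)"
  proof
    fix t assume t: "t \<in> U \<inter> box M"
    let ?J = "{j. D \<le> Poly_Mapping.lookup t j}"
    have "card ?J \<le> ?v - 3"
    proof (rule ccontr)
      assume "\<not> card ?J \<le> ?v - 3"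
      then have "?v - 2 \<le> card ?J" using v by linarith
      then obtain I where I: "I \<subseteq> ?J" "card I = ?v - 2" using obtain_subset_with_card_n by metis
      have "t = L I + (t - L I)"
      proof (rule poly_mapping_eqI)
        fix j
        have "Poly_Mapping.lookup (L I) j \<le> Poly_Mapping.lookup t j"
        proof (cases "j \<in> I")
          case True
          then have "D \<le> Poly_Mapping.lookup t j" using I by auto
          moreover have "Poly_Mapping.lookup (L I) j < D" using L[OF I(2)] by (auto simp: box_def)
          ultimately show ?thesis by simp
        next
          case False
          then have "j \<notin> Poly_Mapping.keys (L I)" using L[OF I(2)] by auto
          then show ?thesis by (simp add: in_keys_iff)
        qed
        then show "Poly_Mapping.lookup t j = Poly_Mapping.lookup (L I + (t - L I)) j"
          by (simp add: lookup_add lookup_minus)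
      qed
      then show False using U[of t] t I(2) by blast
    qed
    moreover have "t \<in> ?X ?J" using t by (auto simp: box_def not_le)
    ultimately show "t \<in> (\<Union>J\<in>?JJ. ?X J)" by blast
  qed
  moreover have fin: "finite (\<Union>J\<in>?JJ. ?X J)" by (intro finite_UN_I card_bounded_monomials(1)) simp
  ultimately have "card (U \<inter> box M) \<le> card (\<Union>J\<in>?JJ. ?X J)" by (intro card_mono)
  also have "\<dots> \<le> (\<Sum>J\<in>?JJ. card (?X J))" by (rule card_UN_le) simp
  also have "\<dots> \<le> (\<Sum>J\<in>?JJ. D ^ ?v * M ^ (?v - 3))"
  proof (rule sum_mono)
    fix J assume J: "J \<in> ?JJ"
    have "card (?X J) = (\<Prod>j\<in>UNIV. ?h J j)" by (rule card_bounded_monomials(2))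
    also have "\<dots> \<le> (\<Prod>j\<in>UNIV. D * (if j \<in> J then M else 1))"
      using D by (intro prod_mono) auto
    also have "\<dots> = D ^ ?v * (\<Prod>j\<in>UNIV. if j \<in> J then M else 1)" by (simp add: prod.distrib)
    also have "(\<Prod>j\<in>UNIV. if j \<in> J then M else 1) = M ^ card J" by (simp add: prod.If_cases)
    also have "M ^ card J \<le> M ^ (?v - 3)" using J D by (intro power_increasing) auto
    finally show "card (?X J) \<le> D ^ ?v * M ^ (?v - 3)" by simp
  qed
  also have "\<dots> = card ?JJ * (D ^ ?v * M ^ (?v - 3))" by simp
  also have "card ?JJ \<le> 2 ^ ?v"
    using card_mono[of "Pow (UNIV :: 'v set)" ?JJ] by (simp add: card_Pow)
  finally show ?thesis by simp
qed

text \<open>Otherwise every \<open>I\<close> of this size carries a nonzero element of the ideal,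
  and the standard monomials in a box of side \<open>M\<close> number only a constant times
  \<open>M^(CARD('v) - 3)\<close>. Products with powers of the two forms contribute another
  \<open>M^2\<close>, which is too few to span all monomials of a box.\<close>

lemma two_forms_transversal:
  fixes b1 b2 :: "('v::{finite,linorder}) mpoly"
  assumes v: "3 \<le> CARD('v)" and b: "whomog unit_wt e1 b1" "whomog unit_wt e2 b2" "0 < e1" "0 < e2"
  shows "\<exists>I. card I = CARD('v) - 2 \<and> polys I \<inter> {a * b1 + c * b2 | a c. True} \<subseteq> {0}"
proof (rule ccontr)
  let ?v = "CARD('v)" and ?B = "{a * b1 + c * b2 | a c. True}"
  assume "\<not> ?thesis"
  then have ex: "\<exists>g. g \<in> polys I \<inter> ?B \<and> g \<noteq> 0" if "card I = ?v - 2" for I using that by blast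
  have B: "is_ideal ?B" by (rule is_ideal_two_generators)
  \<comment> \<open>An ideal generated by forms contains the components of its elements, so each
    element found in \<open>polys I\<close> can be replaced by its top component.\<close>
  have Bpart: "wpart unit_wt k x \<in> ?B" if x: "x \<in> ?B" for x k
  proof -
    obtain a c where "x = a * b1 + c * b2" using x by blast
    then have "x = b1 * a + b2 * c" by (simp only: mult.commute)
    then have "wpart unit_wt k x = (if e1 \<le> k then wpart unit_wt (k - e1) a else 0) * b1
        + (if e2 \<le> k then wpart unit_wt (k - e2) c else 0) * b2"
      by (simp add: wpart_add wpart_whomog_mult[OF b(1)] wpart_whomog_mult[OF b(2)] mult.commute[of _ b1] mult.commute[of _ b2])
    then show ?thesis by blast
  qed
  have "\<exists>g e. g \<in> polys I \<and> g \<in> ?B \<and> g \<noteq> 0 \<and> whomog unit_wt e g" if I: "card I = ?v - 2" for I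
  proof -
    obtain g where g: "g \<in> polys I" "g \<in> ?B" "g \<noteq> 0" using ex[OF I] by blast
    then show ?thesis
      using Bpart[OF g(2)] by (intro exI[of _ "wpart unit_wt (tdeg g) g"] exI[of _ "tdeg g"])
        (auto simp: wpart_polys wpart_wdeg_nonzero whomog_wpart)
  qed
  then have "\<forall>I\<in>{I. card I = ?v - 2}. \<exists>g. \<exists>e. g \<in> polys I \<and> g \<in> ?B \<and> g \<noteq> 0 \<and> whomog unit_wt e g" by simp
  from bchoice[OF this] obtain g where
    "\<forall>I\<in>{I. card I = ?v - 2}. \<exists>e. g I \<in> polys I \<and> g I \<in> ?B \<and> g I \<noteq> 0 \<and> whomog unit_wt e (g I)" by (rule exE)
  from bchoice[OF this] obtain e where
    "\<forall>I\<in>{I. card I = ?v - 2}. g I \<in> polys I \<and> g I \<in> ?B \<and> g I \<noteq> 0 \<and> whomog unit_wt (e I) (g I)" by (rule exE)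
  then have g: "\<And>I. card I = ?v - 2 \<Longrightarrow>
      g I \<in> polys I \<and> g I \<in> ?B \<and> g I \<noteq> 0 \<and> whomog unit_wt (e I) (g I)" by simp
  define L where "L I = Max (Poly_Mapping.keys (g I))" for I
  have LK: "L I \<in> Poly_Mapping.keys (g I)" if "card I = ?v - 2" for I
    unfolding L_def using g[OF that] by (intro Max_in) auto
  define U where "U = {t. \<not> (\<exists>I s. card I = ?v - 2 \<and> t = L I + s)}"
  \<comment> \<open>Listing all subsets of the variables turns the bound for lists into one that is
    uniform in \<open>I\<close>.\<close>
  have "\<exists>k. \<forall>p\<in>set (map g (SOME xs. set xs = (UNIV :: 'v set set))). Poly_Mapping.keys p \<subseteq> box (Suc k)"
    by (rule keys_in_box_exists)
  moreover have "set (SOME xs. set xs = (UNIV :: 'v set set)) = UNIV"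
    by (rule someI_ex) (rule finite_list, simp)
  ultimately obtain k where k: "\<And>I. Poly_Mapping.keys (g I) \<subseteq> box (Suc k)" by auto
  define D where "D = Suc k"
  have LD: "L I \<in> box D \<and> Poly_Mapping.keys (L I) \<subseteq> I" if "card I = ?v - 2" for I
    using LK[OF that] k g[OF that] by (auto simp: D_def polys_def)
  have std: "Poly_Mapping.single t 1 \<in> cpoly.span ((\<lambda>u. Poly_Mapping.single u 1) ` {u\<in>U. wt unit_wt u = N} \<union> ?B)"
    if "wt unit_wt t = N" for t N
    by (rule reduce_to_standard[OF B, of "{I. card I = ?v - 2}" g e])
      (use g that in \<open>auto simp: U_def L_def\<close>)
  \<comment> \<open>\<open>C\<close> is the constant in the final estimate: two factors come from
    \<open>card_standard_le\<close>, and the last from bounding \<open>?M\<close> by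
    \<open>(D + ?v) * N\<close>. Taking \<open>N = C + 1\<close> contradicts the resulting
    \<open>N \<le> C\<close>. Monomials in \<open>box N\<close> have degree at most
    \<open>M\<close>; adding \<open>D\<close> makes \<open>?M\<close> exceed every exponent up to
    \<open>M\<close> and be at least \<open>D\<close>.\<close>
  define C where "C = 2 ^ ?v * D ^ ?v * (D + ?v) ^ (?v - 1)"
  define N where "N = Suc C"
  define M where "M = ?v * N"
  let ?M = "D + M"
  let ?S = "(\<lambda>(u, i, j). Poly_Mapping.single u 1 * b1 ^ i * b2 ^ j) ` ({u\<in>U. wt unit_wt u \<le> M} \<times> {..M} \<times> {..M})"
  have finS: "finite ({u\<in>U. wt unit_wt u \<le> M} \<times> {..M} \<times> {..M})"
    using finite_subset[OF _ finite_degree[of M], of "{u\<in>U. wt unit_wt u \<le> M}"] by auto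
  have "(\<lambda>t. Poly_Mapping.single t 1) ` box N \<subseteq> cpoly.span ?S"
  proof (rule image_subsetI)
    fix t :: "'v \<Rightarrow>\<^sub>0 nat" assume t: "t \<in> box N"
    have "wt unit_wt t \<le> (\<Sum>j\<in>(UNIV :: 'v set). N)"
      unfolding wt_def unit_wt_def using t by (intro sum_mono) (auto simp: box_def less_imp_le)
    then have "wt unit_wt t \<le> M" by (simp add: M_def)
    then show "Poly_Mapping.single t 1 \<in> cpoly.span ?S"
      using span_standard_times_forms[OF b std] by blast
  qed
  then have "card ((\<lambda>t. Poly_Mapping.single t 1 :: 'v mpoly) ` box N) \<le> card ?S"
    using cpoly.independent_span_bound[OF finite_imageI[OF finS]] independent_monomials(1)[OF card_box(1)] by blast
  then have "N ^ ?v \<le> card ?S" by (simp add: independent_monomials(2)[OF card_box(1)] card_box(2))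
  also have "\<dots> \<le> card ({u\<in>U. wt unit_wt u \<le> M} \<times> {..M} \<times> {..M})" by (rule card_image_le[OF finS])
  also have "\<dots> = card {u\<in>U. wt unit_wt u \<le> M} * (Suc M) ^ 2" by (simp add: card_cartesian_product power2_eq_square)
  also have "\<dots> \<le> card (U \<inter> box ?M) * ?M ^ 2"
  proof (intro mult_mono power_mono card_mono)
    show "{u\<in>U. wt unit_wt u \<le> M} \<subseteq> U \<inter> box ?M"
    proof
      fix u assume u: "u \<in> {u\<in>U. wt unit_wt u \<le> M}"
      have "Poly_Mapping.lookup u j < ?M" for j
      proof -
        have "Poly_Mapping.lookup u j \<le> M" using u lookup_le_wt[of u j] by simp
        then show ?thesis by (simp add: D_def)
      qed
      then show "u \<in> U \<inter> box ?M" using u by (simp add: box_def)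
    qed
  qed (auto simp: card_box D_def)
  also have "\<dots> \<le> (2 ^ ?v * (D ^ ?v * ?M ^ (?v - 3))) * ?M ^ 2"
    by (intro mult_right_mono card_standard_le[OF v _ _ LD]) (auto simp: D_def U_def)
  also have "\<dots> = 2 ^ ?v * D ^ ?v * ?M ^ (?v - 1)"
  proof -
    have "?v - 1 = (?v - 3) + 2" using v by simp
    then show ?thesis by (simp only: power_add ac_simps)
  qed
  also have "?M ^ (?v - 1) \<le> ((D + ?v) * N) ^ (?v - 1)"
    by (intro power_mono) (auto simp: M_def N_def algebra_simps)
  finally have "N ^ ?v \<le> C * N ^ (?v - 1)" by (simp add: C_def power_mult_distrib ac_simps)
  moreover have "N ^ ?v = N * N ^ (?v - 1)" using v by (metis One_nat_def Suc_pred power_Suc zero_less_card_finite)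
  ultimately have "N * N ^ (?v - 1) \<le> C * N ^ (?v - 1)" by simp
  then show False by (simp add: N_def)
qed

text \<open>The variables in \<open>I\<close> remain independent modulo \<open>Q\<close>, so a chain
  ending in \<open>Q\<close> has length at most \<open>CARD('v) - (CARD('v) - 2)\<close>.\<close>

lemma prime_over_two_forms:
  fixes b1 b2 :: "('v::{finite,linorder}) mpoly"
  assumes "3 \<le> CARD('v)" "whomog unit_wt e1 b1" "whomog unit_wt e2 b2" "0 < e1" "0 < e2"
  shows "\<exists>Q. is_prime Q \<and> b1 \<in> Q \<and> b2 \<in> Q \<and> (\<forall>P k. chain P k \<and> P k = Q \<longrightarrow> k \<le> 2)"
proof -
  let ?B = "{a * b1 + c * b2 | a c. True}"
  obtain I where I: "card I = CARD('v) - 2" "polys I \<inter> ?B \<subseteq> {0}" using two_forms_transversal[OF assms] by blast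
  have "is_ideal ?B" by (rule is_ideal_two_generators)
  then obtain Q where Q: "is_prime Q" "?B \<subseteq> Q" "polys I \<inter> Q \<subseteq> {0}" using exists_prime_avoiding I by blast
  have "b1 \<in> ?B" by (intro CollectI exI[of _ 1] exI[of _ 0]) simp
  moreover have "b2 \<in> ?B" by (intro CollectI exI[of _ 0] exI[of _ 1]) simp
  moreover have "k \<le> 2" if "chain P k" "P k = Q" for P k
  proof -
    obtain zs where zs: "set zs = I" "distinct zs" using finite_distinct_list[of I] by auto
    have "alg_indep_mod (P k) (map var zs)" unfolding that(2) by (rule alg_indep_mod_vars[OF Q(3) zs(2)]) (simp add: zs)
    then have "k + length (map var zs) \<le> CARD('v)" by (rule chain_length_le[OF that(1)])
    moreover have "length zs = card I" using zs distinct_card by metis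
    ultimately show ?thesis using I(1) assms(1) by simp
  qed
  ultimately show ?thesis using Q by blast
qed

section \<open>Partial derivatives\<close>

lemma lookup_partial:
  "Poly_Mapping.lookup (partial j p) s =
    of_nat (Suc (Poly_Mapping.lookup s j)) * Poly_Mapping.lookup p (s + Poly_Mapping.single j 1)"
proof -
  let ?e = "Poly_Mapping.single j (1::nat)"
  have "Poly_Mapping.lookup (partial j p) s = (\<Sum>t\<in>Poly_Mapping.keys p.
      if t = s + ?e then of_nat (Suc (Poly_Mapping.lookup s j)) * Poly_Mapping.lookup p t else 0)"
    unfolding partial_def lookup_sum
  proof (rule sum.cong)
    fix t assume "t \<in> Poly_Mapping.keys p"
    show "Poly_Mapping.lookup (Poly_Mapping.single (t - ?e) (of_nat (Poly_Mapping.lookup t j) * Poly_Mapping.lookup p t)) s =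
      (if t = s + ?e then of_nat (Suc (Poly_Mapping.lookup s j)) * Poly_Mapping.lookup p t else 0)"
    proof (cases "t = s + ?e")
      case True
      then show ?thesis by (simp add: lookup_add)
    next
      case False
      \<comment> \<open>Truncated subtraction can send another monomial to \<open>s\<close> only if
        \<open>x_j\<close> does not occur in it, and then its coefficient in the derivative is
        0.\<close>
      have "Poly_Mapping.lookup t j = 0" if eq: "t - ?e = s"
      proof (rule ccontr)
        assume nz: "Poly_Mapping.lookup t j \<noteq> 0"
        have "t = s + ?e"
        proof (rule poly_mapping_eqI)
          fix i
          show "Poly_Mapping.lookup t i = Poly_Mapping.lookup (s + ?e) i"
            using nz unfolding eq[symmetric] by (auto simp: lookup_add lookup_minus lookup_single when_def)
        qed
        with False show False ..
      qed
      then show ?thesis using False by (auto simp: lookup_single when_def)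
    qed
  qed simp
  then show ?thesis by (simp add: in_keys_iff)
qed

lemma partial_add: "partial j (p + q) = partial j p + partial j q"
  by (rule poly_mapping_eqI) (simp add: lookup_partial lookup_add algebra_simps)

lemma partial_single: "partial j (Poly_Mapping.single t c) =
    Poly_Mapping.single (t - Poly_Mapping.single j 1) (of_nat (Poly_Mapping.lookup t j) * c)"
  by (cases "c = 0") (simp_all add: partial_def)

lemma mpoly_induct [case_names single add]:
  fixes p :: "'v mpoly"
  assumes "\<And>t c. P (Poly_Mapping.single t c)" "\<And>p q. P p \<Longrightarrow> P q \<Longrightarrow> P (p + q)"
  shows "P p"
proof -
  have "P (\<Sum>t\<in>T. Poly_Mapping.single t (Poly_Mapping.lookup p t))" if "finite T" for T
    using that
  proof (induction T rule: finite_induct)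
    case empty
    then show ?case using assms(1)[of 0 0] by simp
  qed (auto intro: assms)
  then show ?thesis by (subst poly_mapping_sum_keys) simp
qed

lemma partial_mult_single:
  "partial j (Poly_Mapping.single s a * Poly_Mapping.single t b) =
    partial j (Poly_Mapping.single s a) * Poly_Mapping.single t b +
    Poly_Mapping.single s a * partial j (Poly_Mapping.single t b)"
proof -
  let ?e = "Poly_Mapping.single j (1::nat)"
  have move: "Poly_Mapping.single (u - ?e + w) (of_nat (Poly_Mapping.lookup u j) * c) =
      Poly_Mapping.single (u + w - ?e) (of_nat (Poly_Mapping.lookup u j) * c)" for u w and c :: complex
  proof (cases "Poly_Mapping.lookup u j = 0")
    case False
    have "u - ?e + w = u + w - ?e"
      using False by (intro poly_mapping_eqI) (auto simp: lookup_add lookup_minus lookup_single when_def)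
    then show ?thesis by simp
  qed simp
  show ?thesis
    using move[of s t "a * b"] move[of t s "a * b"]
    by (simp add: mult_single partial_single lookup_add distrib_right distrib_left single_add ac_simps)
qed

lemma partial_mult: "partial j (p * q) = partial j p * q + p * partial j q"
proof (induction p rule: mpoly_induct)
  case (single s a)
  show ?case
  proof (induction q rule: mpoly_induct)
    case (single t b)
    show ?case by (rule partial_mult_single)
  qed (simp add: partial_add algebra_simps)
qed (simp add: partial_add algebra_simps)

lemma euler:
  assumes "homogeneous d f"
  shows "(\<Sum>j\<in>UNIV. var j * partial j f) = of_nat d * f"
proof -
  have single: "var j * partial j (Poly_Mapping.single t c) = of_nat (Poly_Mapping.lookup t j) * Poly_Mapping.single t c" for j t c
  proof (cases "Poly_Mapping.lookup t j = 0")
    case False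
    then have "Poly_Mapping.single j 1 + (t - Poly_Mapping.single j 1) = t"
      by (intro poly_mapping_eqI) (auto simp: lookup_add lookup_minus lookup_single when_def)
    then show ?thesis by (simp add: partial_single var_def mult_single flip: single_of_nat)
  qed (simp add: partial_single)
  have psum: "partial j (sum g T) = (\<Sum>t\<in>T. partial j (g t))" for j T and g :: "_ \<Rightarrow> 'a mpoly"
    by (induction T rule: infinite_finite_induct) (auto simp: partial_add, simp_all add: partial_def)
  let ?t = "\<lambda>t. Poly_Mapping.single t (Poly_Mapping.lookup f t)"
  have f: "f = (\<Sum>t\<in>Poly_Mapping.keys f. ?t t)" by (rule poly_mapping_sum_keys)
  have "partial j f = (\<Sum>t\<in>Poly_Mapping.keys f. partial j (?t t))" for j
    by (subst f) (rule psum)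
  then have "(\<Sum>j\<in>UNIV. var j * partial j f) = (\<Sum>j\<in>UNIV. \<Sum>t\<in>Poly_Mapping.keys f. of_nat (Poly_Mapping.lookup t j) * ?t t)"
    by (simp add: sum_distrib_left single)
  also have "\<dots> = (\<Sum>t\<in>Poly_Mapping.keys f. of_nat (total_deg t) * ?t t)"
    by (subst sum.swap) (simp add: total_deg_def sum_distrib_right)
  also have "\<dots> = of_nat d * (\<Sum>t\<in>Poly_Mapping.keys f. ?t t)"
    using assms unfolding sum_distrib_left homogeneous_def by (intro sum.cong) auto
  finally show ?thesis using f by simp
qed

text \<open>For a variable occurring in a monomial of top degree, the derivative is nonzero in
  characteristic 0 and has smaller degree in that variable.\<close>

lemma partial_not_dvd:
  fixes p :: "('v::{finite,linorder}) mpoly"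
  assumes "0 < tdeg p"
  shows "\<exists>i. \<not> p dvd partial i p"
proof -
  have "p \<noteq> 0" using assms by (auto simp: wdeg_def)
  then obtain t where t: "t \<in> Poly_Mapping.keys p" "wt unit_wt t = tdeg p" by (rule wdeg_attained)
  then have "t \<noteq> 0" using assms by auto
  then obtain i where i: "Poly_Mapping.lookup t i \<noteq> 0" using lookup_pm_zero_iff by blast
  let ?e = "Poly_Mapping.single i (1::nat)"
  have "t - ?e + ?e = t" using i by (intro poly_mapping_eqI) (auto simp: lookup_add lookup_minus lookup_single when_def)
  then have "Poly_Mapping.lookup (partial i p) (t - ?e) \<noteq> 0"
    using t(1) by (simp add: lookup_partial in_keys_iff del: of_nat_Suc)
  then have nz: "partial i p \<noteq> 0" by auto
  have "wdeg (var_wt i) (partial i p) < wdeg (var_wt i) p"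
  proof -
    obtain s where s: "s \<in> Poly_Mapping.keys (partial i p)" "wt (var_wt i) s = wdeg (var_wt i) (partial i p)"
      using nz by (rule wdeg_attained)
    then have "s + ?e \<in> Poly_Mapping.keys p" by (auto simp: in_keys_iff lookup_partial)
    then have "wt (var_wt i) (s + ?e) \<le> wdeg (var_wt i) p" by (rule wt_le_wdeg)
    then show ?thesis using s(2) by (simp add: wt_add var_wt_def)
  qed
  then have "\<not> p dvd partial i p" using dvd_imp_wdeg_le[OF _ nz, of p "var_wt i"] by auto
  then show ?thesis ..
qed

lemma of_nat_dvd_one: "d \<noteq> 0 \<Longrightarrow> (of_nat d :: 'v mpoly) dvd 1"
  using const_dvd_one[of "of_nat d"] by (simp add: const_def)

lemma squarefree_imp_nonzero: "squarefree f \<Longrightarrow> f \<noteq> 0" for f :: "'v mpoly"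
proof
  assume sqf: "squarefree f" and "f = 0"
  then have "(0 :: 'v mpoly) dvd 1" unfolding squarefree_def by (metis dvd_0_right)
  then show False by simp
qed

text \<open>If \<open>p\<close> divided all partial derivatives, Euler's formula would give
  \<open>f = p * q\<close>. By the product rule \<open>p\<close> divides every
  \<open>partial i p * q\<close>, so it divides \<open>q\<close>, and \<open>p^2\<close> divides
  \<open>f\<close>.\<close>

lemma squarefree_partial_not_dvd:
  fixes p f :: "('v::{finite,linorder}) mpoly"
  assumes "prime_elem p" "homogeneous d f" "0 < d" "squarefree f"
  shows "\<exists>i. \<not> p dvd partial i f"
proof (rule ccontr)
  assume "\<not> (\<exists>i. \<not> p dvd partial i f)"
  then have all: "p dvd partial i f" for i by blast
  then have "p dvd (\<Sum>j\<in>UNIV. var j * partial j f)" by (intro dvd_sum) auto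
  then have "p dvd of_nat d * f" using euler[OF assms(2)] by simp
  moreover have "of_nat d * f dvd f" by (rule unit_mult_dvd[OF of_nat_dvd_one]) (use assms(3) in simp)
  ultimately have "p dvd f" by (rule dvd_trans)
  then obtain q where q: "f = p * q" by (elim dvdE)
  have "p \<noteq> 0" "\<not> p dvd 1" using assms(1) by (auto simp: prime_elem_def)
  then have "0 < tdeg p" using unit_iff[of p] by auto
  then obtain i where i: "\<not> p dvd partial i p" using partial_not_dvd by blast
  have "partial i f = partial i p * q + p * partial i q" unfolding q by (rule partial_mult)
  then have "p dvd partial i p * q + p * partial i q" using all[of i] by simp
  then have "p dvd partial i p * q" by (simp add: dvd_add_left_iff)
  then have "p dvd q" using i assms(1) by (auto simp: prime_elem_def)
  then have "p ^ 2 dvd f" unfolding q by (auto simp: power2_eq_square elim!: dvdE)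
  then have "p dvd 1" using assms(4) by (auto simp: squarefree_def)
  then show False using \<open>\<not> p dvd 1\<close> by simp
qed

text \<open>Divisors of \<open>f\<close> are built up one prime \<open>p\<close> at a time. At each
  step some partial derivative is prime to \<open>p\<close> and can be cancelled; which one depends
  on \<open>p\<close>.\<close>

lemma squarefree_dvd_cancel_partials:
  fixes f D :: "('v::{finite,linorder}) mpoly"
  assumes f: "homogeneous d f" "0 < d" "squarefree f" and D: "\<And>i. f dvd D * partial i f"
  shows "f dvd D"
proof -
  have f0: "f \<noteq> 0" by (rule squarefree_imp_nonzero[OF f(3)])
  have "h dvd D" if "h dvd f" for h
    using that
  proof (induction "tdeg h" arbitrary: h rule: less_induct)
    case less
    have h0: "h \<noteq> 0" using less.prems f0 by auto
    show ?case
    proof (cases "h dvd 1")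
      case True
      then show ?thesis by (rule dvd_trans) simp
    next
      case False
      then obtain p where p: "prime_elem p" "p dvd h" using prime_dvd_exists[OF h0] by blast
      then obtain h' where h': "h = p * h'" by (elim dvdE)
      have nz: "p \<noteq> 0" "h' \<noteq> 0" using h0 h' by auto
      have "tdeg h' < tdeg h"
        using nz p(1) unit_iff[of p] unfolding h' by (auto simp: wdeg_mult prime_elem_def)
      moreover have "h' dvd f" using less.prems unfolding h' by (rule dvd_mult_right)
      ultimately have "h' dvd D" using less.hyps by blast
      then obtain D' where D': "D = h' * D'" by (elim dvdE)
      obtain i where i: "\<not> p dvd partial i f" using squarefree_partial_not_dvd[OF p(1) f] by blast
      have "h dvd D * partial i f" using less.prems D[of i] by (rule dvd_trans)
      then have "h' * p dvd h' * (D' * partial i f)" unfolding h' D' by (simp add: ac_simps)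
      then have "p dvd D' * partial i f" using nz by simp
      then have "p dvd D'" using i p(1) by (auto simp: prime_elem_def)
      then show ?thesis unfolding h' D' by (simp add: mult.commute mult_dvd_mono)
    qed
  qed
  then show ?thesis by simp
qed

section \<open>Determinants\<close>

lemma dvd_det_column:
  fixes A :: "'a::comm_ring_1^'n^'n"
  assumes "\<And>k. r dvd A $ k $ i"
  shows "r dvd det A"
  unfolding det_def
proof (intro dvd_sum dvd_mult)
  fix p :: "'n \<Rightarrow> 'n" assume "p \<in> {p. p permutes UNIV}"
  then obtain k where "p k = i" using permutes_surj by (metis mem_Collect_eq surjD)
  then have "r dvd A $ k $ p k" using assms by simp
  then show "r dvd (\<Prod>k\<in>UNIV. A $ k $ p k)"
    by (metis UNIV_I dvd_prodI finite dvd_trans)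
qed

text \<open>A permutation other than the identity moves some index besides \<open>i\<close>, where
  the matrix is diagonal.\<close>

lemma det_replace_row:
  fixes w :: "'a::comm_ring_1^'n"
  shows "det (\<chi> k l. if k = i then w $ l else if k = l then c else 0) = w $ i * c ^ (CARD('n) - 1)"
proof -
  let ?A = "(\<chi> k l. if k = i then w $ l else if k = l then c else 0) :: 'a^'n^'n"
  have "(\<Prod>k\<in>UNIV. ?A $ k $ p k) = 0" if p: "p permutes UNIV" "p \<noteq> id" for p
  proof -
    have "\<exists>k. k \<noteq> i \<and> p k \<noteq> k"
    proof (rule ccontr)
      assume *: "\<nexists>k. k \<noteq> i \<and> p k \<noteq> k"
      then have "p i = i" using permutes_inj[OF p(1)] by (metis injD)
      with * have "p = id" by (intro ext) (metis id_apply)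
      with p show False by simp
    qed
    then obtain k where "k \<noteq> i" "p k \<noteq> k" by blast
    then show ?thesis by (intro prod_zero bexI[of _ k]) auto
  qed
  then have "det ?A = (\<Sum>p\<in>{id}. of_int (sign p) * (\<Prod>k\<in>UNIV. ?A $ k $ p k))"
    unfolding det_def by (intro sum.mono_neutral_right) (auto simp: permutes_id finite_permutations)
  also have "\<dots> = (\<Prod>k\<in>UNIV. ?A $ k $ k)" by simp
  also have "\<dots> = ?A $ i $ i * (\<Prod>k\<in>UNIV - {i}. ?A $ k $ k)" by (rule prod.remove) auto
  also have "(\<Prod>k\<in>UNIV - {i}. ?A $ k $ k) = (\<Prod>k\<in>UNIV - {i}. c)" by (intro prod.cong) auto
  also have "\<dots> = c ^ (CARD('n) - 1)" by (simp add: card_Diff_singleton)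
  finally show ?thesis by simp
qed

lemma det_replace_column:
  fixes w :: "'a::comm_ring_1^'n"
  shows "det (\<chi> k l. if l = i then w $ k else if k = l then c else 0) = w $ i * c ^ (CARD('n) - 1)"
proof -
  have "transpose (\<chi> k l. if l = i then w $ k else if k = l then c else 0) = (\<chi> k l. if k = i then w $ l else if k = l then c else 0)"
    by (auto simp: transpose_def vec_eq_iff)
  then show ?thesis using det_replace_row[of i w c] by (subst det_transpose[symmetric]) simp
qed

lemma matrix_mult_replace_column:
  fixes A :: "'a::comm_ring_1^'n^'n"
  shows "A ** (\<chi> k l. if l = i then w $ k else if k = l then 1 else 0) = (\<chi> k l. if l = i then (A *v w) $ k else A $ k $ l)"
  unfolding vec_eq_iff
proof (intro allI)
  fix k l
  have "(\<Sum>j\<in>UNIV. A $ k $ j * (if j = l then 1 else 0)) = A $ k $ l"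
    by (simp add: if_distrib[of "\<lambda>x. _ * x"] cong: if_cong)
  then show "(A ** (\<chi> k l. if l = i then w $ k else if k = l then 1 else 0)) $ k $ l = (\<chi> k l. if l = i then (A *v w) $ k else A $ k $ l) $ k $ l"
    by (simp add: matrix_matrix_mult_def matrix_vector_mult_def)
qed

text \<open>Cramer's rule without division: multiply \<open>A\<close> by the identity matrix whose
  column \<open>i\<close> is replaced by \<open>w\<close>.\<close>

lemma det_mult_vec_nth:
  fixes A :: "'a::comm_ring_1^'n^'n"
  shows "det A * w $ i = det (\<chi> k l. if l = i then (A *v w) $ k else A $ k $ l)"
  using det_mul[of A "\<chi> k l. if l = i then w $ k else if k = l then 1 else 0"]
  by (simp add: det_replace_column matrix_mult_replace_column)

lemma whomog_det:
  fixes A :: "('v::finite) mpoly^'n^'n"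
  assumes "\<And>i j. whomog w (r i) (A $ i $ j)"
  shows "whomog w (\<Sum>i\<in>UNIV. r i) (det A)"
  unfolding det_def
proof (rule whomog_sum)
  fix p
  have "whomog w (0 + (\<Sum>i\<in>UNIV. r i)) (const (of_int (sign p)) * (\<Prod>i\<in>UNIV. A $ i $ p i))"
    by (intro whomog_mult whomog_const whomog_prod assms) simp
  then show "whomog w (\<Sum>i\<in>UNIV. r i) (of_int (sign p) * (\<Prod>i\<in>UNIV. A $ i $ p i))"
    by (simp add: const_def)
qed

section \<open>Families with relations in the maximal ideal\<close>

interpretation pvec: module "(*s) :: 'a::comm_ring_1 \<Rightarrow> 'a^'n \<Rightarrow> 'a^'n"
  by unfold_locales (auto simp: vec_eq_iff algebra_simps)

lemma (in module) span_family:
  assumes "finite J"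
  shows "span (b ` J) = {\<Sum>j\<in>J. c j *s b j | c. True}"
proof
  show "{\<Sum>j\<in>J. c j *s b j | c. True} \<subseteq> span (b ` J)"
  proof
    fix x assume "x \<in> {\<Sum>j\<in>J. c j *s b j | c. True}"
    then obtain c where x: "x = (\<Sum>j\<in>J. c j *s b j)" by blast
    show "x \<in> span (b ` J)" unfolding x by (intro span_sum span_scale span_base imageI)
  qed
  show "span (b ` J) \<subseteq> {\<Sum>j\<in>J. c j *s b j | c. True}"
  proof
    fix x assume "x \<in> span (b ` J)"
    then show "x \<in> {\<Sum>j\<in>J. c j *s b j | c. True}"
    proof (induction rule: span_induct_alt)
      case base
      show ?case by (intro CollectI exI[of _ "\<lambda>_. 0"]) simp
    next
      case (step r x y)
      then obtain c i where c: "y = (\<Sum>j\<in>J. c j *s b j)" and i: "i \<in> J" "x = b i" by blast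
      have "r *s x + y = (\<Sum>j\<in>J. (if j = i then r *s b j else 0)) + y"
        using i assms by simp
      also have "\<dots> = (\<Sum>j\<in>J. (c j + (if j = i then r else 0)) *s b j)"
        unfolding c sum.distrib[symmetric]
        by (intro sum.cong) (auto simp: scale_left_distrib add.commute)
      finally show ?case by (intro CollectI exI[of _ "\<lambda>j. c j + (if j = i then r else 0)"]) simp
    qed
  qed
qed

lemma lookup_mult_zero: "Poly_Mapping.lookup (p * q) 0 = Poly_Mapping.lookup p 0 * Poly_Mapping.lookup q 0"
  for p q :: "'v mpoly"
proof (induction p rule: mpoly_induct)
  case (single t c)
  show ?case
  proof (cases "t = 0")
    case True
    then show ?thesis using lookup_const_mult[of c q 0] by (simp add: const_def)
  next
    case False
    have "Poly_Mapping.lookup (Poly_Mapping.single t c * q) 0 = 0"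
    proof (rule ccontr)
      assume "Poly_Mapping.lookup (Poly_Mapping.single t c * q) 0 \<noteq> 0"
      then have "0 \<in> Poly_Mapping.keys (Poly_Mapping.single t c * q)" by (simp add: in_keys_iff)
      then obtain s where "0 = t + s" using keys_mult[of "Poly_Mapping.single t c" q] by (auto split: if_splits)
      then have "Poly_Mapping.lookup t j + Poly_Mapping.lookup s j = 0" for j by (metis lookup_add lookup_zero)
      then have "t = 0" by (auto simp flip: lookup_pm_zero_iff)
      with False show False ..
    qed
    then show ?thesis using False by (simp add: lookup_single)
  qed
qed (simp add: lookup_add algebra_simps)

text \<open>Reducing modulo the maximal ideal, the residues of \<open>b\<close> are coordinate vectors, here realised as the powers of a
  variable.\<close>

lemma card_le_generators:
  fixes scl :: "('v::finite) mpoly \<Rightarrow> 'b::ab_group_add \<Rightarrow> 'b" and J :: "nat set"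
  assumes "module scl" and J: "finite J" and I: "finite I"
    and rel: "\<And>c. (\<Sum>j\<in>J. scl (c j) (b j)) = 0 \<Longrightarrow> \<forall>j\<in>J. Poly_Mapping.lookup (c j) 0 = 0"
    and h: "\<And>j. j \<in> J \<Longrightarrow> b j = (\<Sum>i\<in>I. scl (h j i) (g i))"
    and q: "\<And>i. i \<in> I \<Longrightarrow> g i = (\<Sum>j\<in>J. scl (q i j) (b j))"
  shows "card J \<le> card I"
proof -
  interpret module scl by fact
  let ?h = "\<lambda>j i. Poly_Mapping.lookup (h j i) 0" and ?q = "\<lambda>i l. Poly_Mapping.lookup (q i l) 0"
  have delta: "(if l = j then 1 else 0) = (\<Sum>i\<in>I. ?h j i * ?q i l)" if j: "j \<in> J" and l: "l \<in> J" for j l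
  proof -
    \<comment> \<open>Expressing \<open>b j\<close> through \<open>g\<close> and back gives a
      relation with these coefficients. Their constant terms vanish, so the product of the two
      matrices of constant terms is the identity.\<close>
    let ?c = "\<lambda>l. (if l = j then 1 else 0) - (\<Sum>i\<in>I. h j i * q i l)"
    have "(\<Sum>l\<in>J. scl (if l = j then 1 else 0) (b l)) = (\<Sum>l\<in>J. if l = j then b l else 0)"
      by (intro sum.cong) auto
    then have 1: "(\<Sum>l\<in>J. scl (if l = j then 1 else 0) (b l)) = b j" using j J by simp
    have "(\<Sum>l\<in>J. scl (\<Sum>i\<in>I. h j i * q i l) (b l)) = (\<Sum>l\<in>J. \<Sum>i\<in>I. scl (h j i) (scl (q i l) (b l)))"
      by (simp add: scale_sum_left)
    also have "\<dots> = (\<Sum>i\<in>I. scl (h j i) (\<Sum>l\<in>J. scl (q i l) (b l)))"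
      by (subst sum.swap) (simp add: scale_sum_right)
    also have "\<dots> = (\<Sum>i\<in>I. scl (h j i) (g i))" by (intro sum.cong) (auto simp: q)
    also have "\<dots> = b j" by (rule h[OF j, symmetric])
    finally have "(\<Sum>l\<in>J. scl (?c l) (b l)) = 0"
      using 1 by (simp add: scale_left_diff_distrib sum_subtractf)
    then have "Poly_Mapping.lookup (?c l) 0 = 0" using rel[of ?c] l by blast
    then show ?thesis by (cases "l = j") (simp_all add: lookup_minus lookup_sum lookup_mult_zero)
  qed
  \<comment> \<open>Types are nonempty, so some variable exists; its powers supply independent
    vectors indexed by naturals.\<close>
  obtain x :: 'v where True by simp
  let ?x = "\<lambda>l. Poly_Mapping.single (Poly_Mapping.single x l) (1 :: complex)"
  define w where "w i = (\<Sum>l\<in>J. const (?q i l) * ?x l)" for i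
  have "?x j \<in> cpoly.span (w ` I)" if j: "j \<in> J" for j
  proof -
    have "?x j = (\<Sum>l\<in>J. if l = j then ?x l else 0)" using j J by simp
    also have "\<dots> = (\<Sum>l\<in>J. const (if l = j then 1 else 0) * ?x l)" by (intro sum.cong) auto
    also have "\<dots> = (\<Sum>l\<in>J. const (\<Sum>i\<in>I. ?h j i * ?q i l) * ?x l)"
      by (intro sum.cong refl arg_cong2[where f = "(*)"] arg_cong[where f = const] delta j)
    also have "\<dots> = (\<Sum>l\<in>J. \<Sum>i\<in>I. const (?h j i) * (const (?q i l) * ?x l))"
      by (simp only: const_sum const_mult sum_distrib_right mult.assoc)
    also have "\<dots> = (\<Sum>i\<in>I. const (?h j i) * w i)"
      unfolding w_def sum_distrib_left by (rule sum.swap)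
    also have "\<dots> \<in> cpoly.span (w ` I)"
      by (intro cpoly.span_sum cpoly.span_scale cpoly.span_base imageI)
    finally show ?thesis .
  qed
  then have "(\<lambda>t. Poly_Mapping.single t 1) ` Poly_Mapping.single x ` J \<subseteq> cpoly.span (w ` I)" by blast
  then have "card ((\<lambda>t. Poly_Mapping.single t 1 :: 'v mpoly) ` Poly_Mapping.single x ` J) \<le> card (w ` I)"
    using cpoly.independent_span_bound[of "w ` I"] independent_monomials(1)[of "Poly_Mapping.single x ` J"] I J by blast
  also have "\<dots> \<le> card I" by (rule card_image_le[OF I])
  also have "card ((\<lambda>t. Poly_Mapping.single t 1 :: 'v mpoly) ` Poly_Mapping.single x ` J) = card (Poly_Mapping.single x ` J)"
    using independent_monomials(2) J by blast
  also have "\<dots> = card J" by (intro card_image inj_on_subset[OF inj_single]) simp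
  finally show ?thesis .
qed

section \<open>The Bourbaki map\<close>

definition grad :: "('v::finite) mpoly \<Rightarrow> 'v mvec" where
  "grad f = (\<chi> j. partial j f)"

lemma D0_iff: "a \<in> D0 f \<longleftrightarrow> (\<Sum>j\<in>UNIV. a $ j * grad f $ j) = 0"
  by (simp add: D0_def grad_def)

lemma D0_zero: "0 \<in> D0 f"
  by (simp add: D0_def)

lemma D0_add: "a \<in> D0 f \<Longrightarrow> b \<in> D0 f \<Longrightarrow> a + b \<in> D0 f"
  by (simp add: D0_def distrib_right sum.distrib)

lemma D0_scale: "a \<in> D0 f \<Longrightarrow> c *s a \<in> D0 f"
proof -
  have "(\<Sum>j\<in>UNIV. (c *s a) $ j * partial j f) = c * (\<Sum>j\<in>UNIV. a $ j * partial j f)"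
    by (simp add: sum_distrib_left mult.assoc)
  then show "a \<in> D0 f \<Longrightarrow> c *s a \<in> D0 f" by (simp add: D0_def)
qed

lemma D0_diff: "a \<in> D0 f \<Longrightarrow> b \<in> D0 f \<Longrightarrow> a - b \<in> D0 f"
  by (simp add: D0_def left_diff_distrib sum_subtractf)

lemma D0_sum: "(\<And>i. i \<in> I \<Longrightarrow> g i \<in> D0 f) \<Longrightarrow> sum g I \<in> D0 f"
  by (induction I rule: infinite_finite_induct) (auto intro: D0_add D0_zero)

locale hypersurface =
  fixes n d :: nat and f :: "('v::{finite,linorder}) mpoly" and \<rho> :: "nat \<Rightarrow> 'v mvec"
  assumes n: "2 \<le> n" and card: "CARD('v) = n + 1" and d: "0 < d"
    and hom: "homogeneous d f" and sqf: "squarefree f"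
    and \<rho>_D0: "\<And>j. j \<in> {1..n - 1} \<Longrightarrow> \<rho> j \<in> D0 f"
begin

lemma f_nonzero: "f \<noteq> 0"
  by (rule squarefree_imp_nonzero[OF sqf])

lemma bij_position: "bij_betw (position :: 'v \<Rightarrow> nat) UNIV {..n}"
proof -
  have mono: "position i < position j" if "i < j" for i j :: 'v
    unfolding position_def using that by (intro psubset_card_mono) auto
  have inj: "inj (position :: 'v \<Rightarrow> nat)"
    by (rule injI) (metis less_irrefl linorder_neqE mono)
  have "position i \<le> n" for i :: 'v
  proof -
    have "card {..<i} < CARD('v)" by (intro psubset_card_mono) auto
    then show ?thesis using card by (simp add: position_def)
  qed
  then have "range (position :: 'v \<Rightarrow> nat) \<subseteq> {..n}" by auto
  moreover have "card (range (position :: 'v \<Rightarrow> nat)) = card {..n}"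
    using card_image[OF inj] card by simp
  ultimately have "range (position :: 'v \<Rightarrow> nat) = {..n}" by (intro card_subset_eq) auto
  then show ?thesis using inj by (simp add: bij_betw_def)
qed

lemma position_le: "position (i :: 'v) \<le> n"
  using bij_position by (auto simp: bij_betw_def)

lemma sum_position: "(\<Sum>i\<in>(UNIV :: 'v set). h (position i)) = h 0 + (\<Sum>k\<in>{1..n - 1}. h k) + h n"
  for h :: "nat \<Rightarrow> 'b::comm_monoid_add"
proof -
  have "(\<Sum>i\<in>(UNIV :: 'v set). h (position i)) = (\<Sum>k\<in>{..n}. h k)"
    by (rule sum.reindex_bij_betw[OF bij_position])
  also have "{..n} = insert 0 (insert n {1..n - 1})" using n by auto
  also have "(\<Sum>k\<in>insert 0 (insert n {1..n - 1}). h k) = h 0 + (h n + (\<Sum>k\<in>{1..n - 1}. h k))"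
    using n by simp
  finally show ?thesis by (simp add: ac_simps)
qed

definition last_row :: 'v where
  "last_row = (THE i. position i = n)"

lemma position_eq_n: "position i = n \<longleftrightarrow> i = last_row"
proof -
  have "\<exists>!i :: 'v. position i = n"
    using bij_position by (metis UNIV_I atMost_iff bij_betw_def imageE inj_on_def order_refl)
  then show ?thesis unfolding last_row_def by (metis (mono_tags, lifting) theI')
qed

abbreviation M :: "'v mvec \<Rightarrow> ('v mvec, 'v) vec" where
  "M \<equiv> syzygy_matrix n \<rho>"

abbreviation v :: "'v mvec \<Rightarrow> 'v mpoly" where
  "v \<equiv> bourbaki_map n f \<rho>"

abbreviation B :: "('v mpoly) set" where
  "B \<equiv> bourbaki_ideal n f \<rho>"

lemma M_nth: "M \<sigma> $ i = (if i = last_row then \<sigma> else M 0 $ i)"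
proof -
  have "position i = n \<or> position i < n" using position_le[of i] by auto
  then show ?thesis
    using n position_eq_n[of i] by (auto simp: syzygy_matrix_def)
qed

text \<open>\<open>M 0\<close> stands for the fixed rows. In this form the determinant is visibly
  linear in the last row.\<close>

lemma M_row: "M \<sigma> = (\<chi> i. if i = last_row then \<sigma> else M 0 $ i)"
  using M_nth[of \<sigma>] by (simp add: vec_eq_iff)

lemma det_M_add: "det (M (\<sigma> + \<tau>)) = det (M \<sigma>) + det (M \<tau>)"
  unfolding M_row[of "\<sigma> + \<tau>"] M_row[of \<sigma>] M_row[of \<tau>] by (rule det_row_add)

lemma det_M_scale: "det (M (c *s \<sigma>)) = c * det (M \<sigma>)"
  unfolding M_row[of "c *s \<sigma>"] M_row[of \<sigma>] by (rule det_row_mul)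

section \<open>Divisibility of the determinant by \<open>f\<close>\<close>

lemma M_mult_grad:
  assumes "\<sigma> \<in> D0 f"
  shows "(M \<sigma> *v grad f) $ i = (if position i = 0 then of_nat d * f else 0)"
proof -
  consider "position i = 0" | "position i \<noteq> 0" "position i < n" | "position i = n" "position i \<noteq> 0"
    using position_le[of i] by linarith
  then show ?thesis
  proof cases
    case 1
    then show ?thesis using euler[OF hom] by (simp add: matrix_vector_mult_def syzygy_matrix_def grad_def)
  next
    case 2
    then have "\<rho> (position i) \<in> D0 f" using \<rho>_D0 by auto
    then show ?thesis using 2 by (simp add: matrix_vector_mult_def syzygy_matrix_def D0_iff)
  next
    case 3
    then show ?thesis using assms by (simp add: matrix_vector_mult_def syzygy_matrix_def D0_iff)
  qed
qed

text \<open>All rows but the first annihilate the gradient, and the first gives \<open>d * f\<close>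
  by Euler's formula. Cramer's rule then makes \<open>f\<close> divide the determinant times each
  partial derivative.\<close>

lemma dvd_det_M:
  assumes "\<sigma> \<in> D0 f"
  shows "f dvd det (M \<sigma>)"
proof (rule squarefree_dvd_cancel_partials[OF hom d sqf])
  fix i
  have "f dvd det (\<chi> k l. if l = i then (M \<sigma> *v grad f) $ k else M \<sigma> $ k $ l)"
    by (rule dvd_det_column[of _ _ i]) (simp add: M_mult_grad[OF assms])
  then show "f dvd det (M \<sigma>) * partial i f"
    using det_mult_vec_nth[of "M \<sigma>" "grad f" i] by (simp add: grad_def)
qed

section \<open>The quotient by \<open>f\<close> as a linear map\<close>

lemma v_unique: "det (M \<sigma>) = q * f \<Longrightarrow> v \<sigma> = q"
  unfolding bourbaki_map_def using f_nonzero by (intro the_equality) auto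

lemma det_M: "\<sigma> \<in> D0 f \<Longrightarrow> det (M \<sigma>) = v \<sigma> * f"
  using dvd_det_M v_unique by (metis dvdE mult.commute)

lemma v_add: "\<sigma> \<in> D0 f \<Longrightarrow> \<tau> \<in> D0 f \<Longrightarrow> v (\<sigma> + \<tau>) = v \<sigma> + v \<tau>"
  by (rule v_unique) (simp add: det_M_add det_M distrib_right)

lemma v_scale: "\<sigma> \<in> D0 f \<Longrightarrow> v (c *s \<sigma>) = c * v \<sigma>"
  by (rule v_unique) (simp add: det_M_scale det_M mult.assoc)

lemma v_zero: "v 0 = 0"
  using v_scale[OF D0_zero, of 0] by simp

lemma v_diff: "\<sigma> \<in> D0 f \<Longrightarrow> \<tau> \<in> D0 f \<Longrightarrow> v (\<sigma> - \<tau>) = v \<sigma> - v \<tau>"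
proof -
  assume *: "\<sigma> \<in> D0 f" "\<tau> \<in> D0 f"
  have "\<sigma> - \<tau> = \<sigma> + (-1) *s \<tau>" by (simp add: vec_eq_iff)
  then have "v (\<sigma> - \<tau>) = v \<sigma> + (-1) * v \<tau>" by (simp only: v_add[OF *(1) D0_scale[OF *(2)]] v_scale[OF *(2)])
  then show ?thesis by simp
qed

lemma v_sum: "(\<And>i. i \<in> I \<Longrightarrow> g i \<in> D0 f) \<Longrightarrow> v (sum g I) = (\<Sum>i\<in>I. v (g i))"
  by (induction I rule: infinite_finite_induct) (auto simp: v_zero v_add D0_sum)

lemma mem_B: "q \<in> B \<longleftrightarrow> (\<exists>\<sigma>\<in>D0 f. q = v \<sigma>)"
  by (auto simp: bourbaki_ideal_def)

lemma is_ideal_B: "is_ideal B"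
  unfolding is_ideal_def
proof (intro conjI ballI allI)
  show "0 \<in> B" using v_zero D0_zero by (auto simp: mem_B)
next
  fix a b assume "a \<in> B" "b \<in> B"
  then obtain \<sigma> \<tau> where "\<sigma> \<in> D0 f" "a = v \<sigma>" "\<tau> \<in> D0 f" "b = v \<tau>" by (auto simp: mem_B)
  then show "a + b \<in> B" using v_add D0_add by (metis mem_B)
next
  fix a r assume "a \<in> B"
  then obtain \<sigma> where "\<sigma> \<in> D0 f" "a = v \<sigma>" by (auto simp: mem_B)
  then show "r * a \<in> B" using v_scale D0_scale by (metis mem_B)
qed

text \<open>The trivial syzygy that expresses commutativity of \<open>partial i f\<close> and
  \<open>partial j f\<close>; it vanishes for \<open>i = j\<close>.\<close>

definition koszul :: "'v \<Rightarrow> 'v \<Rightarrow> 'v mvec" where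
  "koszul i j = (\<chi> l. (if l = j then partial i f else 0) - (if l = i then partial j f else 0))"

lemma koszul_D0: "koszul i j \<in> D0 f"
proof -
  have "(\<Sum>l\<in>UNIV. koszul i j $ l * partial l f)
      = (\<Sum>l\<in>UNIV. (if l = j then partial i f * partial l f else 0) - (if l = i then partial j f * partial l f else 0))"
    by (intro sum.cong) (auto simp: koszul_def)
  then show ?thesis by (simp add: D0_def sum_subtractf mult.commute)
qed

text \<open>Over the local ring at \<open>p\<close>, a \<open>\<sigma>\<close> with \<open>v \<sigma>\<close> of minimal order completes \<open>\<rho>\<^sub>1, \<dots>, \<rho>\<^sub>n\<^sub>-\<^sub>1\<close> to a basis, and the Koszul syzygies
  for an \<open>f\<^sub>i\<close> prime to \<open>p\<close> are combinations of this basis. Comparing determinants, that order is \<open>0\<close>.\<close>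

lemma v_not_all_dvd:
  assumes p: "prime_elem p" and nz: "\<sigma>0 \<in> D0 f" "v \<sigma>0 \<noteq> 0"
    and ker: "\<And>\<sigma>. \<sigma> \<in> D0 f \<Longrightarrow> v \<sigma> = 0 \<Longrightarrow> \<exists>a. \<sigma> = syzygy_combination n \<rho> a"
  shows "\<exists>\<sigma>\<in>D0 f. \<not> p dvd v \<sigma>"
proof (rule ccontr)
  assume "\<not> ?thesis"
  then have all: "p dvd v \<sigma>" if "\<sigma> \<in> D0 f" for \<sigma> using that by blast
  have p0: "p \<noteq> 0" and "\<not> p dvd 1" using p by (auto simp: prime_elem_def)
  then have degp: "0 < tdeg p" using unit_iff[of p] by auto
  let ?S = "\<lambda>k. \<forall>\<sigma>\<in>D0 f. p ^ k dvd v \<sigma>"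
  \<comment> \<open>The degree of the nonzero \<open>v \<sigma>0\<close> bounds the powers of
    \<open>p\<close> dividing it, so a largest power dividing all values of \<open>v\<close>
    exists.\<close>
  have "\<exists>k. \<not> ?S (Suc k)"
  proof (rule ccontr)
    assume "\<not> (\<exists>k. \<not> ?S (Suc k))"
    then have *: "p ^ Suc (tdeg (v \<sigma>0)) dvd v \<sigma>0" using nz(1) by blast
    have "k \<le> tdeg (p ^ k)" for k
    proof (induction k)
      case (Suc k)
      have "tdeg (p ^ Suc k) = tdeg p + tdeg (p ^ k)" using p0 by (simp add: wdeg_mult)
      then show ?case using Suc degp by simp
    qed simp
    then have "Suc (tdeg (v \<sigma>0)) \<le> tdeg (v \<sigma>0)"
      using dvd_imp_wdeg_le[OF * nz(2), of unit_wt] le_trans by blast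
    then show False by simp
  qed
  define k where "k = (LEAST k. \<not> ?S (Suc k))"
  have k1: "\<not> ?S (Suc k)" unfolding k_def by (rule LeastI_ex) fact
  have k0: "?S k"
  proof (cases k)
    case (Suc k')
    then show ?thesis using not_less_Least[of k' "\<lambda>k. \<not> ?S (Suc k)"] unfolding k_def[symmetric] by simp
  qed simp
  have "k \<noteq> 0" using k1 all by (intro notI) simp
  obtain \<sigma> where \<sigma>: "\<sigma> \<in> D0 f" "\<not> p ^ Suc k dvd v \<sigma>" using k1 by blast
  obtain g where g: "v \<sigma> = p ^ k * g" using k0 \<sigma>(1) by (meson dvdE)
  have pg: "\<not> p dvd g"
  proof
    assume "p dvd g"
    then have "p ^ k * p dvd p ^ k * g" by (rule mult_dvd_mono[OF dvd_refl])
    then show False using \<sigma>(2) g by (simp add: mult.commute)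
  qed
  obtain i where i: "\<not> p dvd partial i f" using squarefree_partial_not_dvd[OF p hom d sqf] by blast
  let ?fi = "partial i f"
  have "\<exists>w. v (koszul i j) = p ^ k * w" for j using k0 koszul_D0 by (meson dvdE)
  then obtain w where w: "v (koszul i j) = p ^ k * w j" for j by metis
  \<comment> \<open>Both terms have the value \<open>p^k * g * w j\<close> under \<open>v\<close>.
    Multiplying by \<open>g\<close>, which is prime to \<open>p\<close>, replaces a division in the
    local ring.\<close>
  have "\<exists>a. g *s koszul i j - w j *s \<sigma> = syzygy_combination n \<rho> a" for j
    by (intro ker) (simp_all add: D0_diff D0_scale koszul_D0 \<sigma>(1) v_diff v_scale w g)
  then obtain a where a: "g *s koszul i j - w j *s \<sigma> = syzygy_combination n \<rho> (a j)" for j by metis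
  \<comment> \<open>Coefficients expressing the rows of \<open>L\<close> through those of
    \<open>M \<sigma>\<close>: row \<open>i\<close> of \<open>L\<close> is the row of variables, and
    row \<open>j\<close> is \<open>g *s koszul i j\<close>.\<close>
  define A :: "('v mvec, 'v) vec" where
    "A = (\<chi> j r. if j = i then (if position r = 0 then 1 else 0)
      else if position r = 0 then 0 else if position r < n then a j (position r) else w j)"
  define L where "L = A ** M \<sigma>"
  have L_row: "L $ j $ l = (if j = i then var l else g * koszul i j $ l)" for j l
  proof -
    define h where "h k = (if j = i then (if k = 0 then 1 else 0) else if k = 0 then 0 else if k < n then a j k else w j)
        * (if k = 0 then var l else if k < n then \<rho> k $ l else \<sigma> $ l)" for k
    have "A $ j $ r * M \<sigma> $ r $ l = h (position r)" for r
      by (simp add: h_def A_def syzygy_matrix_def)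
    then have "L $ j $ l = (\<Sum>r\<in>(UNIV :: 'v set). h (position r))"
      by (simp add: L_def matrix_matrix_mult_def)
    also have "\<dots> = h 0 + (\<Sum>k\<in>{1..n - 1}. h k) + h n" by (rule sum_position)
    also have "\<dots> = (if j = i then var l else g * koszul i j $ l)"
    proof (cases "j = i")
      case True
      then show ?thesis using n by (simp add: h_def)
    next
      case False
      have "(\<Sum>k\<in>{1..n - 1}. h k) = syzygy_combination n \<rho> (a j) $ l"
        unfolding syzygy_combination_def sum_component using n False
        by (intro sum.cong) (auto simp: h_def)
      also have "\<dots> = g * koszul i j $ l - w j * \<sigma> $ l" using a[of j] by (metis vector_minus_component vector_smult_component)
      finally show ?thesis using n False by (simp add: h_def)
    qed
    finally show ?thesis .
  qed
  have Lgrad: "(L *v grad f) $ j = (if j = i then of_nat d * f else 0)" for j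
  proof (cases "j = i")
    case True
    then show ?thesis using euler[OF hom] by (simp add: matrix_vector_mult_def L_row grad_def)
  next
    case False
    have "(L *v grad f) $ j = g * (\<Sum>l\<in>UNIV. koszul i j $ l * grad f $ l)"
      using False by (simp add: matrix_vector_mult_def L_row sum_distrib_left mult.assoc)
    then show ?thesis using koszul_D0[of i j] False by (simp add: D0_iff)
  qed
  define u :: "'v mvec" where "u = (\<chi> l. if l = i then of_nat d * f else var l)"
  \<comment> \<open>Cramer's rule for the gradient in column \<open>i\<close> leaves a matrix that
    is diagonal outside row \<open>i\<close>, so its determinant is explicit.\<close>
  have "(\<chi> j l. if l = i then (L *v grad f) $ j else L $ j $ l)
      = (\<chi> j l. if j = i then u $ l else if j = l then g * ?fi else 0)"
    unfolding vec_eq_iff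
    by (auto simp: Lgrad L_row u_def koszul_def)
  then have "det L * grad f $ i = det (\<chi> j l. if j = i then u $ l else if j = l then g * ?fi else 0)"
    using det_mult_vec_nth[of L "grad f" i] by simp
  also have "\<dots> = of_nat d * f * (g * ?fi) ^ n"
    by (subst det_replace_row) (simp add: u_def card)
  finally have "det L * ?fi = of_nat d * f * (g * ?fi) ^ n" by (simp add: grad_def)
  moreover have "det L = det A * (p ^ k * g * f)"
    unfolding L_def by (simp add: det_mul det_M[OF \<sigma>(1)] g)
  ultimately have "f * (p ^ k * (det A * g * ?fi)) = f * (of_nat d * (g * ?fi) ^ n)" by (simp add: ac_simps)
  then have "p ^ k * (det A * g * ?fi) = of_nat d * (g * ?fi) ^ n" using f_nonzero by simp
  \<comment> \<open>For \<open>k \<noteq> 0\<close> the left side is divisible by \<open>p\<close>,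
    while the right side is a unit times a power of \<open>g * ?fi\<close>, which is prime to
    \<open>p\<close>.\<close>
  moreover have "p dvd p ^ k * (det A * g * ?fi)" using \<open>k \<noteq> 0\<close> by (simp add: dvd_power)
  ultimately have "p dvd of_nat d * (g * ?fi) ^ n" by simp
  moreover have "of_nat d * (g * ?fi) ^ n dvd (g * ?fi) ^ n"
    using d by (intro unit_mult_dvd of_nat_dvd_one) simp
  ultimately have "p dvd g * ?fi" using p prime_elem_dvd_power dvd_trans by blast
  then show False using p i pg by (simp add: prime_elem_dvd_mult_iff)
qed

end

section \<open>Minimal generators\<close>

text \<open>In the part of the relation of degree \<open>e j\<close>, the coefficient of
  \<open>\<rho> j\<close> is the constant term of \<open>c j\<close>. If it were nonzero,
  \<open>\<rho> j\<close> would be a combination of the other generators.\<close>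

lemma minimal_generators_relation:
  fixes \<rho> :: "nat \<Rightarrow> ('v::{finite,linorder}) mvec"
  assumes gens: "minimal_generators f m \<rho> e" and rel: "(\<Sum>j\<in>{1..m}. c j *s \<rho> j) = 0"
  shows "\<forall>j\<in>{1..m}. Poly_Mapping.lookup (c j) 0 = 0"
proof (rule ballI, rule ccontr)
  fix j assume j: "j \<in> {1..m}" and nz: "Poly_Mapping.lookup (c j) 0 \<noteq> 0"
  define r where "r = Poly_Mapping.lookup (c j) 0"
  define b where "b i = (if e i \<le> e j then wpart unit_wt (e j - e i) (c i) else 0)" for i
  have hom: "whomog unit_wt (e i) (\<rho> i $ k)" if "i \<in> {1..m}" for i k
    using gens that by (auto simp: minimal_generators_def homogeneous_vec_def homogeneous_iff_whomog)
  have "(\<Sum>i\<in>{1..m}. b i *s \<rho> i) = 0"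
    unfolding vec_eq_iff
  proof
    fix k
    have "0 = wpart unit_wt (e j) ((\<Sum>i\<in>{1..m}. c i *s \<rho> i) $ k)" using rel by simp
    also have "\<dots> = (\<Sum>i\<in>{1..m}. wpart unit_wt (e j) (\<rho> i $ k * c i))"
      by (simp add: wpart_sum mult.commute)
    also have "\<dots> = (\<Sum>i\<in>{1..m}. b i * \<rho> i $ k)"
    proof (rule sum.cong)
      fix i assume "i \<in> {1..m}"
      from wpart_whomog_mult[OF hom[OF this], of "e j" k "c i"]
      show "wpart unit_wt (e j) (\<rho> i $ k * c i) = b i * \<rho> i $ k" by (auto simp: b_def)
    qed simp
    finally show "(\<Sum>i\<in>{1..m}. b i *s \<rho> i) $ k = 0 $ k" by simp
  qed
  moreover have "b j = const r"
    unfolding b_def r_def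
    by (rule poly_mapping_eqI) (auto simp: lookup_wpart const_def lookup_single when_def wt_unit_zero_iff)
  ultimately have 1: "const r *s \<rho> j + (\<Sum>i\<in>{1..m} - {j}. b i *s \<rho> i) = 0"
    using j by (simp add: sum.remove)
  have "const (1 / r) *s (const r *s \<rho> j + (\<Sum>i\<in>{1..m} - {j}. b i *s \<rho> i)) = 0"
    unfolding 1 by simp
  moreover have "const (1 / r) * const r = (1 :: 'v mpoly)" using nz by (simp add: r_def flip: const_mult)
  ultimately have "\<rho> j + const (1 / r) *s (\<Sum>i\<in>{1..m} - {j}. b i *s \<rho> i) = 0"
    by (simp only: pvec.scale_right_distrib pvec.scale_scale pvec.scale_one)
  then have "\<rho> j = - (const (1 / r) *s (\<Sum>i\<in>{1..m} - {j}. b i *s \<rho> i))"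
    by (simp add: eq_neg_iff_add_eq_0)
  also have "\<dots> \<in> pvec.span (\<rho> ` ({1..m} - {j}))"
    by (intro pvec.span_neg pvec.span_scale pvec.span_sum pvec.span_base imageI)
  finally have "\<rho> j \<in> pvec.span (\<rho> ` ({1..m} - {j}))" .
  then have "insert (\<rho> j) (\<rho> ` ({1..m} - {j})) \<subseteq> pvec.span (\<rho> ` ({1..m} - {j}))"
    using pvec.span_superset[of "\<rho> ` ({1..m} - {j})"] by (rule insert_subsetI)
  then have "pvec.span (insert (\<rho> j) (\<rho> ` ({1..m} - {j}))) = pvec.span (\<rho> ` ({1..m} - {j}))"
    by (intro antisym pvec.span_minimal pvec.subspace_span pvec.span_mono) auto
  moreover have "insert (\<rho> j) (\<rho> ` ({1..m} - {j})) = \<rho> ` {1..m}" using j by blast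
  ultimately show False using gens j by (auto simp: minimal_generators_def)
qed

lemma minimal_generators_span:
  assumes "minimal_generators f m \<rho> e"
  shows "D0 f = {\<Sum>j\<in>{1..m}. c j *s \<rho> j | c. True}"
  using assms pvec.span_family[of "{1..m}" \<rho>] by (auto simp: minimal_generators_def)

text \<open>By symmetry the number \<open>m\<close> depends on \<open>f\<close> alone, so
  \<open>syzygy_hypersurface\<close> determines it.\<close>

lemma minimal_generators_card_le:
  fixes f :: "('v::{finite,linorder}) mpoly"
  assumes "minimal_generators f m \<rho> e" "minimal_generators f m' \<rho>' e'"
  shows "m \<le> m'"
proof -
  have "\<forall>j\<in>{1..m}. \<exists>c. \<rho> j = (\<Sum>i\<in>{1..m'}. c i *s \<rho>' i)"
    using assms(1) minimal_generators_span[OF assms(2)] by (auto simp: minimal_generators_def)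
  from bchoice[OF this] obtain h where h: "\<forall>j\<in>{1..m}. \<rho> j = (\<Sum>i\<in>{1..m'}. h j i *s \<rho>' i)" by (rule exE)
  have "\<forall>i\<in>{1..m'}. \<exists>c. \<rho>' i = (\<Sum>j\<in>{1..m}. c j *s \<rho> j)"
    using assms(2) minimal_generators_span[OF assms(1)] by (auto simp: minimal_generators_def)
  from bchoice[OF this] obtain q where q: "\<forall>i\<in>{1..m'}. \<rho>' i = (\<Sum>j\<in>{1..m}. q i j *s \<rho> j)" by (rule exE)
  have "card {1..m} \<le> card {1..m'}"
    by (rule card_le_generators[where b = \<rho> and g = \<rho>' and h = h and q = q, OF pvec.module_axioms _ _
          minimal_generators_relation[OF assms(1)] h[rule_format] q[rule_format]]) simp_all
  then show ?thesis by simp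
qed

lemma minimal_generators_syzygy_hypersurface:
  fixes f :: "('v::{finite,linorder}) mpoly"
  assumes "minimal_generators f m \<rho> e"
  shows "syzygy_hypersurface k f \<longleftrightarrow> k = m"
  using assms minimal_generators_card_le unfolding syzygy_hypersurface_def by (metis le_antisym)

section \<open>Saturation\<close>

lemma var_mult_keys: "t \<in> Poly_Mapping.keys s \<Longrightarrow> Poly_Mapping.single y 1 + t \<in> Poly_Mapping.keys (var y * s)"
  by (simp add: var_def keys_monom_mult)

lemma var_dvd_iff:
  fixes p :: "('v::finite) mpoly"
  shows "var x dvd p \<longleftrightarrow> (\<forall>t\<in>Poly_Mapping.keys p. Poly_Mapping.lookup t x \<noteq> 0)"
  using var_dvd_keys[of x p] var_power_dvd[of p 1 x] by (auto simp: Suc_le_eq)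

lemma var_dvd_var_mult:
  fixes s :: "('v::finite) mpoly"
  assumes "x \<noteq> y" "var x dvd var y * s"
  shows "var x dvd s"
  unfolding var_dvd_iff
proof
  fix t assume "t \<in> Poly_Mapping.keys s"
  then have "Poly_Mapping.lookup (Poly_Mapping.single y 1 + t) x \<noteq> 0"
    using assms(2)[unfolded var_dvd_iff] var_mult_keys[of t s y] by blast
  then show "Poly_Mapping.lookup t x \<noteq> 0" using assms(1) by (simp add: lookup_add lookup_single_not_eq)
qed

text \<open>\<open>z\<close> is regular modulo \<open>(x, y)\<close>. In the part of
  \<open>a\<close> free of \<open>x\<close>, every monomial times \<open>z\<close> must come from
  \<open>var y * b\<close>, so \<open>y\<close> occurs in it; the rest of \<open>a\<close> is
  divisible by \<open>x\<close>.\<close>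

lemma var_mult_mem_two_vars:
  fixes a :: "('v::finite) mpoly"
  assumes "z \<noteq> x" "z \<noteq> y" "var z * a = var y * b - var x * c"
  shows "\<exists>q p. a = var x * q - var y * p"
proof -
  let ?a2 = "wpart (var_wt x) 0 a"
  have "var x dvd a - ?a2"
    unfolding var_dvd_iff by (auto simp: in_keys_iff lookup_minus lookup_wpart wt_var split: if_splits)
  moreover have "var y dvd ?a2"
    unfolding var_dvd_iff
  proof
    fix t assume t: "t \<in> Poly_Mapping.keys ?a2"
    then have a: "t \<in> Poly_Mapping.keys a" "Poly_Mapping.lookup t x = 0" by (auto simp: keys_wpart wt_var)
    let ?t = "Poly_Mapping.single z 1 + t"
    have tx: "Poly_Mapping.lookup ?t x = 0" using a(2) assms(1) by (simp add: lookup_add lookup_single_not_eq)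
    have "?t \<in> Poly_Mapping.keys (var y * b - var x * c)" using var_mult_keys[OF a(1), of z] assms(3) by simp
    then have "?t \<in> Poly_Mapping.keys (var y * b) \<or> ?t \<in> Poly_Mapping.keys (var x * c)"
      using keys_diff[of "var y * b" "var x * c"] by blast
    moreover have "?t \<notin> Poly_Mapping.keys (var x * c)" using tx var_dvd_keys[of x "var x * c" ?t] by auto
    ultimately have "Poly_Mapping.lookup ?t y \<noteq> 0" using var_dvd_keys[of y "var y * b" ?t] by auto
    then show "Poly_Mapping.lookup t y \<noteq> 0" using assms(2) by (simp add: lookup_add lookup_single_not_eq)
  qed
  ultimately obtain q p where "a - ?a2 = var x * q" "?a2 = var y * p" by (elim dvdE)
  then have "a = var x * q - var y * (- p)" by (simp add: algebra_simps)
  then show ?thesis by blast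
qed

text \<open>By induction on the power of the irrelevant ideal, it suffices to pass from all products
  with single variables to the element itself.\<close>

lemma saturatedI:
  fixes I :: "(('v::finite) mpoly) set"
  assumes I: "is_ideal I" and step: "\<And>g. (\<And>x. var x * g \<in> I) \<Longrightarrow> g \<in> I"
  shows "saturated I"
proof -
  have "g \<in> I" if "\<forall>h\<in>irrelevant_power k. h * g \<in> I" for k g
    using that
  proof (induction k arbitrary: g)
    case 0
    then show ?case by (auto dest: spec[of _ 1])
  next
    case (Suc k)
    have "h * g \<in> I" if h: "h \<in> irrelevant_power k" for h
    proof (rule step)
      fix x :: 'v
      have "var x \<in> (irrelevant_ideal :: ('v mpoly) set)"
        unfolding irrelevant_ideal_def genideal_def by blast
      then have "var x * h \<in> irrelevant_power (Suc k)"
        using ideal_prod.prod[of "var x" irrelevant_ideal h "irrelevant_power k" poly_ring] h by simp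
      then have "var x * h * g \<in> I" using Suc.prems by blast
      then show "var x * (h * g) \<in> I" by (simp add: mult.assoc)
    qed
    then show ?case using Suc.IH by blast
  qed
  moreover have "g \<in> saturation I" if "g \<in> I" for g
    unfolding saturation_def using that is_ideal_mult[OF I] by blast
  ultimately show ?thesis unfolding saturated_def saturation_def by blast
qed

section \<open>Primes over an ideal\<close>

text \<open>Split prime factors off \<open>g\<close>: either the factor or the cofactor, which has
  smaller degree, lies in \<open>Q\<close>.\<close>

lemma is_prime_contains_prime_elem:
  fixes Q :: "(('v::{finite,linorder}) mpoly) set"
  assumes "is_prime Q" "g \<in> Q" "g \<noteq> 0"
  shows "\<exists>p\<in>Q. prime_elem p"
  using assms(2,3)
proof (induction "tdeg g" arbitrary: g rule: less_induct)
  case less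
  have "\<not> g dvd 1"
    using is_primeD(2)[OF assms(1)] is_ideal_mult_right[OF is_primeD(1)[OF assms(1)] less.prems(1)] by (metis dvdE)
  then obtain p where p: "prime_elem p" "p dvd g" using prime_dvd_exists less.prems(2) by blast
  then obtain h where h: "g = p * h" by (elim dvdE)
  then consider "p \<in> Q" | "h \<in> Q" using is_primeD(3)[OF assms(1)] less.prems(1) by blast
  then show ?case
  proof cases
    case 2
    have "p \<noteq> 0" "h \<noteq> 0" using h less.prems(2) by auto
    moreover have "\<not> p dvd 1" using p(1) by (simp add: prime_elem_def)
    ultimately have "tdeg h < tdeg g" using unit_iff[of p] unfolding h by (simp add: wdeg_mult)
    then show ?thesis using less.hyps 2 \<open>h \<noteq> 0\<close> by blast
  qed (use p in blast)
qed

lemma prime_quot_vimage: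
  fixes I :: "('v mpoly) set"
  assumes I: "is_ideal I" and P: "primeideal P (poly_ring Quot I)"
  shows "is_prime {r. I +>\<^bsub>poly_ring\<^esub> r \<in> P}" "I \<subseteq> {r. I +>\<^bsub>poly_ring\<^esub> r \<in> P}"
proof -
  let ?h = "\<lambda>r. I +>\<^bsub>poly_ring\<^esub> r"
  have I': "ideal I (poly_ring :: ('v mpoly) ring)" using I by (simp add: ideal_poly_ring)
  interpret I: ideal I "poly_ring :: ('v mpoly) ring" by (rule I')
  interpret P: primeideal P "poly_ring Quot I" by (rule P)
  interpret h: ring_hom_ring "poly_ring :: ('v mpoly) ring" "poly_ring Quot I" ?h by (rule I.rcos_ring_hom_ring)
  have "ideal {r \<in> carrier poly_ring. ?h r \<in> P} (poly_ring :: ('v mpoly) ring)"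
    by (rule h.ideal_vimage) (rule P.is_ideal)
  then have id: "is_ideal {r. ?h r \<in> P}" by (simp add: ideal_poly_ring)
  show "is_prime {r. ?h r \<in> P}"
    unfolding is_prime_def
  proof (intro conjI allI impI id)
    show "1 \<notin> {r. ?h r \<in> P}"
    proof
      assume "1 \<in> {r. ?h r \<in> P}"
      then have "\<one>\<^bsub>poly_ring Quot I\<^esub> \<in> P" using h.hom_one by simp
      then show False using P.one_imp_carrier P.I_notcarr by simp
    qed
  next
    fix a b assume "a * b \<in> {r. ?h r \<in> P}"
    then have "?h a \<otimes>\<^bsub>poly_ring Quot I\<^esub> ?h b \<in> P" using h.hom_mult[of a b] by simp
    then show "a \<in> {r. ?h r \<in> P} \<or> b \<in> {r. ?h r \<in> P}"
      using P.I_prime[of "?h a" "?h b"] h.hom_closed by auto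
  qed
  show "I \<subseteq> {r. ?h r \<in> P}"
  proof
    fix r assume "r \<in> I"
    then have "?h r = I" by (rule I.a_rcos_const)
    moreover have "I = \<zero>\<^bsub>poly_ring Quot I\<^esub>" by (simp add: FactRing_def)
    ultimately show "r \<in> {r. ?h r \<in> P}" using additive_subgroup.zero_closed[OF P.is_additive_subgroup] by simp
  qed
qed

text \<open>Strict inclusions survive pulling back because every element of the quotient is a
  coset.\<close>

lemma prime_chain_quot:
  fixes I :: "('v mpoly) set"
  assumes I: "is_ideal I" and P: "prime_chain (poly_ring Quot I) P k"
  shows "\<exists>P'. chain P' k \<and> I \<subseteq> P' 0"
proof (intro exI conjI)
  let ?P = "\<lambda>i. {r. I +>\<^bsub>poly_ring\<^esub> r \<in> P i}"
  have pr: "primeideal (P i) (poly_ring Quot I)" if "i \<le> k" for i using P that by (simp add: prime_chain_def)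
  have "?P i \<subset> ?P (Suc i)" if "i < k" for i
  proof -
    have sub: "P i \<subset> P (Suc i)" using P that by (simp add: prime_chain_def)
    then obtain c where c: "c \<in> P (Suc i)" "c \<notin> P i" by blast
    have "ideal (P (Suc i)) (poly_ring Quot I)" using pr[of "Suc i"] that by (simp add: primeideal_def)
    then have "c \<in> carrier (poly_ring Quot I)" using c(1) by (rule ideal.Icarr)
    then obtain r where "c = I +>\<^bsub>poly_ring\<^esub> r" by (auto simp: FactRing_def A_RCOSETS_defs a_r_coset_def)
    then show ?thesis using sub c by blast
  qed
  then show "chain ?P k" using prime_quot_vimage(1)[OF I pr] by (simp add: chain_def)
  show "I \<subseteq> ?P 0" using prime_quot_vimage(2)[OF I pr[of 0]] by simp
qed

text \<open>\<open>Q\<close> contains a prime element \<open>p\<close>, and the principal ideal of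
  \<open>p\<close> differs from \<open>Q\<close> because it does not contain
  \<open>I\<close>.\<close>

lemma height_ge_2:
  fixes I :: "(('v::{finite,linorder}) mpoly) set"
  assumes nz: "g \<in> I" "g \<noteq> 0" and np: "\<And>p. prime_elem p \<Longrightarrow> \<not> I \<subseteq> {q. p dvd q}"
    and Q: "is_prime Q" "I \<subseteq> Q"
  shows "\<exists>p. prime_elem p \<and> {0} \<subset> {q. p dvd q} \<and> {q. p dvd q} \<subset> Q"
proof -
  obtain p where p: "p \<in> Q" "prime_elem p" using is_prime_contains_prime_elem[OF Q(1)] nz Q(2) by blast
  have "p \<noteq> 0" using p(2) by (auto simp: prime_elem_def)
  moreover have "p \<in> {q. p dvd q}" by simp
  ultimately have "{0} \<noteq> {q. p dvd q}" by blast
  then have "{0} \<subset> {q. p dvd q}" by (intro psubsetI) simp_all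
  moreover have "{q. p dvd q} \<subseteq> Q"
  proof
    fix q assume "q \<in> {q. p dvd q}"
    then obtain r where q: "q = p * r" unfolding mem_Collect_eq by (elim dvdE)
    show "q \<in> Q" unfolding q by (rule is_ideal_mult_right[OF is_primeD(1)[OF Q(1)] p(1)])
  qed
  moreover have "{q. p dvd q} \<noteq> Q" using np[OF p(2)] Q(2) by auto
  ultimately show ?thesis using p(2) by blast
qed

text \<open>A chain of primes over \<open>I\<close> can be prolonged below by \<open>{0}\<close> and
  a principal prime, which costs two of the available dimensions.\<close>

lemma krull_dim_quot_le:
  fixes I :: "(('v::{finite,linorder}) mpoly) set"
  assumes I: "is_ideal I" and nz: "g \<in> I" "g \<noteq> 0" and np: "\<And>p. prime_elem p \<Longrightarrow> \<not> I \<subseteq> {q. p dvd q}"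
  shows "krull_dim (poly_ring Quot I) \<le> ereal (real (CARD('v) - 2))"
  unfolding krull_dim_def
proof (rule SUP_least)
  \<comment> \<open>For the unit ideal there is no such \<open>k\<close>, and the supremum is
    -\<infinity>.\<close>
  fix k assume "k \<in> {k. \<exists>P. prime_chain (poly_ring Quot I) P k}"
  then obtain P where P: "chain P k" "I \<subseteq> P 0" using prime_chain_quot[OF I] by blast
  have P0: "is_prime (P 0)" using P(1) by (simp add: chain_def)
  obtain p where p: "prime_elem p" "{0} \<subset> {q. p dvd q}" "{q. p dvd q} \<subset> P 0"
    using height_ge_2[OF nz np P0 P(2)] by blast
  define P' where "P' i = (if i = 0 then {0} else if i = 1 then {q. p dvd q} else P (i - 2))" for i
  have "chain P' (k + 2)"
    unfolding chain_def
  proof (intro conjI allI impI)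
    fix i assume "i \<le> k + 2"
    then show "is_prime (P' i)"
      using P(1) is_prime_zero is_prime_principal[OF p(1)] by (auto simp: P'_def chain_def)
  next
    fix i assume i: "i < k + 2"
    consider "i = 0" | "i = 1" | "2 \<le> i" by linarith
    then show "P' i \<subset> P' (Suc i)"
    proof cases
      case 3
      then have "Suc i - 2 = Suc (i - 2)" "i - 2 < k" using i by auto
      then show ?thesis using P(1) 3 by (auto simp: P'_def chain_def)
    qed (use p in \<open>auto simp: P'_def\<close>)
  qed
  moreover have "alg_indep_mod (P' (k + 2)) []"
    using P(1) by (intro alg_indep_mod_Nil) (auto simp: P'_def chain_def is_prime_def)
  ultimately have "k + 2 + length ([] :: 'v mpoly list) \<le> CARD('v)" by (rule chain_length_le)
  then show "ereal (real k) \<le> ereal (real (CARD('v) - 2))" by simp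
qed

lemma codim_ge_2:
  fixes I :: "(('v::{finite,linorder}) mpoly) set"
  assumes nz: "g \<in> I" "g \<noteq> 0" and np: "\<And>p. prime_elem p \<Longrightarrow> \<not> I \<subseteq> {q. p dvd q}"
  shows "enat 2 \<le> codim poly_ring I"
  unfolding codim_def
proof (rule INF_greatest)
  fix Q assume "Q \<in> {Q. primeideal Q poly_ring \<and> I \<subseteq> Q}"
  then have Q: "is_prime Q" "I \<subseteq> Q" by (auto simp: primeideal_poly_ring)
  obtain p where p: "prime_elem p" "{0} \<subset> {q. p dvd q}" "{q. p dvd q} \<subset> Q"
    using height_ge_2[OF nz np Q] by blast
  define P where "P i = (if i = 0 then {0} else if i = 1 then {q. p dvd q} else Q)" for i :: nat
  have "chain P 2"
    unfolding chain_def
  proof (intro conjI allI impI)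
    fix i :: nat assume "i \<le> 2"
    show "is_prime (P i)" using Q(1) is_prime_zero is_prime_principal[OF p(1)] by (auto simp: P_def)
  next
    fix i :: nat assume "i < 2"
    then have "i = 0 \<or> i = 1" by auto
    then show "P i \<subset> P (Suc i)" using p(2,3) unfolding P_def by auto
  qed
  moreover have "P 2 = Q" by (simp add: P_def)
  ultimately have "2 \<in> {k. \<exists>P. prime_chain poly_ring P k \<and> P k = Q}" by (auto simp: prime_chain_poly_ring)
  then show "enat 2 \<le> height poly_ring Q" unfolding height_def by (rule SUP_upper)
qed

lemma codim_two_forms_le_2:
  fixes b1 b2 :: "('v::{finite,linorder}) mpoly"
  assumes "3 \<le> CARD('v)" "whomog unit_wt e1 b1" "whomog unit_wt e2 b2" "0 < e1" "0 < e2"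
  shows "codim poly_ring (genideal poly_ring {b1, b2}) \<le> enat 2"
proof -
  obtain Q where Q: "is_prime Q" "b1 \<in> Q" "b2 \<in> Q" and ht: "\<And>P k. chain P k \<Longrightarrow> P k = Q \<Longrightarrow> k \<le> 2"
    using prime_over_two_forms[OF assms] by blast
  have "genideal poly_ring {b1, b2} \<subseteq> Q"
    unfolding genideal_def using Q is_primeD(1)[OF Q(1)] by (auto simp: ideal_poly_ring)
  then have "codim poly_ring (genideal poly_ring {b1, b2}) \<le> height poly_ring Q"
    unfolding codim_def using Q(1) by (intro INF_lower) (simp add: primeideal_poly_ring)
  also have "\<dots> \<le> enat 2"
    unfolding height_def by (rule SUP_least) (auto simp: prime_chain_poly_ring dest: ht)
  finally show ?thesis .
qed

section \<open>Tame hypersurfaces\<close>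

locale tame_hypersurface = hypersurface n d f \<rho>
  for n d :: nat and f :: "('v::{finite,linorder}) mpoly" and \<rho> :: "nat \<Rightarrow> 'v mvec" +
  fixes m :: nat and e :: "nat \<Rightarrow> nat"
  assumes m: "n \<le> m" and gens: "minimal_generators f m \<rho> e" and tame: "tame n f \<rho>"
begin

lemma \<rho>_mem: "j \<in> {1..m} \<Longrightarrow> \<rho> j \<in> D0 f"
  using gens by (simp add: minimal_generators_def)

lemma image_combination: "syzygy_combination n \<rho> ` ({1..n - 1} \<rightarrow>\<^sub>E UNIV) = {\<sigma>\<in>D0 f. v \<sigma> = 0}"
  using tame by (simp add: tame_def short_exact_def)

lemma ker_v: "\<sigma> \<in> D0 f \<Longrightarrow> v \<sigma> = 0 \<Longrightarrow> \<exists>a. \<sigma> = syzygy_combination n \<rho> a"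
  using image_combination by blast

text \<open>Tameness speaks of extensional families; restricting \<open>a\<close> to the index set
  leaves the sum unchanged.\<close>

lemma v_combination: "syzygy_combination n \<rho> a \<in> D0 f" "v (syzygy_combination n \<rho> a) = 0"
proof -
  have "syzygy_combination n \<rho> a = syzygy_combination n \<rho> (restrict a {1..n - 1})"
    unfolding syzygy_combination_def by (intro sum.cong) auto
  moreover have "syzygy_combination n \<rho> (restrict a {1..n - 1}) \<in> {\<sigma>\<in>D0 f. v \<sigma> = 0}"
    unfolding image_combination[symmetric] by (intro imageI) auto
  ultimately have "syzygy_combination n \<rho> a \<in> {\<sigma>\<in>D0 f. v \<sigma> = 0}" by (simp only:)
  then show "syzygy_combination n \<rho> a \<in> D0 f" "v (syzygy_combination n \<rho> a) = 0" by auto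
qed

lemma combination_inj:
  assumes "syzygy_combination n \<rho> a = 0" "k \<in> {1..n - 1}"
  shows "a k = 0"
proof -
  let ?a = "restrict a {1..n - 1}" and ?z = "restrict (\<lambda>_. 0) {1..n - 1}"
  have "syzygy_combination n \<rho> ?a = syzygy_combination n \<rho> a"
    unfolding syzygy_combination_def by (intro sum.cong) auto
  moreover have "syzygy_combination n \<rho> ?z = 0"
    unfolding syzygy_combination_def by (intro sum.neutral) auto
  moreover have "inj_on (syzygy_combination n \<rho>) ({1..n - 1} \<rightarrow>\<^sub>E UNIV)"
    using tame by (simp add: tame_def short_exact_def)
  ultimately have "?a = ?z" using assms(1) by (auto dest!: inj_onD[where x = ?a and y = ?z])
  then have "?a k = ?z k" by (rule fun_cong)
  then show ?thesis using assms(2) by simp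
qed

lemma v_\<rho>: "j \<in> {1..n - 1} \<Longrightarrow> v (\<rho> j) = 0"
proof -
  assume j: "j \<in> {1..n - 1}"
  have "syzygy_combination n \<rho> (\<lambda>i. if i = j then 1 else 0) = (\<Sum>i\<in>{1..n - 1}. if i = j then \<rho> i else 0)"
    unfolding syzygy_combination_def by (intro sum.cong) auto
  also have "\<dots> = \<rho> j" using j by simp
  finally show "v (\<rho> j) = 0" using v_combination(2) by metis
qed

lemma v_linear_combination:
  assumes "\<And>j. j \<in> J \<Longrightarrow> \<rho> j \<in> D0 f"
  shows "v (\<Sum>j\<in>J. c j *s \<rho> j) = (\<Sum>j\<in>J. c j * v (\<rho> j))"
proof -
  have "v (\<Sum>j\<in>J. c j *s \<rho> j) = (\<Sum>j\<in>J. v (c j *s \<rho> j))" by (intro v_sum D0_scale assms)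
  also have "\<dots> = (\<Sum>j\<in>J. c j * v (\<rho> j))" by (intro sum.cong refl v_scale assms)
  finally show ?thesis .
qed

section \<open>Generators of the Bourbaki ideal\<close>

lemma B_eq: "B = {\<Sum>j\<in>{n..m}. c j * v (\<rho> j) | c. True}"
proof -
  have split: "v (\<Sum>j\<in>{1..m}. c j *s \<rho> j) = (\<Sum>j\<in>{n..m}. c j * v (\<rho> j))" for c
  proof -
    have "v (\<Sum>j\<in>{1..m}. c j *s \<rho> j) = (\<Sum>j\<in>{1..m}. c j * v (\<rho> j))"
      by (intro v_linear_combination \<rho>_mem)
    also have "\<dots> = (\<Sum>j\<in>{n..m}. c j * v (\<rho> j))"
      using n by (intro sum.mono_neutral_right) (auto intro!: v_\<rho>)
    finally show ?thesis .
  qed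
  have "B = v ` {\<Sum>j\<in>{1..m}. c j *s \<rho> j | c. True}"
    by (simp only: bourbaki_ideal_def minimal_generators_span[OF gens])
  also have "\<dots> = {v (\<Sum>j\<in>{1..m}. c j *s \<rho> j) | c. True}" by blast
  finally show ?thesis by (simp only: split)
qed

lemma v_\<rho>_mem: "j \<in> {n..m} \<Longrightarrow> v (\<rho> j) \<in> B"
  using n by (auto simp: mem_B intro!: bexI[of _ "\<rho> j"] \<rho>_mem)

text \<open>The same combination of the syzygies lies in the kernel of \<open>v\<close>, hence is a
  combination of the first \<open>n - 1\<close> generators. This is a relation among all minimal
  generators.\<close>

lemma relation:
  assumes "(\<Sum>j\<in>{n..m}. c j * v (\<rho> j)) = 0"
  shows "\<forall>j\<in>{n..m}. Poly_Mapping.lookup (c j) 0 = 0"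
proof -
  let ?s = "\<Sum>j\<in>{n..m}. c j *s \<rho> j"
  have mem: "\<rho> j \<in> D0 f" if "j \<in> {n..m}" for j using that n by (intro \<rho>_mem) auto
  have "v ?s = 0" using assms v_linear_combination[of "{n..m}" c] mem by simp
  moreover have "?s \<in> D0 f" using mem by (intro D0_sum D0_scale)
  ultimately obtain a where a: "?s = (\<Sum>j\<in>{1..n - 1}. a j *s \<rho> j)"
    using ker_v unfolding syzygy_combination_def by blast
  define c' where "c' j = (if j < n then - a j else c j)" for j
  have "{1..m} = {1..n - 1} \<union> {n..m}" "{1..n - 1} \<inter> {n..m} = {}" using n m by auto
  then have "(\<Sum>j\<in>{1..m}. c' j *s \<rho> j) = (\<Sum>j\<in>{1..n - 1}. c' j *s \<rho> j) + (\<Sum>j\<in>{n..m}. c' j *s \<rho> j)"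
    by (simp add: sum.union_disjoint)
  also have "(\<Sum>j\<in>{1..n - 1}. c' j *s \<rho> j) = - (\<Sum>j\<in>{1..n - 1}. a j *s \<rho> j)"
    unfolding sum_negf[symmetric] by (intro sum.cong) (auto simp: c'_def)
  also have "(\<Sum>j\<in>{n..m}. c' j *s \<rho> j) = ?s" by (intro sum.cong) (auto simp: c'_def)
  finally have "(\<Sum>j\<in>{1..m}. c' j *s \<rho> j) = 0" using a by simp
  then have "\<forall>j\<in>{1..m}. Poly_Mapping.lookup (c' j) 0 = 0" by (rule minimal_generators_relation[OF gens])
  then have "Poly_Mapping.lookup (c' j) 0 = 0" if "j \<in> {n..m}" for j using that n by simp
  then show ?thesis by (simp add: c'_def)
qed

text \<open>A vanishing value would be a relation with coefficient 1, whose constant term is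
  nonzero.\<close>

lemma v_\<rho>_nonzero:
  assumes "j \<in> {n..m}"
  shows "v (\<rho> j) \<noteq> 0"
proof
  assume "v (\<rho> j) = 0"
  then have "(\<Sum>i\<in>{n..m}. (if i = j then 1 else 0) * v (\<rho> i)) = 0" by (intro sum.neutral) auto
  from relation[OF this] assms have "Poly_Mapping.lookup (if j = j then 1 else 0 :: 'v mpoly) 0 = 0" by blast
  then show False by simp
qed

text \<open>\<open>G\<close> may contain inhomogeneous polynomials, as \<open>min_num_gens\<close>
  ranges over all finite generating sets; comparing constant terms covers them.\<close>

lemma card_le_card_generators:
  assumes G: "finite G" "genideal poly_ring G = B"
  shows "m - n + 1 \<le> card G"
proof -
  have B': "B = {\<Sum>g\<in>G. c g * g | c. True}" using G genideal_finite by blast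
  have "G \<subseteq> B" unfolding G(2)[symmetric] genideal_def by blast
  then have "\<forall>g\<in>G. \<exists>c. g = (\<Sum>j\<in>{n..m}. c j * v (\<rho> j))" using B_eq by blast
  from bchoice[OF this] obtain q where q: "\<forall>g\<in>G. g = (\<Sum>j\<in>{n..m}. q g j * v (\<rho> j))" by (rule exE)
  have "\<forall>j\<in>{n..m}. \<exists>c. v (\<rho> j) = (\<Sum>g\<in>G. c g * g)" using B' v_\<rho>_mem by blast
  from bchoice[OF this] obtain h where h: "\<forall>j\<in>{n..m}. v (\<rho> j) = (\<Sum>g\<in>G. h j g * g)" by (rule exE)
  have "module ((*) :: 'v mpoly \<Rightarrow> _)" by unfold_locales (auto simp: algebra_simps)
  then have "card {n..m} \<le> card G"
    by (rule card_le_generators[where b = "\<lambda>j. v (\<rho> j)" and g = "\<lambda>g. g" and h = h and q = q, OF _ _ G(1)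
          relation h[rule_format] q[rule_format]]) simp_all
  then show ?thesis using m by simp
qed

lemma generators:
  "finite ((\<lambda>j. v (\<rho> j)) ` {n..m})" "genideal poly_ring ((\<lambda>j. v (\<rho> j)) ` {n..m}) = B"
  "card ((\<lambda>j. v (\<rho> j)) ` {n..m}) = m - n + 1"
proof -
  let ?G = "(\<lambda>j. v (\<rho> j)) ` {n..m}"
  show fin: "finite ?G" by simp
  have "is_ideal I \<Longrightarrow> ?G \<subseteq> I \<Longrightarrow> B \<subseteq> I" for I
    unfolding B_eq by (auto intro!: is_ideal_sum is_ideal_mult)
  moreover have "?G \<subseteq> B" using v_\<rho>_mem by blast
  ultimately show gen: "genideal poly_ring ?G = B"
    unfolding genideal_def ideal_poly_ring using is_ideal_B by blast
  \<comment> \<open>Coincident values would leave fewer generators than the lower bound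
    allows.\<close>
  have "card ?G \<le> m - n + 1" using card_image_le[of "{n..m}" "\<lambda>j. v (\<rho> j)"] m by simp
  then show "card ?G = m - n + 1" using card_le_card_generators[OF fin gen] by simp
qed

lemma min_num_gens_B: "min_num_gens poly_ring B = enat (m - n + 1)"
  unfolding min_num_gens_def
proof (rule antisym)
  show "(INF G\<in>{G. finite G \<and> G \<subseteq> carrier poly_ring \<and> genideal poly_ring G = B}. enat (card G)) \<le> enat (m - n + 1)"
    by (rule INF_lower2[of "(\<lambda>j. v (\<rho> j)) ` {n..m}"]) (use generators in auto)
  show "enat (m - n + 1) \<le> (INF G\<in>{G. finite G \<and> G \<subseteq> carrier poly_ring \<and> genideal poly_ring G = B}. enat (card G))"
    using card_le_card_generators by (intro INF_greatest) auto
qed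

lemma B_not_in_prime: "prime_elem p \<Longrightarrow> \<not> B \<subseteq> {q. p dvd q}"
proof -
  assume p: "prime_elem p"
  have "\<rho> n \<in> D0 f" "v (\<rho> n) \<noteq> 0" using n m v_\<rho>_nonzero[of n] by (auto intro: \<rho>_mem)
  then obtain \<sigma> where "\<sigma> \<in> D0 f" "\<not> p dvd v \<sigma>" using v_not_all_dvd[OF p _ _ ker_v] by blast
  moreover from this have "v \<sigma> \<in> B" by (auto simp: mem_B)
  ultimately show ?thesis by blast
qed

section \<open>Dimension and saturation\<close>

lemma krull_dim_B: "krull_dim (poly_ring Quot B) \<le> ereal (real (n - 1))"
  using krull_dim_quot_le[OF is_ideal_B v_\<rho>_mem[of n] v_\<rho>_nonzero[of n] B_not_in_prime] m card by simp

text \<open>The obstruction to lifting \<open>g\<close> is the class of \<open>x \<sigma>\<^sub>y - y \<sigma>\<^sub>x\<close>; the free module spanned by \<open>\<rho>\<^sub>1, \<dots>, \<rho>\<^sub>n\<^sub>-\<^sub>1\<close> has depth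
  at least \<open>3\<close>, so the Koszul cocycle is a coboundary.\<close>

lemma var_mult_mem_B:
  assumes all: "\<And>x. var x * g \<in> B"
  shows "g \<in> B"
proof -
  have "\<exists>T :: 'v set. T \<subseteq> UNIV \<and> card T = 3" using card n obtain_subset_with_card_n[of 3 "UNIV :: 'v set"] by auto
  then obtain x y z :: 'v where xyz: "x \<noteq> y" "z \<noteq> x" "z \<noteq> y" by (metis card_3_iff)
  obtain \<sigma> where \<sigma>: "\<And>x. \<sigma> x \<in> D0 f" "\<And>x. v (\<sigma> x) = var x * g" using all unfolding mem_B by metis
  have "\<exists>a. var i *s \<sigma> j - var j *s \<sigma> i = syzygy_combination n \<rho> a" for i j
    by (intro ker_v) (simp_all add: D0_diff D0_scale \<sigma> v_diff v_scale)
  then obtain a where a: "\<And>i j. var i *s \<sigma> j - var j *s \<sigma> i = syzygy_combination n \<rho> (a i j)" by metis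
  \<comment> \<open>The cocycle identity: in terms of \<open>\<sigma>\<close> the alternating sum
    cancels, and injectivity of \<open>syzygy_combination\<close> carries this over to the
    coefficients.\<close>
  have "syzygy_combination n \<rho> (\<lambda>k. var z * a x y k - var y * a x z k + var x * a y z k)
      = var z *s syzygy_combination n \<rho> (a x y) - var y *s syzygy_combination n \<rho> (a x z) + var x *s syzygy_combination n \<rho> (a y z)"
    unfolding syzygy_combination_def
    by (simp add: pvec.scale_sum_right pvec.scale_left_distrib pvec.scale_left_diff_distrib sum.distrib sum_subtractf)
  also have "\<dots> = 0"
    unfolding a[symmetric] by (simp add: vec_eq_iff algebra_simps)
  finally have "var z * a x y k - var y * a x z k + var x * a y z k = 0" if "k \<in> {1..n - 1}" for k
    using combination_inj that by blast
  then have "var z * a x y k = var y * a x z k - var x * a y z k" if "k \<in> {1..n - 1}" for k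
    using that by (simp add: algebra_simps eq_diff_eq)
  then have "\<forall>k\<in>{1..n - 1}. \<exists>qp. a x y k = var x * fst qp - var y * snd qp"
    using var_mult_mem_two_vars[OF xyz(2,3)] by (metis fst_conv snd_conv)
  from bchoice[OF this] obtain qp where qp: "\<forall>k\<in>{1..n - 1}. a x y k = var x * fst (qp k) - var y * snd (qp k)" by (rule exE)
  \<comment> \<open>Corrections from the kernel of \<open>v\<close>: they give
    \<open>x * (\<sigma> y - ?q) = y * (\<sigma> x - ?p)\<close>, so \<open>x\<close> divides
    \<open>\<sigma> x - ?p\<close>, and the quotient is the wanted preimage of
    \<open>g\<close>.\<close>
  let ?q = "syzygy_combination n \<rho> (\<lambda>k. fst (qp k))" and ?p = "syzygy_combination n \<rho> (\<lambda>k. snd (qp k))"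
  have "syzygy_combination n \<rho> (a x y) = (\<Sum>k\<in>{1..n - 1}. (var x * fst (qp k) - var y * snd (qp k)) *s \<rho> k)"
    unfolding syzygy_combination_def using qp by (intro sum.cong) auto
  also have "\<dots> = var x *s ?q - var y *s ?p"
    unfolding syzygy_combination_def
    by (simp add: pvec.scale_sum_right pvec.scale_left_diff_distrib sum_subtractf)
  finally have "var x *s \<sigma> y - var y *s \<sigma> x = var x *s ?q - var y *s ?p" using a by simp
  then have eq: "var x * (\<sigma> y - ?q) $ l = var y * (\<sigma> x - ?p) $ l" for l
    by (simp add: vec_eq_iff algebra_simps)
  have "var x dvd (\<sigma> x - ?p) $ l" for l
    using eq[of l] xyz(1) by (metis dvd_triv_left var_dvd_var_mult)
  then have "\<exists>t. (\<sigma> x - ?p) $ l = var x * t" for l by (meson dvdE)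
  then obtain t where t: "\<And>l. (\<sigma> x - ?p) $ l = var x * t l" by metis
  define \<tau> where "\<tau> = (\<chi> l. t l)"
  have \<tau>: "\<sigma> x - ?p = var x *s \<tau>" using t by (simp add: vec_eq_iff \<tau>_def)
  have "var x *s \<tau> \<in> D0 f" unfolding \<tau>[symmetric] by (intro D0_diff \<sigma> v_combination)
  then have "var x * (\<Sum>l\<in>UNIV. \<tau> $ l * partial l f) = 0" by (simp add: D0_def sum_distrib_left mult.assoc)
  then have D: "\<tau> \<in> D0 f" by (simp add: D0_def)
  have "var x * v \<tau> = v (\<sigma> x - ?p)" unfolding \<tau> by (rule v_scale[OF D, symmetric])
  also have "\<dots> = var x * g" by (simp add: v_diff \<sigma> v_combination)
  finally have "v \<tau> = g" by simp
  then show ?thesis using D by (auto simp: mem_B)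
qed

lemma saturated_B: "saturated B"
  using is_ideal_B var_mult_mem_B by (rule saturatedI)

text \<open>The unit ideal needs one generator, so \<open>m - n + 1 \<le> 1\<close>. Conversely, for
  \<open>m = n\<close> the ideal is principal, and no prime element divides its generator.\<close>

lemma B_UNIV_iff: "B = UNIV \<longleftrightarrow> m = n"
proof
  assume "B = UNIV"
  moreover have "genideal poly_ring {1 :: 'v mpoly} = UNIV"
    by (auto simp: genideal_finite)
  ultimately have "m - n + 1 \<le> card {1 :: 'v mpoly}" by (intro card_le_card_generators) auto
  then show "m = n" using m by simp
next
  assume mn: "m = n"
  have "v (\<rho> n) dvd 1"
  proof (rule ccontr)
    assume "\<not> v (\<rho> n) dvd 1"
    then obtain p where "prime_elem p" "p dvd v (\<rho> n)" using prime_dvd_exists v_\<rho>_nonzero[of n] m by auto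
    then show False using B_not_in_prime[of p] mn by (auto simp: B_eq)
  qed
  then obtain u where u: "1 = v (\<rho> n) * u" by (elim dvdE)
  have "1 \<in> B" unfolding u using m by (intro is_ideal_mult_right[OF is_ideal_B] v_\<rho>_mem) simp
  then show "B = UNIV" using is_ideal_eq_UNIV[OF is_ideal_B] by blast
qed

section \<open>Degrees, freeness and complete intersections\<close>

lemma syzygy_hypersurface_iff: "syzygy_hypersurface k f \<longleftrightarrow> k = m"
  by (rule minimal_generators_syzygy_hypersurface[OF gens])

text \<open>The determinant is homogeneous of the sum of its row degrees, with 1 for the row of
  variables; dividing by \<open>f\<close> subtracts \<open>d\<close>.\<close>

lemma degree_v_\<rho>:
  assumes j: "j \<in> {n..m}"
  shows "d \<le> 1 + (\<Sum>i\<in>{1..n - 1}. e i) + e j"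
    "whomog unit_wt (1 + (\<Sum>i\<in>{1..n - 1}. e i) + e j - d) (v (\<rho> j))"
proof -
  let ?K = "1 + (\<Sum>i\<in>{1..n - 1}. e i) + e j"
  define h where "h k = (if k = 0 then 1 else if k < n then e k else e j)" for k
  have hom\<rho>: "whomog unit_wt (e i) (\<rho> i $ l)" if "i \<in> {1..m}" for i l
    using gens that by (auto simp: minimal_generators_def homogeneous_vec_def homogeneous_iff_whomog)
  have "whomog unit_wt (h (position i)) (M (\<rho> j) $ i $ l)" for i l
    using whomog_var[of unit_wt l] hom\<rho>[of "position i" l] hom\<rho>[of j l] j n m
    by (auto simp: syzygy_matrix_def h_def unit_wt_def)
  then have "whomog unit_wt (\<Sum>i\<in>(UNIV :: 'v set). h (position i)) (det (M (\<rho> j)))"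
    by (rule whomog_det)
  moreover have "(\<Sum>i\<in>(UNIV :: 'v set). h (position i)) = ?K"
  proof -
    have "(\<Sum>k\<in>{1..n - 1}. h k) = (\<Sum>k\<in>{1..n - 1}. e k)" by (intro sum.cong) (auto simp: h_def)
    then show ?thesis unfolding sum_position using n by (simp add: h_def)
  qed
  moreover have "\<rho> j \<in> D0 f" using j n by (intro \<rho>_mem) auto
  ultimately have K: "whomog unit_wt ?K (f * v (\<rho> j))" by (simp add: det_M mult.commute)
  have nz: "f * v (\<rho> j) \<noteq> 0" using f_nonzero v_\<rho>_nonzero[OF j] by simp
  have fh: "whomog unit_wt d f" using hom by (simp add: homogeneous_iff_whomog)
  \<comment> \<open>Taking the component of degree \<open>?K\<close> proves both claims: if
    \<open>d > ?K\<close> the product would be 0, and otherwise \<open>f\<close> cancels.\<close>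
  have eq: "f * v (\<rho> j) = (if d \<le> ?K then f * wpart unit_wt (?K - d) (v (\<rho> j)) else 0)"
    using wpart_whomog_mult[OF fh, of ?K "v (\<rho> j)"] wpart_whomog[OF K, of ?K] by simp
  then show dK: "d \<le> ?K" using nz by (metis (full_types))
  then have "v (\<rho> j) = wpart unit_wt (?K - d) (v (\<rho> j))" using eq f_nonzero by simp
  then show "whomog unit_wt (?K - d) (v (\<rho> j))" by (metis whomog_wpart)
qed

lemma B_UNIV_of_degree_0:
  assumes "j \<in> {n..m}" "1 + (\<Sum>i\<in>{1..n - 1}. e i) + e j = d"
  shows "B = UNIV"
proof -
  have "tdeg (v (\<rho> j)) = 0" using degree_v_\<rho>(2)[OF assms(1)] assms by (intro wdeg_whomog v_\<rho>_nonzero) simp_all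
  then have "v (\<rho> j) dvd 1" using unit_iff v_\<rho>_nonzero[OF assms(1)] by blast
  then obtain u where u: "1 = v (\<rho> j) * u" by (elim dvdE)
  have "1 \<in> B" unfolding u by (rule is_ideal_mult_right[OF is_ideal_B v_\<rho>_mem[OF assms(1)]])
  then show ?thesis using is_ideal_eq_UNIV[OF is_ideal_B] by blast
qed

text \<open>Two generators force \<open>m \<le> n + 1\<close>, and \<open>m = n\<close> would make
  \<open>B\<close> the unit ideal. Conversely, the two generators are forms of positive degree,
  which bounds the codimension above; the lower bound holds since no prime element divides
  \<open>B\<close>.\<close>

lemma complete_intersection_iff: "complete_intersection 2 B \<longleftrightarrow> m = n + 1"
proof
  assume ci: "complete_intersection 2 B"
  then obtain G where G: "finite G" "card G = 2" "genideal poly_ring G = B"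
    and cd: "codim poly_ring B = enat 2" by (auto simp: complete_intersection_def)
  have "m - n + 1 \<le> 2" using card_le_card_generators[OF G(1,3)] G(2) by simp
  moreover have "m \<noteq> n"
  proof
    assume "m = n"
    then have "{Q. primeideal Q poly_ring \<and> B \<subseteq> Q} = {}"
      using B_UNIV_iff by (auto simp: primeideal_poly_ring is_prime_def)
    \<comment> \<open>No prime contains the unit ideal, and an infimum over the empty set is
      \<infinity>.\<close>
    then have "codim poly_ring B = Inf (height poly_ring ` ({} :: 'v mpoly set set))" by (simp only: codim_def)
    then have "codim poly_ring B = \<infinity>" by (simp add: top_enat_def)
    then show False using cd by simp
  qed
  ultimately show "m = n + 1" using m by simp
next
  assume mn: "m = n + 1"
  let ?K = "\<lambda>j. 1 + (\<Sum>i\<in>{1..n - 1}. e i) + e j - d"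
  \<comment> \<open>A generator of degree 0 would be a unit, so that \<open>B\<close> is everything
    and \<open>m = n\<close>.\<close>
  have pos: "0 < ?K j" if "j \<in> {n..m}" for j
    using B_UNIV_of_degree_0[OF that] degree_v_\<rho>(1)[OF that] B_UNIV_iff mn by auto
  have "{n..m} = {n, n + 1}" using mn by auto
  then have G: "genideal poly_ring {v (\<rho> n), v (\<rho> (n + 1))} = B" "card {v (\<rho> n), v (\<rho> (n + 1))} = 2"
    using generators(2,3) mn by simp_all
  have hom2: "whomog unit_wt (?K n) (v (\<rho> n))" "whomog unit_wt (?K (n + 1)) (v (\<rho> (n + 1)))"
    using degree_v_\<rho>(2)[of n] degree_v_\<rho>(2)[of "n + 1"] mn by simp_all
  have "codim poly_ring B \<le> enat 2"
    using codim_two_forms_le_2[OF _ hom2] pos mn n card G(1) by simp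
  moreover have "enat 2 \<le> codim poly_ring B"
    using m by (intro codim_ge_2[OF v_\<rho>_mem[of n] v_\<rho>_nonzero[of n] B_not_in_prime]) auto
  ultimately have "codim poly_ring B = enat 2" by (rule antisym)
  moreover have "\<forall>g\<in>{v (\<rho> n), v (\<rho> (n + 1))}. \<exists>e. homogeneous e g"
    using hom2 by (auto simp: homogeneous_iff_whomog)
  ultimately show "complete_intersection 2 B" 
    unfolding complete_intersection_def using G
    by (intro conjI exI[of _ "{v (\<rho> n), v (\<rho> (n + 1))}"]) simp_all
qed

lemma free_iff: "free_hypersurface n f \<longleftrightarrow> m = n"
  by (auto simp: free_hypersurface_def syzygy_hypersurface_iff)

lemma degree_bound: "\<forall>j\<in>{n..m}. d - 1 \<le> (\<Sum>i\<in>{1..n - 1}. e i) + e j"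
  using degree_v_\<rho>(1) by fastforce

text \<open>Equality means that some generator of \<open>B\<close> has degree 0 and is a unit.
  Conversely, in the free case \<open>v (\<rho> n)\<close> generates the unit ideal, so equality
  holds at \<open>j = n\<close>.\<close>

lemma degree_equality_iff:
  "(\<exists>j\<in>{n..m}. (\<Sum>i\<in>{1..n - 1}. e i) + e j = d - 1) \<longleftrightarrow> free_hypersurface n f"
proof
  assume "\<exists>j\<in>{n..m}. (\<Sum>i\<in>{1..n - 1}. e i) + e j = d - 1"
  \<comment> \<open>Since \<open>d\<close> is positive, the truncated \<open>d - 1\<close> causes no
    loss.\<close>
  then obtain j where "j \<in> {n..m}" "1 + (\<Sum>i\<in>{1..n - 1}. e i) + e j = d" using d by auto
  then show "free_hypersurface n f" using B_UNIV_of_degree_0 B_UNIV_iff free_iff by blast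
next
  assume "free_hypersurface n f"
  then have mn: "m = n" and "B = UNIV" using free_iff B_UNIV_iff by auto
  then obtain c where "1 = c n * v (\<rho> n)" using B_eq by (auto simp: set_eq_iff dest: spec[of _ 1])
  then have "v (\<rho> n) dvd 1" by (metis dvd_triv_right)
  then have "tdeg (v (\<rho> n)) = 0" using unit_iff by blast
  then have "1 + (\<Sum>i\<in>{1..n - 1}. e i) + e n - d = 0"
    using wdeg_whomog[OF degree_v_\<rho>(2)[of n] v_\<rho>_nonzero[of n]] m by simp
  then have "(\<Sum>i\<in>{1..n - 1}. e i) + e n = d - 1" using degree_v_\<rho>(1)[of n] m by simp
  then show "\<exists>j\<in>{n..m}. (\<Sum>i\<in>{1..n - 1}. e i) + e j = d - 1" using m by (intro bexI[of _ n]) auto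
qed

end

theorem theorem4p1:
  fixes n d m :: nat
    and f :: "('v::{finite, linorder}) mpoly"
    and \<rho> :: "nat \<Rightarrow> 'v mvec"
    and e :: "nat \<Rightarrow> nat"
  assumes "n \<ge> 2" and "CARD('v) = n + 1"
    and "d \<ge> 3" and "homogeneous d f" and "squarefree f" and "\<not> is_cone f"
    and "m \<ge> n" and "minimal_generators f m \<rho> e"
    and "tame n f \<rho>"
  shows "(saturated (bourbaki_ideal n f \<rho>) \<and>
          krull_dim (poly_ring Quot (bourbaki_ideal n f \<rho>)) \<le> ereal (real (n - 1)) \<and>
          min_num_gens poly_ring (bourbaki_ideal n f \<rho>) = enat (m - n + 1)) \<and>
         (free_hypersurface n f \<longleftrightarrow> bourbaki_ideal n f \<rho> = carrier poly_ring) \<and>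
         (syzygy_hypersurface (n + 1) f \<longleftrightarrow> complete_intersection 2 (bourbaki_ideal n f \<rho>)) \<and>
         ((\<forall>j\<in>{n..m}. (\<Sum>i\<in>{1..n - 1}. e i) + e j \<ge> d - 1) \<and>
          ((\<exists>j\<in>{n..m}. (\<Sum>i\<in>{1..n - 1}. e i) + e j = d - 1) \<longleftrightarrow> free_hypersurface n f))"
proof -
  interpret tame_hypersurface n d f \<rho> m e
    using assms by unfold_locales (auto simp: minimal_generators_def)
  show ?thesis
    using saturated_B krull_dim_B min_num_gens_B free_iff B_UNIV_iff syzygy_hypersurface_iff
      complete_intersection_iff degree_bound degree_equality_iff
    by auto
qed

end
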